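(* Let $\Gamma$ be a cocompact discrete subgroup of $\mathrm{PSL}_2(\mathbb{C})$ and $p\in\Gamma\backslash\mathcal{H}$. Suppose $X>1$, $T>1$, and $x_1,\dots,x_R\in[X,2X]$ with $|x_k-x_l|>\epsilon>0$ for all $k\ne l$. Then for all complex numbers $a_j$, \[\sum_{k=1}^R\Big|\sum_{|t_j|\le T}a_jx_k^{it_j}u_j(p)\Big|^2\ll\big(T^3+XT^2\epsilon^{-1}\big)\sum_{|t_j|\le T}|a_j|^2.\]
   Context: $\mathcal{H}$ is hyperbolic $3$-space (upper half-space) with Laplacian $\Delta=y^2(\partial_{x_1}^2+\partial_{x_2}^2+\partial_y^2)-y\partial_y$. $\{u_j\}$ is a complete orthonormal system of eigenfunctions of $-\Delta$ on $L^2(\Gamma\backslash\mathcal{H})$ with eigenvalues $\lambda_j=1+t_j^2$, where $t_j\in\mathbb{R}$ or $t_j\in i\mathbb{R}$. The implied constant depends on $\Gamma$ and $p$.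
   Formalization: For purely imaginary t_j the root of λ_j = 1 + t_j² with Im t_j ≥ 0 is taken; with t_0 = -i the bound fails (R = 1, T = 2, a_0 = 1, other a_j = 0, ε = X, X → ∞). *)

theory Defs
  imports "HOL-Analysis.Analysis" "HOL-Algebra.Coset"
begin

definition quot_topology :: "'a topology \<Rightarrow> ('a \<Rightarrow> 'b) \<Rightarrow> 'b topology" where
  "quot_topology X q =
     topology (\<lambda>U. U \<subseteq> q ` topspace X \<and> openin X {x \<in> topspace X. q x \<in> U})"

lemma openin_quot_topology:
  "openin (quot_topology X q) U \<longleftrightarrow>
     U \<subseteq> q ` topspace X \<and> openin X {x \<in> topspace X. q x \<in> U}"
proof -
  have "istopology (\<lambda>U. U \<subseteq> q ` topspace X \<and> openin X {x \<in> topspace X. q x \<in> U})"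
    unfolding istopology_def
  proof (intro conjI allI impI; (elim conjE)?)
    fix S T
    assume "openin X {x \<in> topspace X. q x \<in> S}" "openin X {x \<in> topspace X. q x \<in> T}"
    then have "openin X ({x \<in> topspace X. q x \<in> S} \<inter> {x \<in> topspace X. q x \<in> T})"
      by (rule openin_Int)
    moreover have "{x \<in> topspace X. q x \<in> S} \<inter> {x \<in> topspace X. q x \<in> T}
      = {x \<in> topspace X. q x \<in> S \<inter> T}" by auto
    ultimately show "openin X {x \<in> topspace X. q x \<in> S \<inter> T}" by simp
  next
    fix K
    assume K: "\<forall>U\<in>K. U \<subseteq> q ` topspace X \<and> openin X {x \<in> topspace X. q x \<in> U}"
    have "openin X (\<Union>U\<in>K. {x \<in> topspace X. q x \<in> U})"
      using K by (intro openin_Union) auto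
    moreover have "(\<Union>U\<in>K. {x \<in> topspace X. q x \<in> U}) = {x \<in> topspace X. q x \<in> \<Union>K}" by auto
    ultimately show "openin X {x \<in> topspace X. q x \<in> \<Union>K}" by simp
  qed auto
  then show ?thesis
    by (simp add: quot_topology_def topology_inverse')
qed

lemma topspace_quot_topology [simp]: "topspace (quot_topology X q) = q ` topspace X"
proof
  show "topspace (quot_topology X q) \<subseteq> q ` topspace X"
    using openin_quot_topology[of X q "topspace (quot_topology X q)"] by auto
  have "{x \<in> topspace X. q x \<in> q ` topspace X} = topspace X" by auto
  then have "openin (quot_topology X q) (q ` topspace X)"
    by (simp add: openin_quot_topology)
  then show "q ` topspace X \<subseteq> topspace (quot_topology X q)"
    by (rule openin_subset)
qed

lemma quotient_map_quot_topology: "quotient_map X (quot_topology X q) q"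
  by (auto simp: quotient_map_def openin_quot_topology)

definition borel_of_topology :: "'a topology \<Rightarrow> 'a measure" where
  "borel_of_topology X = sigma (topspace X) {U. openin X U}"


definition SL2C :: "(complex^2^2) monoid" where
  "SL2C = \<lparr>carrier = {A. det A = 1}, mult = (**), one = mat 1\<rparr>"

lemma group_SL2C: "group SL2C"
proof (rule groupI)
  fix A assume "A \<in> carrier SL2C"
  then have A: "det A = 1" by (simp add: SL2C_def)
  then obtain B where B: "B ** A = mat 1"
    by (metis invertible_det_nz invertible_left_inverse one_neq_zero)
  then have "det B = 1" using A by (metis det_I det_mul mult.right_neutral)
  with B show "\<exists>B\<in>carrier SL2C. B \<otimes>\<^bsub>SL2C\<^esub> A = \<one>\<^bsub>SL2C\<^esub>"
    by (auto simp: SL2C_def)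
qed (auto simp: SL2C_def det_mul matrix_mul_assoc)

definition PSL2C :: "(complex^2^2) set monoid" where
  "PSL2C = SL2C Mod {mat 1, - mat 1}"

definition PSL2C_topology :: "(complex^2^2) set topology" where
  "PSL2C_topology =
     quot_topology (top_of_set (carrier SL2C)) (\<lambda>A. {mat 1, - mat 1} #>\<^bsub>SL2C\<^esub> A)"

definition discrete_subgroup :: "(complex^2^2) set set \<Rightarrow> bool" where
  "discrete_subgroup \<Gamma> \<longleftrightarrow>
     subgroup \<Gamma> PSL2C \<and> subtopology PSL2C_topology \<Gamma> = discrete_topology \<Gamma>"

text \<open>A point \<open>(x\<^sub>1, x\<^sub>2, y)\<close> of the upper half-space is the pair \<open>(x\<^sub>1 + i x\<^sub>2, y)\<close>.\<close>

definition hyp3 :: "(complex \<times> real) set" where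
  "hyp3 = {P. snd P > 0}"

text \<open>In quaternion notation \<open>P = z + y j\<close> this is \<open>(a P + b) (c P + d)\<^sup>-\<^sup>1\<close>.\<close>

definition sl2_act :: "complex^2^2 \<Rightarrow> complex \<times> real \<Rightarrow> complex \<times> real" where
  "sl2_act A P =
     (let a = A $ 1 $ 1; b = A $ 1 $ 2; c = A $ 2 $ 1; d = A $ 2 $ 2;
          z = fst P; y = snd P;
          N = (cmod (c * z + d))\<^sup>2 + (cmod c)\<^sup>2 * y\<^sup>2
      in (((a * z + b) * cnj (c * z + d) + a * cnj c * of_real (y\<^sup>2)) / of_real N, y / N))"

lemma sl2_act_uminus: "sl2_act (- A) P = sl2_act A P"
proof -
  have "cmod (- (A $ 2 $ 1 * fst P) - A $ 2 $ 2) = cmod (A $ 2 $ 1 * fst P + A $ 2 $ 2)"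
    by (metis minus_add_distrib norm_minus_cancel uminus_add_conv_diff add.commute)
  then show ?thesis
    by (simp add: sl2_act_def Let_def) (simp add: algebra_simps)
qed

lemma sl2_act_mem_hyp3:
  assumes "det A = 1" "P \<in> hyp3"
  shows "sl2_act A P \<in> hyp3"
proof -
  have y: "snd P > 0" using assms(2) by (simp add: hyp3_def)
  have "(cmod (A $ 2 $ 1 * fst P + A $ 2 $ 2))\<^sup>2 + (cmod (A $ 2 $ 1))\<^sup>2 * (snd P)\<^sup>2 > 0"
  proof (cases "A $ 2 $ 1 = 0")
    case True
    then have "A $ 2 $ 2 \<noteq> 0" using assms(1) by (auto simp: det_2)
    with True show ?thesis by simp
  next
    case False
    then show ?thesis using y by (intro add_nonneg_pos mult_pos_pos) auto
  qed
  then show ?thesis using y by (simp add: sl2_act_def Let_def hyp3_def)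
qed

lemma sl2_act_one: "sl2_act (mat 1) P = P"
  by (simp add: sl2_act_def Let_def mat_def)

lemma PSL2C_carrier: "carrier PSL2C = (\<lambda>A. {A, - A}) ` {A. det A = 1}"
proof -
  have "- mat 1 ** A = - A" for A :: "complex^2^2"
    by (simp add: vec_eq_iff forall_2 matrix_matrix_mult_def sum_2 mat_def)
  then have "{mat 1, - mat 1} #>\<^bsub>SL2C\<^esub> A = {A, - A}" for A
    by (auto simp: r_coset_def SL2C_def)
  then show ?thesis
    by (auto simp: PSL2C_def FactGroup_def RCOSETS_def SL2C_def)
qed

text \<open>Elements of \<open>\<Gamma>\<close> are cosets \<open>{A, -A}\<close>, so \<open>\<Union>\<Gamma>\<close> is the preimage of \<open>\<Gamma>\<close> in
  \<open>SL\<^sub>2(\<complex>)\<close>; the two representatives of a coset act in the same way.\<close>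

definition hyp_orbit :: "(complex^2^2) set set \<Rightarrow> complex \<times> real \<Rightarrow> (complex \<times> real) set" where
  "hyp_orbit \<Gamma> P = (\<lambda>A. sl2_act A P) ` \<Union>\<Gamma>"

definition orbit_space :: "(complex^2^2) set set \<Rightarrow> (complex \<times> real) set set" where
  "orbit_space \<Gamma> = hyp_orbit \<Gamma> ` hyp3"

definition orbit_topology :: "(complex^2^2) set set \<Rightarrow> (complex \<times> real) set topology" where
  "orbit_topology \<Gamma> = quot_topology (top_of_set hyp3) (hyp_orbit \<Gamma>)"

definition cocompact :: "(complex^2^2) set set \<Rightarrow> bool" where
  "cocompact \<Gamma> \<longleftrightarrow> compact_space (orbit_topology \<Gamma>)"

definition hyp_vol :: "(complex \<times> real) measure" where
  "hyp_vol = density lborel (\<lambda>P. ennreal (indicator hyp3 P / (snd P) ^ 3))"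

definition fundamental_domain ::
  "(complex^2^2) set set \<Rightarrow> (complex \<times> real) set \<Rightarrow> bool" where
  "fundamental_domain \<Gamma> F \<longleftrightarrow>
     F \<in> sets borel \<and> F \<subseteq> hyp3 \<and> (\<forall>P\<in>hyp3. \<exists>!Q. Q \<in> F \<inter> hyp_orbit \<Gamma> P)"

text \<open>The measure induced on \<open>\<Gamma>\<close>-orbits by the hyperbolic volume. For discrete \<open>\<Gamma>\<close> a
  fundamental domain exists (a Dirichlet domain with a measurable choice of boundary points),
  and the measure does not depend on which one is chosen.\<close>

definition orbit_vol :: "(complex^2^2) set set \<Rightarrow> (complex \<times> real) set measure" where
  "orbit_vol \<Gamma> =
     distr (restrict_space hyp_vol (SOME F. fundamental_domain \<Gamma> F))
       (borel_of_topology (orbit_topology \<Gamma>)) (hyp_orbit \<Gamma>)"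

definition square_integrable :: "'a measure \<Rightarrow> ('a \<Rightarrow> complex) \<Rightarrow> bool" where
  "square_integrable M f \<longleftrightarrow> f \<in> borel_measurable M \<and> integrable M (\<lambda>x. (cmod (f x))\<^sup>2)"

definition complete_orthonormal :: "'a measure \<Rightarrow> (nat \<Rightarrow> 'a \<Rightarrow> complex) \<Rightarrow> bool" where
  "complete_orthonormal M u \<longleftrightarrow>
     (\<forall>j. square_integrable M (u j)) \<and>
     (\<forall>i j. (LINT x|M. u i x * cnj (u j x)) = (if i = j then 1 else 0)) \<and>
     (\<forall>f e. square_integrable M f \<and> e > 0 \<longrightarrow>
        (\<exists>n c. (LINT x|M. (cmod (f x - (\<Sum>j<n. c j * u j x)))\<^sup>2) < e))"


definition partial :: "'a::real_normed_vector \<Rightarrow> ('a \<Rightarrow> complex) \<Rightarrow> 'a \<Rightarrow> complex" where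
  "partial v f P = vector_derivative (\<lambda>s. f (P + s *\<^sub>R v)) (at 0)"

definition C2_on :: "'a::euclidean_space set \<Rightarrow> ('a \<Rightarrow> complex) \<Rightarrow> bool" where
  "C2_on S f \<longleftrightarrow>
     f differentiable_on S \<and>
     (\<forall>v\<in>Basis. partial v f differentiable_on S) \<and>
     (\<forall>v\<in>Basis. \<forall>w\<in>Basis. continuous_on S (partial w (partial v f)))"

definition hyp_laplacian :: "(complex \<times> real \<Rightarrow> complex) \<Rightarrow> complex \<times> real \<Rightarrow> complex" where
  "hyp_laplacian f P =
     (let y = snd P; e\<^sub>1 = (1, 0); e\<^sub>2 = (\<i>, 0); e\<^sub>3 = (0, 1)
      in of_real (y\<^sup>2) * (partial e\<^sub>1 (partial e\<^sub>1 f) P + partial e\<^sub>2 (partial e\<^sub>2 f) P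
           + partial e\<^sub>3 (partial e\<^sub>3 f) P) - of_real y * partial e\<^sub>3 f P)"

text \<open>A function \<open>u\<close> on the orbit space is regarded, as usual, as the \<open>\<Gamma>\<close>-invariant
  function \<open>u \<circ> hyp_orbit \<Gamma>\<close> on the half-space. Eigenfunctions are taken to be of class
  \<open>C\<^sup>2\<close>, so that the eigenvalue equation and point values make sense.\<close>

definition laplace_eigenfunction ::
  "(complex^2^2) set set \<Rightarrow> complex \<Rightarrow> ((complex \<times> real) set \<Rightarrow> complex) \<Rightarrow> bool" where
  "laplace_eigenfunction \<Gamma> ev u \<longleftrightarrow>
     C2_on hyp3 (u \<circ> hyp_orbit \<Gamma>) \<and>
     (\<forall>P\<in>hyp3. - hyp_laplacian (u \<circ> hyp_orbit \<Gamma>) P = ev * u (hyp_orbit \<Gamma> P))"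

text \<open>The equation \<open>\<lambda>\<^sub>j = 1 + t\<^sub>j\<^sup>2\<close> determines \<open>t\<^sub>j\<close> up to sign. For the purely imaginary
  ones (\<open>\<lambda>\<^sub>j < 1\<close>) the root with nonnegative imaginary part is meant: then
  \<open>\<bar>x powr (i t\<^sub>j)\<bar> \<le> 1\<close> for \<open>x > 1\<close>, whereas for \<open>\<lambda>\<^sub>0 = 0\<close> and \<open>t\<^sub>0 = -i\<close> one has
  \<open>x powr (i t\<^sub>0) = x\<close>.\<close>

definition spectral_system ::
  "(complex^2^2) set set \<Rightarrow> (nat \<Rightarrow> (complex \<times> real) set \<Rightarrow> complex) \<Rightarrow> (nat \<Rightarrow> complex) \<Rightarrow> bool"
  where
  "spectral_system \<Gamma> u t \<longleftrightarrow>
     complete_orthonormal (orbit_vol \<Gamma>) u \<and>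
     (\<forall>j. laplace_eigenfunction \<Gamma> (1 + (t j)\<^sup>2) (u j)) \<and>
     (\<forall>j. Im (t j) = 0 \<or> Re (t j) = 0 \<and> Im (t j) \<ge> 0)"

end

theory Submission
  imports Defs
begin

text \<open>
  Write \<open>x\<^sub>k = X e\<^sup>y\<close> with \<open>0 \<le> y \<le> log 2\<close>. The points \<open>y\<close> are \<open>\<delta>\<close>-separated with
  \<open>\<delta> \<approx> \<epsilon> / X\<close>, so Gallagher's lemma bounds the sum over \<open>k\<close> of \<open>\<bar>S(y)\<bar>\<^sup>2\<close>, where
  \<open>S(y) = \<Sum>\<^sub>j a\<^sub>j u\<^sub>j(p) X\<^sup>i\<^sup>t e\<^sup>i\<^sup>t\<^sup>y\<close>, by \<open>(1/\<delta> + T) \<integral>\<bar>S\<bar>\<^sup>2 + T\<^sup>-\<^sup>1 \<integral>\<bar>S'\<bar>\<^sup>2\<close> over an interval of bounded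
  length. Expanding the square against a weight whose Fourier transform is \<open>O(1 / (1 + \<tau>\<^sup>2))\<close> and applying
  Schur's test, \<open>\<integral>\<bar>S\<bar>\<^sup>2 \<lless> sup\<^sub>j \<Sum>\<^sub>l \<bar>u\<^sub>l(p)\<bar>\<^sup>2 / (1 + (t\<^sub>j - t\<^sub>l)\<^sup>2) \<cdot> \<Sum>\<bar>a\<^sub>j\<bar>\<^sup>2\<close>, and everything follows from
  the local Weyl bound that \<open>\<Sum>\<bar>u\<^sub>j(p)\<bar>\<^sup>2\<close> over \<open>\<tau> \<le> \<bar>t\<^sub>j\<bar> \<le> \<tau> + 1\<close> is \<open>O((1 + \<tau>)\<^sup>2)\<close>. The eigenfunctions with \<open>t\<^sub>j\<close>
  imaginary are handled by the bound \<open>\<Sum>\<bar>u\<^sub>j(p)\<bar>\<^sup>2 = O(1)\<close> and the number of points.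

  The local Weyl bound is Bessel's inequality for an automorphic kernel supported in a ball of radius \<open>1\<close>
  around \<open>p\<close>. By the mean value property, a radial kernel \<open>\<kappa>(r) / sinh r\<close> acts on an eigenfunction by
  \<open>4 \<pi> \<integral> \<kappa>(r) sin (t r) / t dr\<close> and has squared norm \<open>4 \<pi> \<integral> \<kappa>\<^sup>2\<close>; the choice \<open>\<kappa>(r) = \<tau> sin (\<tau> r) (1 - r)\<close> gives
  eigenvalues bounded below for \<open>\<bar>t\<bar>\<close> near \<open>\<tau>\<close> at the cost of norm \<open>\<tau>\<^sup>2\<close>.
\<close>

section \<open>Green's identity for radial test functions\<close>

text \<open>Three points are left open by this outline. (1) Why a sine transform appears: in
  dimension three, dividing a radial function by \<open>sinh r\<close> turns the Laplacian plus
  \<open>1\<close> into the plain second derivative, so an eigenfunction with parameter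
  \<open>t\<close> tests against \<open>F'' + t ^ 2 * F\<close>, which has constant coefficients.
  The price is the singularity of \<open>1 / sinh r\<close> at the centre, where Green's identity
  does not apply; shrinking a cut-off around it produces the value at the centre. (2) Kernels live
  on the half-space, orthonormality on the orbit space, whose measure comes from a chosen
  fundamental domain. The passage uses a Borel fundamental domain, invariance of the volume, and a
  count of the group elements that move some point of the unit ball around \<open>P\<close> into
  that ball. (3) The oscillating kernel is used for \<open>\<tau> \<ge> 3\<close>; smaller and
  imaginary parameters share a fixed, narrow, nonnegative kernel. The final constant depends on
  \<open>\<Gamma>\<close> and \<open>P\<close> through that count alone.\<close>

text \<open>\<open>hcosh P Q\<close> is the hyperbolic cosine of the hyperbolic distance.\<close>

definition hcosh :: "complex \<times> real \<Rightarrow> complex \<times> real \<Rightarrow> real" where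
  "hcosh P Q = ((cmod (fst P - fst Q))\<^sup>2 + (snd P)\<^sup>2 + (snd Q)\<^sup>2) / (2 * snd P * snd Q)"

lemma has_vector_derivative_line:
  fixes f :: "'a::euclidean_space \<Rightarrow> 'b::real_normed_vector"
  assumes "((\<lambda>s. f ((P + x *\<^sub>R v) + s *\<^sub>R v)) has_vector_derivative D) (at 0)"
  shows "((\<lambda>s. f (P + s *\<^sub>R v)) has_vector_derivative D) (at x)"
proof -
  have "((\<lambda>s. f ((P + x *\<^sub>R v) + s *\<^sub>R v)) has_vector_derivative D) (at (x - x))"
    using assms by simp
  then have "((\<lambda>s. f ((P + x *\<^sub>R v) + s *\<^sub>R v)) \<circ> (\<lambda>s. s - x) has_vector_derivative 1 *\<^sub>R D) (at x)"
    by (intro vector_diff_chain_at) (auto intro!: derivative_eq_intros)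
  then show ?thesis
    by (simp add: o_def algebra_simps)
qed

text \<open>Difference quotients along \<open>v\<close> integrate to zero by translation invariance
  of Lebesgue measure, and dominated convergence passes to the derivative. Applied to each component
  of a compactly supported field, this takes the place of the divergence theorem.\<close>

lemma integral_directional_derivative_eq_0:
  fixes f f' :: "'a::euclidean_space \<Rightarrow> complex"
  assumes der: "\<And>P. ((\<lambda>s. f (P + s *\<^sub>R v)) has_vector_derivative f' P) (at 0)"
    and int: "integrable lborel f" and meas: "f' \<in> borel_measurable borel"
    and supp: "\<And>P. P \<notin> K \<Longrightarrow> f' P = 0" and K: "compact K"
    and bnd: "\<And>P. norm (f' P) \<le> B"
  shows "(\<integral>P. f' P \<partial>lborel) = 0"
proof -
  define s :: "nat \<Rightarrow> real" where "s n = inverse (real (Suc n))" for n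
  define q where "q n P = (f (P + s n *\<^sub>R v) - f P) /\<^sub>R s n" for n P
  \<comment> \<open>A difference quotient of step at most \<open>1\<close> can be nonzero only where
    the segment in direction \<open>v\<close> meets \<open>K\<close>. These points make up
    \<open>K'\<close>, which carries the majorant.\<close>
  define K' where "K' = (\<lambda>(x, t). x + t *\<^sub>R v) ` (K \<times> {-1..0::real})"
  have s: "0 < s n" "s n \<le> 1" for n
    by (auto simp: s_def field_simps)
  have B: "B \<ge> 0" using bnd[of 0] norm_ge_zero order_trans by blast
  have compK': "compact K'"
    unfolding K'_def using K
    by (intro compact_continuous_image compact_Times) (auto intro!: continuous_intros simp: case_prod_beta)
  have shift: "integrable lborel (\<lambda>P. f (P + c))" "(\<integral>P. f (P + c) \<partial>lborel) = (\<integral>P. f P \<partial>lborel)" for c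
  proof -
    have "integrable (distr lborel borel ((+) c)) f"
      using int by (simp add: lborel_distr_plus)
    then show "integrable lborel (\<lambda>P. f (P + c))"
      by (subst (asm) integrable_distr_eq) (use int in \<open>auto simp: add.commute\<close>)
    have "(\<integral>P. f P \<partial>lborel) = (\<integral>P. f P \<partial>distr lborel borel ((+) c))"
      by (simp add: lborel_distr_plus)
    also have "\<dots> = (\<integral>P. f (P + c) \<partial>lborel)"
      by (subst integral_distr) (use int in \<open>auto simp: add.commute\<close>)
    finally show "(\<integral>P. f (P + c) \<partial>lborel) = (\<integral>P. f P \<partial>lborel)" by simp
  qed
  have q0: "(\<integral>P. q n P \<partial>lborel) = 0" for n
    unfolding q_def by (simp add: Bochner_Integration.integral_diff shift int)
  have "(\<lambda>n. \<integral>P. q n P \<partial>lborel) \<longlonglongrightarrow> (\<integral>P. f' P \<partial>lborel)"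
  proof (rule integral_dominated_convergence[where w = "\<lambda>P. indicator K' P * B"])
    show "f' \<in> borel_measurable lborel" using meas by simp
    show "q n \<in> borel_measurable lborel" for n
      unfolding q_def using shift(1)[of "s n *\<^sub>R v"] int by (auto intro!: borel_measurable_scaleR borel_measurable_diff)
    show "integrable lborel (\<lambda>P. indicator K' P * B)"
      using compK' by (auto intro!: emeasure_compact_finite borel_compact integrable_mult_left)
    have "(\<lambda>n. q n P) \<longlonglongrightarrow> f' P" for P
    proof -
      have *: "((\<lambda>y. (f (P + y *\<^sub>R v) - f P) /\<^sub>R y) \<longlongrightarrow> f' P) (at 0)"
      proof -
        have "((\<lambda>y. norm (f (P + y *\<^sub>R v) - f P - y *\<^sub>R f' P) / norm y) \<longlongrightarrow> 0) (at 0)"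
          using der[of P] by (simp add: has_vector_derivative_def has_derivative_at)
        moreover have "norm (f (P + y *\<^sub>R v) - f P - y *\<^sub>R f' P) / norm y =
            norm ((f (P + y *\<^sub>R v) - f P) /\<^sub>R y - f' P)" if "y \<noteq> 0" for y
        proof -
          have "(f (P + y *\<^sub>R v) - f P) /\<^sub>R y - f' P = (f (P + y *\<^sub>R v) - f P - y *\<^sub>R f' P) /\<^sub>R y"
            using that by (simp add: algebra_simps)
          then show ?thesis by (simp add: divide_inverse mult.commute)
        qed
        ultimately have "((\<lambda>y. norm ((f (P + y *\<^sub>R v) - f P) /\<^sub>R y - f' P)) \<longlongrightarrow> 0) (at 0)"
          by (subst (asm) LIM_equal) auto
        then show ?thesis
          using Lim_null tendsto_norm_zero_iff by blast
      qed
      have "((\<lambda>y. (f (P + y *\<^sub>R v) - f P) /\<^sub>R y) \<circ> s) \<longlonglongrightarrow> f' P"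
      proof -
        have "s \<longlonglongrightarrow> 0" unfolding s_def[abs_def] by (rule LIMSEQ_inverse_real_of_nat)
        moreover have "s n \<noteq> 0" for n using s(1)[of n] by simp
        ultimately show ?thesis
          using * unfolding tendsto_at_iff_sequentially by blast
      qed
      then show ?thesis
        by (simp add: q_def o_def)
    qed
    then show "AE P in lborel. (\<lambda>n. q n P) \<longlonglongrightarrow> f' P" by simp
    have "norm (q n P) \<le> indicator K' P * B" for n P
    proof -
      define B' where "B' = indicator K' P * B"
      have bd: "norm (f' (P + x *\<^sub>R v)) \<le> B'" if "x \<in> {0..s n}" for x
      proof (cases "P \<in> K'")
        case False
        have "P + x *\<^sub>R v \<notin> K"
        proof
          assume "P + x *\<^sub>R v \<in> K"
          then have "P \<in> K'" unfolding K'_def using that s[of n]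
            by (intro image_eqI[where x = "(P + x *\<^sub>R v, -x)"]) auto
          then show False using False by simp
        qed
        then show ?thesis using False by (simp add: supp B'_def)
      qed (simp add: B'_def bnd)
      have "norm (f (P + s n *\<^sub>R v) - f (P + 0 *\<^sub>R v)) \<le> B' * norm (s n - 0)"
      proof (rule differentiable_bound[where S = "{0..s n}" and f' = "\<lambda>x h. h *\<^sub>R f' (P + x *\<^sub>R v)"])
        fix x assume x: "x \<in> {0..s n}"
        show "((\<lambda>a. f (P + a *\<^sub>R v)) has_derivative (\<lambda>h. h *\<^sub>R f' (P + x *\<^sub>R v))) (at x within {0..s n})"
          using has_vector_derivative_line[OF der] has_vector_derivative_at_within
          unfolding has_vector_derivative_def by blast
        show "onorm (\<lambda>h. h *\<^sub>R f' (P + x *\<^sub>R v)) \<le> B'"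
          using bd[OF x] by (intro onorm_le) (simp add: mult.commute[of B'] mult_left_mono)
      qed (use s[of n] in auto)
      then have "norm (f (P + s n *\<^sub>R v) - f P) / s n \<le> B'"
        using s[of n] by (simp add: field_simps)
      then show ?thesis
        using s[of n] by (simp add: q_def B'_def divide_inverse mult.commute)
    qed
    then show "AE P in lborel. norm (q n P) \<le> indicator K' P * B" for n by simp
  qed
  then show ?thesis
    unfolding q0 by (metis LIMSEQ_const_iff)
qed


lemma has_vector_derivative_partial:
  fixes f :: "'a::real_normed_vector \<Rightarrow> complex"
  assumes "f differentiable at P"
  shows "((\<lambda>s. f (P + s *\<^sub>R v)) has_vector_derivative partial v f P) (at 0)"
proof -
  have "(\<lambda>s. P + s *\<^sub>R v) differentiable at 0" by simp
  then have "f \<circ> (\<lambda>s. P + s *\<^sub>R v) differentiable at 0"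
    using assms by (intro differentiable_chain_at) auto
  then show ?thesis
    by (simp add: partial_def vector_derivative_works o_def)
qed

lemma open_hyp3: "open hyp3"
proof -
  have eq: "hyp3 = snd -` {0<..}" by (auto simp: hyp3_def)
  show ?thesis unfolding eq by (rule open_vimage_snd) simp
qed

lemma Basis_complex_real: "(Basis :: (complex \<times> real) set) = {(1, 0), (\<i>, 0), (0, 1)}"
  by (auto simp: Basis_prod_def Basis_complex_def)

lemma C2_onD:
  assumes "C2_on hyp3 u" "P \<in> hyp3" "v \<in> Basis"
  shows "((\<lambda>s. u (P + s *\<^sub>R v)) has_vector_derivative partial v u P) (at 0)"
    and "((\<lambda>s. partial v u (P + s *\<^sub>R v)) has_vector_derivative partial v (partial v u) P) (at 0)"
proof -
  have "u differentiable_on hyp3" "partial v u differentiable_on hyp3"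
    using assms unfolding C2_on_def by blast+
  then have "u differentiable at P" "partial v u differentiable at P"
    using assms(2) open_hyp3 differentiable_on_eq_differentiable_at by blast+
  then show "((\<lambda>s. u (P + s *\<^sub>R v)) has_vector_derivative partial v u P) (at 0)"
    "((\<lambda>s. partial v u (P + s *\<^sub>R v)) has_vector_derivative partial v (partial v u) P) (at 0)"
    by (simp_all add: has_vector_derivative_partial)
qed

lemma C2_on_continuous:
  assumes "C2_on hyp3 u" "v \<in> Basis"
  shows "continuous_on hyp3 u" "continuous_on hyp3 (partial v u)"
    "continuous_on hyp3 (partial v (partial v u))"
  using assms differentiable_imp_continuous_on unfolding C2_on_def by blast+

section \<open>The distance function in ambient coordinates\<close>

lemma continuous_on_hcosh [continuous_intros]:
  assumes "P \<in> hyp3" shows "continuous_on hyp3 (hcosh P)"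
  unfolding hcosh_def using assms by (auto intro!: continuous_intros simp: hyp3_def)

lemma hcosh_ge_1:
  assumes "P \<in> hyp3" "Q \<in> hyp3" shows "hcosh P Q \<ge> 1"
proof -
  have "2 * snd P * snd Q \<le> (cmod (fst P - fst Q))\<^sup>2 + (snd P)\<^sup>2 + (snd Q)\<^sup>2"
    using zero_le_power2[of "snd P - snd Q"] zero_le_power2[of "cmod (fst P - fst Q)"]
    unfolding power2_diff by linarith
  then show ?thesis
    using assms by (simp add: hcosh_def hyp3_def)
qed

text \<open>A test function that vanishes below \<open>1\<close>, composed with
  \<open>hcosh P\<close>, therefore vanishes off the half-space without any indicator. The boundary
  \<open>snd Q = 0\<close> is covered by division by zero giving \<open>0\<close>.\<close>

lemma hcosh_nonpos: "snd P > 0 \<Longrightarrow> snd Q \<le> 0 \<Longrightarrow> hcosh P Q \<le> 0"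
  unfolding hcosh_def by (intro divide_nonneg_nonpos) (auto simp: mult_nonneg_nonpos)

lemma compact_hcosh_ball:
  assumes P: "P \<in> hyp3"
  shows "compact {Q \<in> hyp3. hcosh P Q \<le> c}"
proof (cases "c > 0")
  case True
  obtain z0 y0 where P0: "P = (z0, y0)" by force
  have y0: "y0 > 0" using P by (simp add: hyp3_def P0)
  \<comment> \<open>The lower bound on \<open>snd Q\<close> comes from keeping only
    \<open>y0 ^ 2\<close> on the left of the second inequality. It holds \<open>K\<close> inside the
    half-space, so closedness can be read off in the ambient space.\<close>
  define K where "K = {Q :: complex \<times> real. y0 / (2 * c) \<le> snd Q \<and>
      (cmod (z0 - fst Q))\<^sup>2 + y0\<^sup>2 + (snd Q)\<^sup>2 \<le> 2 * c * snd Q * y0}"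
  have eq: "{Q \<in> hyp3. hcosh P Q \<le> c} = K"
  proof (intro Set.set_eqI iffI)
    fix Q assume "Q \<in> {Q \<in> hyp3. hcosh P Q \<le> c}"
    then have y: "snd Q > 0" and h: "hcosh P Q \<le> c" by (simp_all add: hyp3_def)
    have le: "(cmod (z0 - fst Q))\<^sup>2 + y0\<^sup>2 + (snd Q)\<^sup>2 \<le> 2 * c * snd Q * y0"
      using h y y0 by (simp add: hcosh_def P0 pos_divide_le_eq mult_ac)
    then have "y0\<^sup>2 \<le> 2 * c * snd Q * y0"
      using zero_le_power2[of "cmod (z0 - fst Q)"] zero_le_power2[of "snd Q"] by linarith
    then have "y0 \<le> 2 * c * snd Q"
      using y0 by (simp add: power2_eq_square)
    then show "Q \<in> K" using le True by (simp add: K_def field_simps)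
  next
    fix Q assume Q: "Q \<in> K"
    then have y: "snd Q > 0" using y0 True by (auto simp: K_def intro: less_le_trans[of 0 "y0 / (2 * c)"])
    then show "Q \<in> {Q \<in> hyp3. hcosh P Q \<le> c}"
      using Q y0 by (simp add: K_def hyp3_def hcosh_def P0 pos_divide_le_eq mult_ac)
  qed
  have "closed K"
    unfolding K_def by (intro closed_Collect_conj closed_Collect_le continuous_intros)
  moreover have "bounded K"
  proof -
    have "Q \<in> cball z0 (2 * c * y0) \<times> {0..2 * c * y0}" if Q: "Q \<in> K" for Q
    proof -
      have y: "snd Q > 0" using Q y0 True by (auto simp: K_def intro: less_le_trans[of 0 "y0 / (2 * c)"])
      have le: "(cmod (z0 - fst Q))\<^sup>2 + y0\<^sup>2 + (snd Q)\<^sup>2 \<le> 2 * c * snd Q * y0"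
        using Q by (simp add: K_def)
      then have "(snd Q)\<^sup>2 \<le> 2 * c * snd Q * y0"
        using zero_le_power2[of "cmod (z0 - fst Q)"] zero_le_power2[of y0] by linarith
      then have y2: "snd Q \<le> 2 * c * y0" using y by (simp add: power2_eq_square mult_ac)
      have "(cmod (z0 - fst Q))\<^sup>2 \<le> 2 * c * snd Q * y0"
        using le zero_le_power2[of "snd Q"] zero_le_power2[of y0] by linarith
      also have "\<dots> \<le> 2 * c * (2 * c * y0) * y0"
        using y2 True y0 by (intro mult_right_mono mult_left_mono) auto
      also have "\<dots> = (2 * c * y0)\<^sup>2" by (simp add: power2_eq_square)
      finally have "cmod (z0 - fst Q) \<le> 2 * c * y0"
        using True y0 by (simp add: power2_le_iff_abs_le)
      then show ?thesis using y y2 by (cases Q) (simp add: dist_norm)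
    qed
    then show ?thesis
      by (intro bounded_subset[OF bounded_Times[of "cball z0 (2 * c * y0)" "{0..2 * c * y0}"]]) auto
  qed
  ultimately show ?thesis by (simp add: eq compact_eq_bounded_closed)
next
  case False
  then have "{Q \<in> hyp3. hcosh P Q \<le> c} = {}" using hcosh_ge_1[OF P] by force
  then show ?thesis by (simp only: compact_empty)
qed

text \<open>With heights \<open>y\<close>, \<open>v\<close> and \<open>c = hcosh P Q\<close>, the
  squared Euclidean distance equals \<open>2 * y * v * (c - 1)\<close>, and \<open>c \<le> 2\<close>
  forces \<open>v \<le> 4 * y\<close>.\<close>

lemma dist_le_hcosh:
  assumes "P \<in> hyp3" "Q \<in> hyp3" "hcosh P Q \<le> 2"
  shows "(dist P Q)\<^sup>2 \<le> 8 * (snd P)\<^sup>2 * (hcosh P Q - 1)"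
proof -
  obtain z y where P: "P = (z, y)" by force
  obtain w v where Q: "Q = (w, v)" by force
  have yv: "y > 0" "v > 0" using assms by (simp_all add: P Q hyp3_def)
  define c where "c = hcosh P Q"
  have c: "(cmod (z - w))\<^sup>2 + y\<^sup>2 + v\<^sup>2 = 2 * c * y * v" using yv by (simp add: c_def hcosh_def P Q)
  have c1: "1 \<le> c" "c \<le> 2" using assms hcosh_ge_1 by (simp_all add: c_def)
  have "v\<^sup>2 \<le> 2 * c * y * v" using c zero_le_power2[of y] zero_le_power2[of "cmod (z - w)"] by linarith
  then have "v \<le> 2 * c * y" using yv by (simp add: power2_eq_square)
  also have "\<dots> \<le> 4 * y" using c1 yv by simp
  finally have v: "v \<le> 4 * y" .
  have "(dist P Q)\<^sup>2 = (cmod (z - w))\<^sup>2 + (y - v)\<^sup>2"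
    by (simp add: P Q dist_Pair_Pair) (simp add: dist_norm)
  also have "\<dots> = 2 * y * v * (c - 1)" using c by (simp add: power2_diff algebra_simps)
  also have "\<dots> \<le> 2 * y * (4 * y) * (c - 1)" using v yv c1 by (intro mult_right_mono mult_left_mono) auto
  finally show ?thesis by (simp add: c_def P power2_eq_square)
qed

lemma hcosh_ball_subset:
  assumes "P \<in> hyp3" "open U" "P \<in> U"
  obtains c where "c > 1" "\<And>Q. Q \<in> hyp3 \<Longrightarrow> hcosh P Q \<le> c \<Longrightarrow> Q \<in> U"
proof -
  obtain e where e: "e > 0" "ball P e \<subseteq> U" using assms open_contains_ball by blast
  have y: "snd P > 0" using assms by (simp add: hyp3_def)
  \<comment> \<open>The \<open>16\<close> is twice the \<open>8\<close> of
    \<open>dist_le_hcosh\<close>, which makes the final inequality strict; the minimum with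
    \<open>1\<close> secures the hypothesis \<open>hcosh P Q \<le> 2\<close> there.\<close>
  define c where "c = 1 + min 1 (e\<^sup>2 / (16 * (snd P)\<^sup>2))"
  have "Q \<in> U" if "Q \<in> hyp3" "hcosh P Q \<le> c" for Q
  proof -
    have "(dist P Q)\<^sup>2 \<le> 8 * (snd P)\<^sup>2 * (hcosh P Q - 1)"
      using that by (intro dist_le_hcosh assms) (auto simp: c_def)
    also have "\<dots> \<le> 8 * (snd P)\<^sup>2 * (e\<^sup>2 / (16 * (snd P)\<^sup>2))"
      using that by (intro mult_left_mono) (auto simp: c_def)
    also have "\<dots> < e\<^sup>2" using y e by (simp add: field_simps)
    finally have "dist P Q < e" using e by (simp add: power2_less_imp_less)
    then show ?thesis using e by auto
  qed
  moreover have "c > 1" using e y by (simp add: c_def)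
  ultimately show ?thesis using that by blast
qed

definition hcosh_partial :: "complex \<times> real \<Rightarrow> complex \<times> real \<Rightarrow> complex \<times> real \<Rightarrow> real" where
  "hcosh_partial P v Q = ((fst Q - fst P) \<bullet> fst v + snd Q * snd v) / (snd P * snd Q)
     - hcosh P Q * snd v / snd Q"

definition hcosh_partial2 :: "complex \<times> real \<Rightarrow> complex \<times> real \<Rightarrow> complex \<times> real \<Rightarrow> real" where
  "hcosh_partial2 P v Q = (fst v \<bullet> fst v + snd v * snd v) / (snd P * snd Q)
     - ((fst Q - fst P) \<bullet> fst v + snd Q * snd v) * snd v / (snd P * (snd Q)\<^sup>2)
     - hcosh_partial P v Q * snd v / snd Q + hcosh P Q * (snd v)\<^sup>2 / (snd Q)\<^sup>2"

lemma hcosh_has_derivative_line: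
  assumes "P \<in> hyp3" "Q \<in> hyp3"
  shows "((\<lambda>s. hcosh P (Q + s *\<^sub>R v)) has_real_derivative hcosh_partial P v Q) (at 0)"
proof -
  obtain z0 y0 where P: "P = (z0, y0)" by force
  obtain z y where Q: "Q = (z, y)" by force
  obtain e h where v: "v = (e, h)" by force
  have y: "y0 > 0" "y > 0" using assms by (simp_all add: P Q hyp3_def)
  have eq: "hcosh P (Q + s *\<^sub>R v) =
      ((cmod (z0 - z))\<^sup>2 + 2 * s * ((z - z0) \<bullet> e) + s\<^sup>2 * (e \<bullet> e) + y0\<^sup>2 + (y + s * h)\<^sup>2) / (2 * y0 * (y + s * h))" for s
    unfolding hcosh_def power2_norm_eq_inner P Q v
    by (simp add: inner_simps inner_commute power2_eq_square algebra_simps)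
  have "((\<lambda>s. ((cmod (z0 - z))\<^sup>2 + 2 * s * ((z - z0) \<bullet> e) + s\<^sup>2 * (e \<bullet> e) + y0\<^sup>2 + (y + s * h)\<^sup>2) / (2 * y0 * (y + s * h)))
     has_real_derivative
     ((2 * ((z - z0) \<bullet> e) + 2 * y * h) * (2 * y0 * y) - ((cmod (z0 - z))\<^sup>2 + y0\<^sup>2 + y\<^sup>2) * (2 * y0 * h)) / (2 * y0 * y)\<^sup>2) (at 0)"
    using y by (auto intro!: derivative_eq_intros simp: power2_eq_square)
  moreover have "((2 * ((z - z0) \<bullet> e) + 2 * y * h) * (2 * y0 * y) - ((cmod (z0 - z))\<^sup>2 + y0\<^sup>2 + y\<^sup>2) * (2 * y0 * h)) / (2 * y0 * y)\<^sup>2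
     = hcosh_partial P v Q"
    using y unfolding hcosh_partial_def hcosh_def P Q v fst_conv snd_conv
    by (simp add: divide_simps) (simp add: power2_eq_square algebra_simps)
  ultimately show ?thesis unfolding eq by simp
qed

lemma hcosh_partial_has_derivative_line:
  assumes "P \<in> hyp3" "Q \<in> hyp3"
  shows "((\<lambda>s. hcosh_partial P v (Q + s *\<^sub>R v)) has_real_derivative hcosh_partial2 P v Q) (at 0)"
proof -
  obtain z0 y0 where P: "P = (z0, y0)" by force
  obtain z y where Q: "Q = (z, y)" by force
  obtain e h where v: "v = (e, h)" by force
  have y: "y0 > 0" "y > 0" using assms by (simp_all add: P Q hyp3_def)
  define c where "c = (\<lambda>s. hcosh P (Q + s *\<^sub>R v))"
  have c: "(c has_real_derivative hcosh_partial P v Q) (at 0)" "c 0 = hcosh P Q"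
    using hcosh_has_derivative_line[OF assms] by (simp_all add: c_def)
  have eq: "hcosh_partial P v (Q + s *\<^sub>R v) =
      ((z - z0) \<bullet> e + s * (e \<bullet> e) + (y + s * h) * h) / (y0 * (y + s * h)) - c s * h / (y + s * h)" for s
    unfolding hcosh_partial_def c_def by (simp add: P Q v inner_simps)
  have "((\<lambda>s. ((z - z0) \<bullet> e + s * (e \<bullet> e) + (y + s * h) * h) / (y0 * (y + s * h)) - c s * h / (y + s * h))
     has_real_derivative
     ((e \<bullet> e + h * h) * (y0 * y) - ((z - z0) \<bullet> e + y * h) * (y0 * h)) / (y0 * y * (y0 * y))
       - (hcosh_partial P v Q * h * y - c 0 * h * h) / (y * y)) (at 0)"
    using y by (auto intro!: derivative_eq_intros c)
  moreover have "((e \<bullet> e + h * h) * (y0 * y) - ((z - z0) \<bullet> e + y * h) * (y0 * h)) / (y0 * y * (y0 * y))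
       - (hcosh_partial P v Q * h * y - c 0 * h * h) / (y * y) = hcosh_partial2 P v Q"
    using y unfolding hcosh_partial2_def c
    by (simp add: P Q v divide_simps) (simp add: power2_eq_square algebra_simps)
  ultimately show ?thesis unfolding eq by simp
qed

text \<open>In terms of the distance \<open>r\<close>, the function \<open>cosh r\<close> has
  hyperbolic gradient of length \<open>sinh r\<close>.\<close>

lemma hcosh_gradient:
  assumes "P \<in> hyp3" "Q \<in> hyp3"
  shows "(snd Q)\<^sup>2 * ((hcosh_partial P (1, 0) Q)\<^sup>2 + (hcosh_partial P (\<i>, 0) Q)\<^sup>2 + (hcosh_partial P (0, 1) Q)\<^sup>2)
    = (hcosh P Q)\<^sup>2 - 1"
proof -
  define a b y0 y where ab: "a = Re (fst Q) - Re (fst P)" "b = Im (fst Q) - Im (fst P)" "y0 = snd P" "y = snd Q"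
  have y: "y0 > 0" "y > 0" using assms by (simp_all add: ab hyp3_def)
  have c: "hcosh P Q = (a\<^sup>2 + b\<^sup>2 + y0\<^sup>2 + y\<^sup>2) / (2 * y0 * y)"
    unfolding hcosh_def cmod_power2 ab by (simp add: power2_commute)
  show ?thesis
    unfolding hcosh_partial_def c inner_complex_def
    by (simp add: ab[symmetric]) (use y in \<open>simp add: divide_simps\<close>, algebra)
qed

text \<open>The function \<open>cosh r\<close> is an eigenfunction of the Laplacian with eigenvalue
  \<open>3\<close>. Together with \<open>hcosh_gradient\<close> and the chain rule, the Laplacian of
  \<open>g (cosh r)\<close> is \<open>(x ^ 2 - 1) * g2 x + 3 * x * g1 x\<close> at
  \<open>x = cosh r\<close>.\<close>

lemma hcosh_laplacian:
  assumes "P \<in> hyp3" "Q \<in> hyp3"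
  shows "(snd Q)\<^sup>2 * (hcosh_partial2 P (1, 0) Q + hcosh_partial2 P (\<i>, 0) Q + hcosh_partial2 P (0, 1) Q)
    - snd Q * hcosh_partial P (0, 1) Q = 3 * hcosh P Q"
proof -
  define a b y0 y where ab: "a = Re (fst Q) - Re (fst P)" "b = Im (fst Q) - Im (fst P)" "y0 = snd P" "y = snd Q"
  have y: "y0 > 0" "y > 0" using assms by (simp_all add: ab hyp3_def)
  have c: "hcosh P Q = (a\<^sup>2 + b\<^sup>2 + y0\<^sup>2 + y\<^sup>2) / (2 * y0 * y)"
    unfolding hcosh_def cmod_power2 ab by (simp add: power2_commute)
  show ?thesis
    unfolding hcosh_partial2_def hcosh_partial_def c inner_complex_def
    by (simp add: ab[symmetric]) (use y in \<open>simp add: divide_simps\<close>, algebra)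
qed

text \<open>Green's identity: the vector field \<open>W\<close> with components
  \<open>y\<^sup>-\<^sup>1 (g(c) \<partial>\<^sub>v u - u \<partial>\<^sub>v g(c))\<close> has compact support, and its divergence is
  \<open>y\<^sup>-\<^sup>3 (g(c) \<Delta>u - u \<Delta>(g(c)))\<close>.\<close>

lemma integral_radial_laplacian_eigenfunction:
  fixes u :: "complex \<times> real \<Rightarrow> complex" and g g1 g2 :: "real \<Rightarrow> real"
  assumes C2: "C2_on hyp3 u" and P: "P \<in> hyp3"
    and eig: "\<And>Q. Q \<in> hyp3 \<Longrightarrow> - hyp_laplacian u Q = ev * u Q"
    and g: "\<And>x. (g has_real_derivative g1 x) (at x)"
    and g1: "\<And>x. (g1 has_real_derivative g2 x) (at x)"
    and g2: "continuous_on UNIV g2"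
    and supp: "\<And>x. x < 1 \<or> x > c0 \<Longrightarrow> g x = 0 \<and> g1 x = 0 \<and> g2 x = 0"
  shows "(\<integral>Q. u Q * (of_real (((hcosh P Q)\<^sup>2 - 1) * g2 (hcosh P Q) + 3 * hcosh P Q * g1 (hcosh P Q))
      + ev * of_real (g (hcosh P Q))) \<partial>hyp_vol) = 0"
proof -
  define K where "K = {Q \<in> hyp3. hcosh P Q \<le> c0}"
  have K: "compact K" unfolding K_def by (rule compact_hcosh_ball[OF P])
  have KH: "K \<subseteq> hyp3" by (auto simp: K_def)
  let ?c = "hcosh P"
  have outside: "g (?c Q) = 0 \<and> g1 (?c Q) = 0 \<and> g2 (?c Q) = 0" if "Q \<notin> K" for Q
  proof (cases "Q \<in> hyp3")
    case True
    then show ?thesis using that supp[of "?c Q"] by (auto simp: K_def)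
  next
    case False
    then have "?c Q \<le> 0" using P by (intro hcosh_nonpos) (auto simp: hyp3_def)
    then show ?thesis using supp[of "?c Q"] by simp
  qed
  \<comment> \<open>The weight \<open>1 / snd Q\<close> reflects the divergence form of the
    Laplacian: \<open>y ^ 3\<close> times the divergence of the Euclidean gradient divided by
    \<open>y\<close> is \<open>y ^ 2\<close> times the Euclidean Laplacian minus \<open>y\<close>
    times the derivative in \<open>y\<close>.\<close>
  define W where "W v Q = of_real (1 / snd Q) * (of_real (g (?c Q)) * partial v u Q
      - u Q * of_real (g1 (?c Q) * hcosh_partial P v Q))" for v Q
  \<comment> \<open>This is the derivative of \<open>W v\<close> along \<open>v\<close>. The two
    products of a first derivative of \<open>u\<close> with a first derivative of
    \<open>g (hcosh P)\<close> have cancelled.\<close>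
  define D where "D v Q = of_real (- snd v / (snd Q)\<^sup>2) * (of_real (g (?c Q)) * partial v u Q
        - u Q * of_real (g1 (?c Q) * hcosh_partial P v Q))
      + of_real (1 / snd Q) * (of_real (g (?c Q)) * partial v (partial v u) Q
        - u Q * of_real (g2 (?c Q) * (hcosh_partial P v Q)\<^sup>2 + g1 (?c Q) * hcosh_partial2 P v Q))" for v Q
  have W0: "W v Q = 0" "D v Q = 0" if "Q \<notin> K" for v Q
    using outside[OF that] by (simp_all add: W_def D_def)
  have contg: "continuous_on UNIV g" "continuous_on UNIV g1"
    using g g1 by (meson DERIV_isCont continuous_at_imp_continuous_on)+
  have cc: "continuous_on K ?c" using continuous_on_hcosh[OF P] KH continuous_on_subset by blast
  have cgc: "continuous_on K (\<lambda>Q. g (?c Q))" "continuous_on K (\<lambda>Q. g1 (?c Q))" "continuous_on K (\<lambda>Q. g2 (?c Q))"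
    by (auto intro!: continuous_on_compose2[OF contg(1) cc] continuous_on_compose2[OF contg(2) cc]
      continuous_on_compose2[OF g2 cc])
  have yK: "snd Q \<noteq> 0" if "Q \<in> K" for Q using that KH by (auto simp: hyp3_def)
  have y0: "snd P \<noteq> 0" using P by (auto simp: hyp3_def)
  have ccp: "continuous_on K (hcosh_partial P v)" "continuous_on K (hcosh_partial2 P v)" for v
  proof -
    show *: "continuous_on K (hcosh_partial P v)"
      unfolding hcosh_partial_def using yK y0 by (auto intro!: continuous_intros cc)
    show "continuous_on K (hcosh_partial2 P v)"
      unfolding hcosh_partial2_def using yK y0 by (auto intro!: continuous_intros cc *)
  qed
  have int0: "(\<integral>Q. D v Q \<partial>lborel) = 0" and intD: "integrable lborel (D v)" if v: "v \<in> Basis" for v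
  proof -
    have cu: "continuous_on K u" "continuous_on K (partial v u)" "continuous_on K (partial v (partial v u))"
      using C2_on_continuous[OF C2 v] KH continuous_on_subset by blast+
    have cW: "continuous_on K (W v)"
      unfolding W_def using yK by (intro continuous_intros cu cgc ccp) auto
    have cD: "continuous_on K (D v)"
      unfolding D_def using yK by (intro continuous_intros cu cgc ccp) auto
    have iW: "integrable lborel (W v)"
    proof -
      have "(\<lambda>Q. indicator K Q *\<^sub>R W v Q) = W v"
        by (rule ext) (simp add: W0 indicator_def)
      then show ?thesis using borel_integrable_compact[OF K cW] by simp
    qed
    show iD: "integrable lborel (D v)"
    proof -
      have "(\<lambda>Q. indicator K Q *\<^sub>R D v Q) = D v"
        by (rule ext) (simp add: W0 indicator_def)
      then show ?thesis using borel_integrable_compact[OF K cD] by simp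
    qed
    obtain B where B: "\<And>Q. Q \<in> K \<Longrightarrow> norm (D v Q) \<le> B" "B \<ge> 0"
    proof -
      have "bounded (D v ` K)" using K cD compact_continuous_image compact_imp_bounded by blast
      then obtain B where "\<forall>x\<in>D v ` K. norm x \<le> B" by (auto simp: bounded_iff)
      then show ?thesis using that[of "max B 0"] by force
    qed
    show "(\<integral>Q. D v Q \<partial>lborel) = 0"
    proof (rule integral_directional_derivative_eq_0[OF _ iW _ _ K])
      show "D v \<in> borel_measurable borel" using iD by (simp add: borel_measurable_integrable)
      show "D v Q = 0" if "Q \<notin> K" for Q using W0 that by simp
      show "norm (D v Q) \<le> B" for Q using B W0[of Q v] by (cases "Q \<in> K") auto
      show "((\<lambda>s. W v (Q + s *\<^sub>R v)) has_vector_derivative D v Q) (at 0)" for Q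
      proof (cases "Q \<in> K")
        case True
        then have Q: "Q \<in> hyp3" using KH by auto
        have y: "snd Q > 0" using Q by (simp add: hyp3_def)
        note d = hcosh_has_derivative_line[OF P Q, of v] hcosh_partial_has_derivative_line[OF P Q, of v]
        have dg: "((\<lambda>s. g (?c (Q + s *\<^sub>R v))) has_real_derivative g1 (?c Q) * hcosh_partial P v Q) (at 0)"
          using DERIV_chain2[of g "g1 (?c Q)" "\<lambda>s. ?c (Q + s *\<^sub>R v)" 0, OF _ d(1)] g by simp
        have dg1: "((\<lambda>s. g1 (?c (Q + s *\<^sub>R v))) has_real_derivative g2 (?c Q) * hcosh_partial P v Q) (at 0)"
          using DERIV_chain2[of g1 "g2 (?c Q)" "\<lambda>s. ?c (Q + s *\<^sub>R v)" 0, OF _ d(1)] g1 by simp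
        have dy: "((\<lambda>s. 1 / snd (Q + s *\<^sub>R v)) has_real_derivative - snd v / (snd Q)\<^sup>2) (at 0)"
          using y by (auto intro!: derivative_eq_intros simp: power2_eq_square)
        have dp: "((\<lambda>s. g1 (?c (Q + s *\<^sub>R v)) * hcosh_partial P v (Q + s *\<^sub>R v)) has_real_derivative
            g2 (?c Q) * (hcosh_partial P v Q)\<^sup>2 + g1 (?c Q) * hcosh_partial2 P v Q) (at 0)"
          by (rule derivative_eq_intros dg1 d refl)+ (simp add: power2_eq_square algebra_simps)
        note of = has_vector_derivative_of_real
        note du = C2_onD[OF C2 Q v]
        show ?thesis
          unfolding W_def D_def
          by (rule derivative_eq_intros du of dg dp dy refl)+
             (simp add: algebra_simps)
      next
        case False
        have "open {s. Q + s *\<^sub>R v \<notin> K}"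
        proof -
          have "open (- K)" using K by (simp add: compact_imp_closed open_Compl)
          then have "open ((\<lambda>s. Q + s *\<^sub>R v) -` (- K))"
            by (intro open_vimage) (auto intro!: continuous_intros)
          then show ?thesis by (simp add: vimage_def)
        qed
        then have "((\<lambda>s. W v (Q + s *\<^sub>R v)) has_vector_derivative 0) (at 0)"
          by (rule has_vector_derivative_transform_within_open[OF has_vector_derivative_const])
             (use False W0 in auto)
        then show ?thesis using W0 False by simp
      qed
    qed
  qed
  have sumD: "(\<integral>Q. (D (1, 0) Q + D (\<i>, 0) Q + D (0, 1) Q) \<partial>lborel) = 0"
    using int0 intD by (simp add: Basis_complex_real)
  define E where "E Q = u Q * (of_real (((?c Q)\<^sup>2 - 1) * g2 (?c Q) + 3 * ?c Q * g1 (?c Q))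
      + ev * of_real (g (?c Q)))" for Q
  have pt: "(indicator hyp3 Q / snd Q ^ 3) *\<^sub>R E Q = - (D (1, 0) Q + D (\<i>, 0) Q + D (0, 1) Q)" for Q
  proof (cases "Q \<in> K")
    case False
    then show ?thesis using outside[OF False] W0 by (simp add: E_def)
  next
    case True
    then have Q: "Q \<in> hyp3" using KH by auto
    then have y: "snd Q > 0" by (simp add: hyp3_def)
    define y where "y = snd Q"
    have y: "y > 0" "complex_of_real y \<noteq> 0" using y by (simp_all add: y_def)
    define p1 p2 p3 where "p1 = partial (1, 0) (partial (1, 0) u) Q"
      "p2 = partial (\<i>, 0) (partial (\<i>, 0) u) Q" "p3 = partial (0, 1) (partial (0, 1) u) Q"
    define q3 where "q3 = partial (0, 1) u Q"
    have lap: "- (of_real (y\<^sup>2) * (p1 + p2 + p3) - of_real y * q3) = ev * u Q"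
      using eig[OF Q] by (simp add: hyp_laplacian_def Let_def p1_p2_p3_def q3_def y_def)
    have G: "complex_of_real ((?c Q)\<^sup>2 - 1) = of_real (y\<^sup>2 * ((hcosh_partial P (1, 0) Q)\<^sup>2 + (hcosh_partial P (\<i>, 0) Q)\<^sup>2 + (hcosh_partial P (0, 1) Q)\<^sup>2))"
      using hcosh_gradient[OF P Q] by (simp add: y_def)
    have L: "complex_of_real (3 * ?c Q) = of_real (y\<^sup>2 * (hcosh_partial2 P (1, 0) Q + hcosh_partial2 P (\<i>, 0) Q + hcosh_partial2 P (0, 1) Q)
      - y * hcosh_partial P (0, 1) Q)"
      using hcosh_laplacian[OF P Q] by (simp add: y_def)
    have "of_real (y ^ 3) * ((indicator hyp3 Q / snd Q ^ 3) *\<^sub>R E Q) = E Q"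
      using y Q by (simp add: y_def[symmetric] scaleR_conv_of_real)
    also have "E Q = u Q * (of_real ((?c Q)\<^sup>2 - 1) * of_real (g2 (?c Q)) + of_real (3 * ?c Q) * of_real (g1 (?c Q)))
        + (ev * u Q) * of_real (g (?c Q))"
      by (simp add: E_def algebra_simps)
    also have "\<dots> = of_real (y ^ 3) * (- (D (1, 0) Q + D (\<i>, 0) Q + D (0, 1) Q))"
      unfolding G L lap[symmetric] D_def p1_p2_p3_def[symmetric] q3_def[symmetric] y_def[symmetric]
      using y by (simp add: field_simps power2_eq_square power3_eq_cube)
    finally have "of_real (y ^ 3) * ((indicator hyp3 Q / snd Q ^ 3) *\<^sub>R E Q)
        = of_real (y ^ 3) * (- (D (1, 0) Q + D (\<i>, 0) Q + D (0, 1) Q))" .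
    moreover have "complex_of_real (y ^ 3) \<noteq> 0" using y by simp
    ultimately show ?thesis by (metis mult_left_cancel)
  qed
  have "(\<integral>Q. E Q \<partial>hyp_vol) = (\<integral>Q. (indicator hyp3 Q / snd Q ^ 3) *\<^sub>R E Q \<partial>lborel)"
  proof -
    have H: "hyp3 \<in> sets borel" using open_hyp3 by simp
    have "continuous_on K E"
    proof -
      have "continuous_on K u" using C2_on_continuous[OF C2, of "(0,1)"] KH continuous_on_subset
        by (auto simp: Basis_complex_real)
      then show ?thesis unfolding E_def by (intro continuous_intros cgc cc)
    qed
    then have "(\<lambda>Q. indicator K Q *\<^sub>R E Q) \<in> borel_measurable borel"
      using K by (intro borel_measurable_continuous_on_indicator) (auto simp: borel_compact)
    moreover have "(\<lambda>Q. indicator K Q *\<^sub>R E Q) = E"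
      by (rule ext) (simp add: outside E_def indicator_def)
    ultimately have "E \<in> borel_measurable borel" by simp
    moreover have "(\<lambda>Q. indicator hyp3 Q / snd Q ^ 3 :: real) \<in> borel_measurable borel"
      using H by (intro borel_measurable_divide borel_measurable_indicator borel_measurable_power measurable_snd'')
        (auto simp: borel_prod[symmetric])
    ultimately show ?thesis
      unfolding hyp_vol_def by (subst integral_density) (auto split: split_indicator simp: hyp3_def)
  qed
  also have "\<dots> = - (\<integral>Q. (D (1, 0) Q + D (\<i>, 0) Q + D (0, 1) Q) \<partial>lborel)"
    unfolding pt by (rule Bochner_Integration.integral_minus)
  finally show ?thesis using sumD by (simp add: E_def)
qed

section \<open>The hyperbolic volume in polar coordinates\<close>

lemma sets_hyp_vol [simp, measurable_cong]: "sets hyp_vol = sets borel"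
  by (simp add: hyp_vol_def)

lemma space_hyp_vol [simp]: "space hyp_vol = UNIV"
  by (simp add: hyp_vol_def)

lemma hyp3_borel [measurable]: "hyp3 \<in> sets borel"
  using open_hyp3 by simp

lemma fst_borel [measurable]: "(fst :: 'a::second_countable_topology \<times> 'b::second_countable_topology \<Rightarrow> 'a) \<in> borel_measurable borel"
  by (auto simp: borel_prod[symmetric])

lemma snd_borel [measurable]: "(snd :: 'a::second_countable_topology \<times> 'b::second_countable_topology \<Rightarrow> 'b) \<in> borel_measurable borel"
  by (auto simp: borel_prod[symmetric])

lemma hcosh_borel [measurable]: "hcosh P \<in> borel_measurable borel"
  unfolding hcosh_def by measurable

lemma nn_integral_hyp_vol:
  assumes [measurable]: "f \<in> borel_measurable borel"
  shows "(\<integral>\<^sup>+Q. f Q \<partial>hyp_vol) = (\<integral>\<^sup>+y. ennreal (indicator {0<..} y / y ^ 3) * (\<integral>\<^sup>+z. f (z, y) \<partial>lborel) \<partial>lborel)"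
proof -
  have "(\<integral>\<^sup>+Q. f Q \<partial>hyp_vol) = (\<integral>\<^sup>+Q. ennreal (indicator hyp3 Q / (snd Q) ^ 3) * f Q \<partial>lborel)"
    unfolding hyp_vol_def by (subst nn_integral_density) auto
  also have "\<dots> = (\<integral>\<^sup>+Q. ennreal (indicator hyp3 Q / (snd Q) ^ 3) * f Q \<partial>(lborel \<Otimes>\<^sub>M lborel))"
    by (simp add: lborel_prod)
  also have "\<dots> = (\<integral>\<^sup>+y. (\<integral>\<^sup>+z. ennreal (indicator hyp3 (z, y) / y ^ 3) * f (z, y) \<partial>lborel) \<partial>lborel)"
    by (subst lborel_pair.nn_integral_snd[symmetric]) (auto simp: borel_prod lborel_prod)
  also have "\<dots> = (\<integral>\<^sup>+y. ennreal (indicator {0<..} y / y ^ 3) * (\<integral>\<^sup>+z. f (z, y) \<partial>lborel) \<partial>lborel)"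
  proof (intro nn_integral_cong)
    fix y :: real
    have [measurable]: "(\<lambda>z. f (z, y)) \<in> borel_measurable borel"
      by (rule measurable_compose[OF _ assms]) (auto intro!: borel_measurable_continuous_onI continuous_intros)
    show "(\<integral>\<^sup>+z. ennreal (indicator hyp3 (z, y) / y ^ 3) * f (z, y) \<partial>lborel)
      = ennreal (indicator {0<..} y / y ^ 3) * (\<integral>\<^sup>+z. f (z, y) \<partial>lborel)"
      by (subst nn_integral_cmult[symmetric]) (auto simp: hyp3_def indicator_def)
  qed
  finally show ?thesis .
qed

text \<open>The squared radius \<open>a\<close> may be negative: the set is then empty and
  \<open>ennreal\<close> truncates the negative area to \<open>0\<close>, so heights at which a ball
  has no slice are covered by the same formula.\<close>

lemma emeasure_disc_complex:
  "emeasure lborel {z :: complex. (cmod (w - z))\<^sup>2 < a} = ennreal (pi * a)"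
proof (cases "a > 0")
  case True
  have "(cmod (w - z))\<^sup>2 < a \<longleftrightarrow> cmod (w - z) < sqrt a" for z
    by (metis real_sqrt_less_iff real_sqrt_abs abs_norm_cancel)
  then have "{z :: complex. (cmod (w - z))\<^sup>2 < a} = ball w (sqrt a)"
    unfolding ball_def dist_norm by (simp only:)
  then show ?thesis using True by (simp add: emeasure_ball unit_ball_vol_2)
next
  case False
  then have "{z :: complex. (cmod (w - z))\<^sup>2 < a} = {}"
    by (auto simp: not_less intro: order_trans)
  then show ?thesis using False by (simp add: ennreal_neg mult_nonneg_nonpos)
qed

text \<open>Horizontal slices of the ball are Euclidean discs, which reduces the volume to an
  integral over heights between \<open>y0 * exp (- r)\<close> and \<open>y0 * exp r\<close>, the two
  zeros of the squared slice radius.\<close>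

lemma hyp_ball_volume:
  assumes P: "P \<in> hyp3" and r: "r > 0"
  shows "emeasure hyp_vol {Q \<in> hyp3. hcosh P Q < cosh r} = ennreal (pi * (sinh (2 * r) - 2 * r))"
proof -
  obtain z0 y0 where P0: "P = (z0, y0)" by force
  have y0: "y0 > 0" using P by (simp add: hyp3_def P0)
  define C where "C = cosh r"
  let ?I = "{y0 * exp (- r)..y0 * exp r}"
  let ?f = "\<lambda>y. pi * (2 * C * y0 * y - y\<^sup>2 - y0\<^sup>2) / y ^ 3"
  let ?F = "\<lambda>y. pi * (- 2 * C * y0 / y - ln y + y0\<^sup>2 / (2 * y\<^sup>2))"
  have factor: "2 * C * y0 * y - y\<^sup>2 - y0\<^sup>2 = (y - y0 * exp (- r)) * (y0 * exp r - y)" for y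
  proof -
    have e: "exp (- r) * exp r = 1" by (simp add: exp_minus)
    have "(y - y0 * exp (- r)) * (y0 * exp r - y) = y0 * y * (exp r + exp (-r)) - y\<^sup>2 - y0\<^sup>2 * (exp (- r) * exp r)"
      by (simp add: algebra_simps power2_eq_square)
    then show ?thesis unfolding e by (simp add: C_def cosh_def)
  qed
  have er: "exp (- r) < exp r" using r by simp
  have "emeasure hyp_vol {Q \<in> hyp3. hcosh P Q < C} = (\<integral>\<^sup>+Q. indicator {Q \<in> hyp3. hcosh P Q < C} Q \<partial>hyp_vol)"
    by (subst nn_integral_indicator) auto
  also have "\<dots> = (\<integral>\<^sup>+y. ennreal (indicator {0<..} y / y ^ 3) * (\<integral>\<^sup>+z. indicator {Q \<in> hyp3. hcosh P Q < C} (z, y) \<partial>lborel) \<partial>lborel)"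
    by (rule nn_integral_hyp_vol) measurable
  also have "\<dots> = (\<integral>\<^sup>+y. ennreal (?f y) * indicator ?I y \<partial>lborel)"
  proof (rule nn_integral_cong)
    fix y :: real
    show "ennreal (indicator {0<..} y / y ^ 3) * (\<integral>\<^sup>+z. indicator {Q \<in> hyp3. hcosh P Q < C} (z, y) \<partial>lborel)
      = ennreal (?f y) * indicator ?I y"
    proof (cases "y > 0")
      case True
      have "(\<integral>\<^sup>+z. indicator {Q \<in> hyp3. hcosh P Q < C} (z, y) \<partial>lborel)
          = (\<integral>\<^sup>+z. indicator {z. (cmod (z0 - z))\<^sup>2 < 2 * C * y0 * y - y\<^sup>2 - y0\<^sup>2} z \<partial>lborel)"
        using True y0 by (intro nn_integral_cong) (auto simp: P0 hyp3_def hcosh_def indicator_def pos_divide_less_eq mult_ac)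
      also have "\<dots> = ennreal (pi * (2 * C * y0 * y - y\<^sup>2 - y0\<^sup>2))"
        by (subst nn_integral_indicator) (simp_all add: emeasure_disc_complex)
      finally have eq: "(\<integral>\<^sup>+z. indicator {Q \<in> hyp3. hcosh P Q < C} (z, y) \<partial>lborel)
          = ennreal (pi * (2 * C * y0 * y - y\<^sup>2 - y0\<^sup>2))" .
      show ?thesis
      proof (cases "y \<in> ?I")
        case True
        then have "pi * (2 * C * y0 * y - y\<^sup>2 - y0\<^sup>2) \<ge> 0" by (simp add: factor)
        then show ?thesis unfolding eq using True \<open>y > 0\<close>
          by (simp add: ennreal_mult[symmetric])
      next
        case False
        then have "(y - y0 * exp (- r)) * (y0 * exp r - y) \<le> 0"
        proof -
          have *: "y0 * exp (- r) < y0 * exp r" using er y0 by simp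
          from False consider "y < y0 * exp (- r)" | "y > y0 * exp r" by auto
          then show ?thesis using * by cases (auto intro: mult_nonpos_nonneg mult_nonneg_nonpos)
        qed
        then show ?thesis unfolding eq factor using False
          by (simp add: ennreal_neg mult_nonneg_nonpos)
      qed
    next
      case False
      moreover have "y \<notin> ?I"
      proof
        assume "y \<in> ?I"
        then have "y0 * exp (- r) \<le> y" by simp
        moreover have "y0 * exp (- r) > 0" using y0 by simp
        ultimately show False using False by linarith
      qed
      ultimately show ?thesis by simp
    qed
  qed
  also have "\<dots> = ennreal (?F (y0 * exp r) - ?F (y0 * exp (- r)))"
  proof (rule nn_integral_FTC_Icc)
    show "?f \<in> borel_measurable borel" by measurable
    fix y assume "y \<in> ?I"
    then have y: "y0 * exp (- r) \<le> y" "y \<le> y0 * exp r" by auto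
    have "y0 * exp (- r) > 0" using y0 by simp
    with y have pos: "y > 0" by linarith
    show "?f y \<ge> 0" using y pos by (simp add: factor)
    show "(?F has_real_derivative ?f y) (at y)"
      using pos by (auto intro!: derivative_eq_intros simp: power2_eq_square power3_eq_cube field_simps)
  next
    show "y0 * exp (- r) \<le> y0 * exp r" using y0 er by simp
  qed
  also have "?F (y0 * exp r) - ?F (y0 * exp (- r)) = pi * (sinh (2 * r) - 2 * r)"
  proof -
    have l: "ln (y0 * exp r) = ln y0 + r" "ln (y0 * exp (- r)) = ln y0 - r"
      using y0 by (simp_all add: ln_mult)
    have e: "exp (2 * r) = exp r * exp r" "exp (- 2 * r) = 1 / (exp r * exp r)" "exp (- r) = 1 / exp r"
      by (simp_all add: exp_minus exp_double power2_eq_square divide_inverse)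
    have a: "2 * C * y0 / (y0 * exp r) = 1 + exp (- 2 * r)" "2 * C * y0 / (y0 * exp (- r)) = 1 + exp (2 * r)"
      using y0 unfolding C_def cosh_def e by (simp_all add: field_simps)
    have b: "y0\<^sup>2 / (2 * (y0 * exp r)\<^sup>2) = exp (- 2 * r) / 2" "y0\<^sup>2 / (2 * (y0 * exp (- r))\<^sup>2) = exp (2 * r) / 2"
      using y0 unfolding e by (simp_all add: field_simps power2_eq_square)
    show ?thesis using a b unfolding l by (simp add: sinh_def algebra_simps)
  qed
  finally show ?thesis by (simp add: C_def)
qed


text \<open>The truncation at \<open>1\<close> makes the distance to points outside the half-space \<open>0\<close>, so that
  kernels of the form \<open>\<kappa> (hdist P Q) / sinh (hdist P Q)\<close> vanish there.\<close>

definition hdist :: "complex \<times> real \<Rightarrow> complex \<times> real \<Rightarrow> real" where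
  "hdist P Q = arcosh (max 1 (hcosh P Q))"

lemma sinh_borel [measurable]: "(sinh :: real \<Rightarrow> real) \<in> borel_measurable borel"
  by (intro borel_measurable_continuous_onI continuous_intros)

lemma hdist_borel [measurable]: "hdist P \<in> borel_measurable borel"
  unfolding hdist_def arcosh_def by measurable

lemma hdist_nonneg: "hdist P Q \<ge> 0"
  unfolding hdist_def by (simp add: arcosh_nonneg_real)

lemma hdist_outside: "P \<in> hyp3 \<Longrightarrow> Q \<notin> hyp3 \<Longrightarrow> hdist P Q = 0"
  using hcosh_nonpos[of P Q] unfolding hdist_def by (simp add: hyp3_def max_absorb1)

lemma cosh_hdist: "P \<in> hyp3 \<Longrightarrow> Q \<in> hyp3 \<Longrightarrow> cosh (hdist P Q) = hcosh P Q"
  unfolding hdist_def by (simp add: hcosh_ge_1 max_absorb2)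

lemma hdist_less_iff:
  assumes "P \<in> hyp3" "Q \<in> hyp3" "r \<ge> 0"
  shows "hdist P Q < r \<longleftrightarrow> hcosh P Q < cosh r"
  using assms cosh_real_nonneg_less_iff[of "hdist P Q" r] by (simp add: hdist_nonneg cosh_hdist)

lemma hdist_le_iff:
  assumes "P \<in> hyp3" "Q \<in> hyp3" "r \<ge> 0"
  shows "hdist P Q \<le> r \<longleftrightarrow> hcosh P Q \<le> cosh r"
  using assms cosh_real_nonneg_le_iff[of "hdist P Q" r] by (simp add: hdist_nonneg cosh_hdist)

lemma AE_hyp_vol_hyp3: "AE Q in hyp_vol. Q \<in> hyp3"
  unfolding hyp_vol_def by (subst AE_density) (auto simp: indicator_def)

text \<open>The pushforward is compared after the reflection \<open>r \<mapsto> -r\<close>, since then the half-lines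
  \<open>{x<..}\<close> correspond to balls, which have finite volume.\<close>

lemma distr_hdist_hyp_vol:
  assumes P: "P \<in> hyp3"
  shows "distr hyp_vol borel (\<lambda>Q. - hdist P Q) =
    density lborel (\<lambda>s. ennreal (indicator {..0} s * 4 * pi * (sinh s)\<^sup>2))" (is "?M = ?N")
proof (rule measure_eqI_lessThan)
  show "sets ?M = sets borel" "sets ?N = sets borel" by auto
  have M: "emeasure ?M {x<..} = (if x < 0 then ennreal (pi * (sinh (2 * - x) - 2 * - x)) else 0)" for x
  proof -
    have "emeasure ?M {x<..} = emeasure hyp_vol {Q. hdist P Q < - x}"
      by (subst emeasure_distr) (auto intro!: arg_cong[where f = "emeasure hyp_vol"])
    also have "\<dots> = emeasure hyp_vol {Q \<in> hyp3. hdist P Q < - x}"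
      using AE_hyp_vol_hyp3 by (intro emeasure_eq_AE) auto
    also have "{Q \<in> hyp3. hdist P Q < - x} = (if x < 0 then {Q \<in> hyp3. hcosh P Q < cosh (- x)} else {})"
      using hdist_less_iff[OF P, of _ "- x"] hdist_nonneg[of P]
      by (auto simp del: cosh_minus) (meson neg_le_0_iff_le not_le order_trans)
    finally show ?thesis
      using hyp_ball_volume[OF P, of "- x"] by (auto simp del: cosh_minus split: if_splits)
  qed
  have N: "emeasure ?N {x<..} = (if x < 0 then ennreal (pi * (sinh (2 * - x) - 2 * - x)) else 0)" for x
  proof -
    let ?F = "\<lambda>s :: real. pi * (sinh (2 * s) - 2 * s)"
    have "emeasure ?N {x<..} = (\<integral>\<^sup>+s. ennreal (indicator {..0} s * 4 * pi * (sinh s)\<^sup>2) * indicator {x<..} s \<partial>lborel)"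
      by (subst emeasure_density) auto
    also have "\<dots> = (\<integral>\<^sup>+s. ennreal (4 * pi * (sinh s)\<^sup>2) * indicator {x..0} s \<partial>lborel)"
      using AE_lborel_singleton[of x] by (intro nn_integral_cong_AE) (auto split: split_indicator)
    also have "\<dots> = (if x < 0 then ennreal (?F 0 - ?F x) else 0)"
    proof (cases "x < 0")
      case True
      have "(\<integral>\<^sup>+s. ennreal (4 * pi * (sinh s)\<^sup>2) * indicator {x..0} s \<partial>lborel) = ennreal (?F 0 - ?F x)"
      proof (rule nn_integral_FTC_Icc)
        show "(?F has_real_derivative 4 * pi * (sinh s)\<^sup>2) (at s)" for s
        proof -
          have "(?F has_real_derivative pi * (cosh (2 * s) * 2 - 2)) (at s)"
            by (auto intro!: derivative_eq_intros)
          also have "pi * (cosh (2 * s) * 2 - 2) = 4 * pi * (sinh s)\<^sup>2"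
            by (simp add: cosh_double cosh_square_eq)
          finally show ?thesis .
        qed
      qed (use True in auto)
      then show ?thesis using True by simp
    next
      case False
      have "(\<integral>\<^sup>+s. ennreal (4 * pi * (sinh s)\<^sup>2) * indicator {x..0} s \<partial>lborel) = (\<integral>\<^sup>+s. 0 \<partial>(lborel :: real measure))"
        using False by (intro nn_integral_cong) (auto simp: indicator_def)
      then show ?thesis using False by simp
    qed
    finally show ?thesis by (simp add: algebra_simps)
  qed
  show "emeasure ?M {x<..} < \<infinity>" for x by (simp add: M)
  show "emeasure ?M {x<..} = emeasure ?N {x<..}" for x by (simp only: M N)
qed

lemma nn_integral_radial:
  assumes P: "P \<in> hyp3" and [measurable]: "f \<in> borel_measurable borel"
  shows "(\<integral>\<^sup>+Q. f (hdist P Q) \<partial>hyp_vol) = (\<integral>\<^sup>+r. f r * ennreal (indicator {0..} r * 4 * pi * (sinh r)\<^sup>2) \<partial>lborel)"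
proof -
  have "(\<integral>\<^sup>+Q. f (hdist P Q) \<partial>hyp_vol) = (\<integral>\<^sup>+Q. f (- (- hdist P Q)) \<partial>hyp_vol)" by simp
  also have "\<dots> = (\<integral>\<^sup>+s. f (- s) \<partial>distr hyp_vol borel (\<lambda>Q. - hdist P Q))"
    by (subst nn_integral_distr) auto
  also have "\<dots> = (\<integral>\<^sup>+s. ennreal (indicator {..0} s * 4 * pi * (sinh s)\<^sup>2) * f (- s) \<partial>lborel)"
    unfolding distr_hdist_hyp_vol[OF P] by (subst nn_integral_density) auto
  also have "\<dots> = (\<integral>\<^sup>+r. ennreal (indicator {..0} (- r) * 4 * pi * (sinh (- r))\<^sup>2) * f (- (- r)) \<partial>lborel)"
    by (subst nn_integral_real_affine[where c = "-1" and t = 0]) auto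
  also have "\<dots> = (\<integral>\<^sup>+r. f r * ennreal (indicator {0..} r * 4 * pi * (sinh r)\<^sup>2) \<partial>lborel)"
    by (intro nn_integral_cong) (auto simp: indicator_def mult.commute)
  finally show ?thesis .
qed

lemma
  fixes f :: "real \<Rightarrow> real"
  assumes P: "P \<in> hyp3" and [measurable]: "f \<in> borel_measurable borel"
  shows integrable_radial: "integrable hyp_vol (\<lambda>Q. f (hdist P Q)) \<longleftrightarrow>
      integrable lborel (\<lambda>r. indicator {0..} r * (4 * pi * (sinh r)\<^sup>2 * f r))"
    and integral_radial: "(\<integral>Q. f (hdist P Q) \<partial>hyp_vol) = (\<integral>r. indicator {0..} r * (4 * pi * (sinh r)\<^sup>2 * f r) \<partial>lborel)"
proof -
  have eq: "density lborel (\<lambda>r. ennreal (indicator {0..} r * 4 * pi * (sinh r)\<^sup>2)) = distr hyp_vol borel (hdist P)" (is "?N = ?M")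
  proof (rule measure_eqI)
    fix A assume "A \<in> sets ?N"
    then have [measurable]: "A \<in> sets borel" by simp
    have "emeasure ?M A = (\<integral>\<^sup>+Q. indicator A (hdist P Q) \<partial>hyp_vol)"
      by (subst nn_integral_indicator[symmetric], simp) (subst nn_integral_distr, auto)
    also have "\<dots> = emeasure ?N A"
      by (subst nn_integral_radial[OF P]) (auto simp: emeasure_density mult.commute intro!: nn_integral_cong)
    finally show "emeasure ?N A = emeasure ?M A" ..
  qed simp
  have "integrable hyp_vol (\<lambda>Q. f (hdist P Q)) \<longleftrightarrow> integrable ?M f"
    by (subst integrable_distr_eq) auto
  also have "\<dots> \<longleftrightarrow> integrable lborel (\<lambda>r. (indicator {0..} r * 4 * pi * (sinh r)\<^sup>2) *\<^sub>R f r)"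
    unfolding eq[symmetric] by (subst integrable_density) auto
  finally show "integrable hyp_vol (\<lambda>Q. f (hdist P Q)) \<longleftrightarrow>
      integrable lborel (\<lambda>r. indicator {0..} r * (4 * pi * (sinh r)\<^sup>2 * f r))" by (simp add: mult_ac)
  have "(\<integral>Q. f (hdist P Q) \<partial>hyp_vol) = (\<integral>r. f r \<partial>?M)"
    by (subst integral_distr) auto
  also have "\<dots> = (\<integral>r. (indicator {0..} r * 4 * pi * (sinh r)\<^sup>2) *\<^sub>R f r \<partial>lborel)"
    unfolding eq[symmetric] by (subst integral_density) auto
  finally show "(\<integral>Q. f (hdist P Q) \<partial>hyp_vol) = (\<integral>r. indicator {0..} r * (4 * pi * (sinh r)\<^sup>2 * f r) \<partial>lborel)"
    by (simp add: mult_ac)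
qed

section \<open>The mean value property of eigenfunctions\<close>

text \<open>For \<open>g = F / sinh r\<close> the radial Laplacian plus \<open>1\<close> gives
  \<open>F2 / sinh r\<close>, so Green's identity with eigenvalue \<open>1 + m\<close> leaves
  \<open>F2 + m * F\<close>. Since \<open>F\<close> vanishes near \<open>0\<close>, the test
  function is smooth enough across the centre.\<close>

lemma integral_eigenfunction_radial_ode:
  fixes F F1 F2 :: "real \<Rightarrow> real" and u :: "complex \<times> real \<Rightarrow> complex"
  assumes C2: "C2_on hyp3 u" and P: "P \<in> hyp3"
    and eig: "\<And>Q. Q \<in> hyp3 \<Longrightarrow> - hyp_laplacian u Q = of_real (1 + m) * u Q"
    and F: "\<And>r. (F has_real_derivative F1 r) (at r)"
    and F1: "\<And>r. (F1 has_real_derivative F2 r) (at r)"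
    and F2: "continuous_on UNIV F2"
    and a: "a > 0"
    and supp: "\<And>r. r < a \<or> r > b \<Longrightarrow> F r = 0 \<and> F1 r = 0 \<and> F2 r = 0"
  shows "(\<integral>Q. u Q * of_real ((F2 (hdist P Q) + m * F (hdist P Q)) / sinh (hdist P Q)) \<partial>hyp_vol) = 0"
proof -
  define S where "S x = sqrt (x\<^sup>2 - 1)" for x :: real
  define R where "R x = arcosh x" for x :: real
  have gt: "x\<^sup>2 > 1" if "x > 1" for x :: real
    using that by (simp add: one_less_power)
  have S: "S x > 0" "(S x)\<^sup>2 = x\<^sup>2 - 1" if "x > 1" for x
    using gt[OF that] by (simp_all add: S_def)
  have dS: "(S has_real_derivative x / S x) (at x)" if "x > 1" for x
    unfolding S_def using gt[OF that] by (auto intro!: derivative_eq_intros simp: field_simps)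
  have dR: "(R has_real_derivative 1 / S x) (at x)" if "x > 1" for x
    unfolding R_def S_def using that by (auto intro!: derivative_eq_intros)
  \<comment> \<open>In the variable \<open>x = cosh r\<close> one has \<open>S x = sinh r\<close>;
    \<open>h\<close>, \<open>h1\<close>, \<open>h2\<close> are \<open>F / sinh r\<close> and its
    first two derivatives with respect to \<open>x\<close>. Below \<open>cosh a\<close> they vanish,
    so the extension by zero to \<open>x \<le> 1\<close> is harmless.\<close>
  define h where "h x = F (R x) / S x" for x
  define h1 where "h1 x = F1 (R x) / (S x)\<^sup>2 - x * F (R x) / S x ^ 3" for x
  define h2 where "h2 x = F2 (R x) / S x ^ 3 - 3 * x * F1 (R x) / S x ^ 4 - F (R x) / S x ^ 3
     + 3 * x\<^sup>2 * F (R x) / S x ^ 5" for x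
  define g where "g x = (if x > 1 then h x else 0)" for x
  define g1 where "g1 x = (if x > 1 then h1 x else 0)" for x
  define g2 where "g2 x = (if x > 1 then h2 x else 0)" for x
  have Rsmall: "R x < a" if "1 < x" "x < cosh a" for x
  proof -
    have "cosh (R x) < cosh a" using that by (simp add: R_def)
    then show ?thesis using that a by (subst (asm) cosh_real_nonneg_less_iff) (auto simp: R_def)
  qed
  have z1: "g x = 0" "g1 x = 0" "g2 x = 0" if "x < cosh a" for x
    using Rsmall[OF _ that] supp[of "R x"]
    by (auto simp: g_def g1_def g2_def h_def h1_def h2_def)
  have z2: "g x = 0" "g1 x = 0" "g2 x = 0" if "x > cosh (max b 0)" for x
  proof -
    have x: "x > 1" using that cosh_real_ge_1[of "max b 0"] by linarith
    have "cosh (R x) > cosh (max b 0)" using that x by (simp add: R_def)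
    then have "R x > b" using x by (subst (asm) cosh_real_nonneg_less_iff) (auto simp: R_def)
    then show "g x = 0" "g1 x = 0" "g2 x = 0"
      using supp[of "R x"] by (simp_all add: g_def g1_def g2_def h_def h1_def h2_def)
  qed
  have ca: "cosh a > 1" using a cosh_real_nonneg_less_iff[of 0 a] by simp
  have zero_deriv: "(f has_real_derivative 0) (at x)" if "x < cosh a" "\<And>y. y < cosh a \<Longrightarrow> f y = 0" for f :: "real \<Rightarrow> real" and x
    using that has_field_derivative_transform_within_open[of "\<lambda>_. 0" 0 x "{..<cosh a}" f] by auto
  have dFR: "((\<lambda>x. F (R x)) has_real_derivative F1 (R x) / S x) (at x)"
    "((\<lambda>x. F1 (R x)) has_real_derivative F2 (R x) / S x) (at x)" if "x > 1" for x
    using DERIV_chain2[OF F dR[OF that]] DERIV_chain2[OF F1 dR[OF that]] by simp_all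
  have dg: "(g has_real_derivative g1 x) (at x)" for x
  proof (cases "x > 1")
    case True
    note S' = S[OF True]
    have "(h has_real_derivative (F1 (R x) / S x * S x - F (R x) * (x / S x)) / (S x * S x)) (at x)"
      unfolding h_def by (rule DERIV_divide[OF dFR(1)[OF True] dS[OF True]]) (use S' in simp)
    also have "(F1 (R x) / S x * S x - F (R x) * (x / S x)) / (S x * S x) = g1 x"
      using S' True by (simp add: g1_def h1_def field_simps power2_eq_square power3_eq_cube)
    finally show ?thesis
      by (rule has_field_derivative_transform_within_open[where S = "{1<..}"]) (use True in \<open>auto simp: g_def\<close>)
  next
    case False
    then show ?thesis using ca z1 zero_deriv[of x g] by auto
  qed
  have dg1: "(g1 has_real_derivative g2 x) (at x)" for x
  proof (cases "x > 1")
    case True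
    note S' = S[OF True]
    have "(h1 has_real_derivative
       (F2 (R x) / S x * (S x)\<^sup>2 - F1 (R x) * (2 * S x * (x / S x))) / ((S x)\<^sup>2 * (S x)\<^sup>2)
       - ((F (R x) + x * (F1 (R x) / S x)) * S x ^ 3 - x * F (R x) * (3 * (S x)\<^sup>2 * (x / S x))) / (S x ^ 3 * S x ^ 3)) (at x)"
      unfolding h1_def
    proof (intro DERIV_diff DERIV_divide dFR[OF True])
      show "((\<lambda>x. (S x)\<^sup>2) has_real_derivative 2 * S x * (x / S x)) (at x)"
        by (auto intro!: derivative_eq_intros dS[OF True])
      show "((\<lambda>x. S x ^ 3) has_real_derivative 3 * (S x)\<^sup>2 * (x / S x)) (at x)"
        by (auto intro!: derivative_eq_intros dS[OF True])
      show "((\<lambda>x. x * F (R x)) has_real_derivative F (R x) + x * (F1 (R x) / S x)) (at x)"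
        by (auto intro!: derivative_eq_intros dFR[OF True])
    qed (use S' in auto)
    also have "(F2 (R x) / S x * (S x)\<^sup>2 - F1 (R x) * (2 * S x * (x / S x))) / ((S x)\<^sup>2 * (S x)\<^sup>2)
       - ((F (R x) + x * (F1 (R x) / S x)) * S x ^ 3 - x * F (R x) * (3 * (S x)\<^sup>2 * (x / S x))) / (S x ^ 3 * S x ^ 3) = g2 x"
      using S' True by (simp add: g2_def h2_def field_simps power2_eq_square power3_eq_cube eval_nat_numeral)
    finally show ?thesis
      by (rule has_field_derivative_transform_within_open[where S = "{1<..}"]) (use True in \<open>auto simp: g1_def\<close>)
  next
    case False
    then show ?thesis using ca z1 zero_deriv[of x g1] by auto
  qed
  have cg2: "continuous_on UNIV g2"
  proof -
    have cR: "continuous_on {1<..} R" "continuous_on {1<..} S"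
      using dR dS by (meson DERIV_isCont continuous_at_imp_continuous_on greaterThan_iff)+
    have cF: "continuous_on UNIV F" "continuous_on UNIV F1"
      using F F1 by (meson DERIV_isCont continuous_at_imp_continuous_on)+
    have "continuous_on {1<..} (\<lambda>x. F (R x))" "continuous_on {1<..} (\<lambda>x. F1 (R x))" "continuous_on {1<..} (\<lambda>x. F2 (R x))"
      using continuous_on_compose2[OF cF(1) cR(1)] continuous_on_compose2[OF cF(2) cR(1)]
        continuous_on_compose2[OF F2 cR(1)] by auto
    moreover have "S x \<noteq> 0" if "x \<in> {1<..}" for x using S[of x] that by auto
    ultimately have "continuous_on {1<..} h2"
      unfolding h2_def using cR by (auto intro!: continuous_intros)
    then have "continuous_on {1<..} g2"
      by (subst continuous_on_cong[of _ _ _ h2]) (auto simp: g2_def)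
    moreover have "continuous_on {..<cosh a} g2"
      by (subst continuous_on_cong[of _ "{..<cosh a}" _ "\<lambda>_. 0"]) (auto simp: z1)
    ultimately have "continuous_on ({1<..} \<union> {..<cosh a}) g2"
      by (intro continuous_on_open_Un) auto
    moreover have "{1<..} \<union> {..<cosh a} = UNIV" using ca by auto
    ultimately show ?thesis by (simp only:)
  qed
  have "(\<integral>Q. u Q * (of_real (((hcosh P Q)\<^sup>2 - 1) * g2 (hcosh P Q) + 3 * hcosh P Q * g1 (hcosh P Q))
      + of_real (1 + m) * of_real (g (hcosh P Q))) \<partial>hyp_vol) = 0"
  proof (rule integral_radial_laplacian_eigenfunction[OF C2 P eig dg dg1 cg2])
    show "g x = 0 \<and> g1 x = 0 \<and> g2 x = 0" if "x < 1 \<or> x > cosh (max b 0)" for x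
      using that z1[of x] z2[of x] ca by linarith
  qed
  moreover have "of_real (((hcosh P Q)\<^sup>2 - 1) * g2 (hcosh P Q) + 3 * hcosh P Q * g1 (hcosh P Q))
      + of_real (1 + m) * of_real (g (hcosh P Q))
    = complex_of_real ((F2 (hdist P Q) + m * F (hdist P Q)) / sinh (hdist P Q))" for Q
  proof (cases "hcosh P Q > 1")
    case True
    let ?x = "hcosh P Q"
    have d: "hdist P Q = R ?x" using True by (simp add: hdist_def R_def)
    have s: "sinh (R ?x) = S ?x"
    proof -
      have "sinh (R ?x) \<ge> 0" using True by (simp add: R_def)
      moreover have "(sinh (R ?x))\<^sup>2 = ?x\<^sup>2 - 1" using True by (simp add: sinh_square_eq R_def)
      ultimately show ?thesis by (metis S_def real_sqrt_abs abs_of_nonneg)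
    qed
    have "(?x\<^sup>2 - 1) * g2 ?x + 3 * ?x * g1 ?x + (1 + m) * g ?x = (F2 (R ?x) + m * F (R ?x)) / S ?x"
      using S[OF True] True unfolding S(2)[OF True, symmetric]
      by (simp add: g_def g1_def g2_def h_def h1_def h2_def field_simps power2_eq_square power3_eq_cube eval_nat_numeral)
    then show ?thesis
      unfolding d s by (metis of_real_add of_real_mult)
  next
    case False
    then have "hdist P Q = 0" by (simp add: hdist_def max_absorb1)
    then show ?thesis using False by (simp add: g_def g1_def g2_def)
  qed
  ultimately show ?thesis by simp
qed

section \<open>Cut-off functions and dominated convergence for singular radial kernels\<close>

lemma continuous_real_antiderivative:
  fixes f :: "real \<Rightarrow> real"
  assumes "continuous_on UNIV f"
  obtains A where "\<And>x. (A has_real_derivative f x) (at x)"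
proof
  fix x :: real
  have "((\<lambda>u. LBINT y=ereal 0..ereal u. f y) has_vector_derivative f x) (at x within {-\<bar>x\<bar>-1..\<bar>x\<bar>+1})"
    using assms by (intro interval_integral_FTC2) (auto intro: continuous_on_subset)
  then have "((\<lambda>u. LBINT y=ereal 0..ereal u. f y) has_vector_derivative f x) (at x)"
    by (subst (asm) at_within_interior) (auto simp: interior_atLeastAtMost_real)
  then show "((\<lambda>u. LBINT y=ereal 0..ereal u. f y) has_real_derivative f x) (at x)"
    by (simp add: has_real_derivative_iff_has_vector_derivative)
qed

lemma DERIV_pos_part_power:
  assumes "n \<ge> 2"
  shows "((\<lambda>x::real. max 0 x ^ n) has_real_derivative real n * max 0 x ^ (n - 1)) (at x)"
proof -
  consider "x > 0" | "x < 0" | "x = 0" by linarith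
  then show ?thesis
  proof cases
    case 1
    have "((\<lambda>x::real. x ^ n) has_real_derivative real n * x ^ (n - 1)) (at x)"
      by (auto intro!: derivative_eq_intros)
    then have "((\<lambda>x::real. max 0 x ^ n) has_real_derivative real n * x ^ (n - 1)) (at x)"
      by (rule has_field_derivative_transform_within_open[where S = "{0<..}"]) (use 1 in auto)
    then show ?thesis using 1 by simp
  next
    case 2
    have "((\<lambda>x::real. max 0 x ^ n) has_real_derivative 0) (at x)"
      by (rule has_field_derivative_transform_within_open[where S = "{..<0}" and f = "\<lambda>_. 0"]) (use 2 assms in auto)
    then show ?thesis using 2 assms by (simp add: power_0_left)
  next
    case 3
    have "((\<lambda>y::real. (max 0 y ^ n - max 0 0 ^ n) / (y - 0)) \<longlongrightarrow> 0) (at 0)"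
    proof (rule Lim_null_comparison)
      have "norm ((max 0 y ^ n - max 0 0 ^ n) / (y - 0)) \<le> \<bar>y\<bar> ^ (n - 1)" for y :: real
      proof (cases "y > 0")
        case True
        then have "y ^ n / y = y ^ (n - 1)" using assms by (simp add: power_diff)
        then show ?thesis using True assms by (simp add: power_0_left)
      qed (use assms in \<open>auto simp: power_0_left\<close>)
      then show "\<forall>\<^sub>F y in at 0. norm ((max 0 y ^ n - max 0 0 ^ n) / (y - 0)) \<le> \<bar>y\<bar> ^ (n - 1)" by simp
      have "((\<lambda>y::real. \<bar>y\<bar> ^ (n - 1)) \<longlongrightarrow> \<bar>0\<bar> ^ (n - 1)) (at 0)"
        by (intro tendsto_intros)
      then show "((\<lambda>y::real. \<bar>y\<bar> ^ (n - 1)) \<longlongrightarrow> 0) (at 0)" using assms by (simp add: power_0_left)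
    qed
    then show ?thesis using 3 assms by (simp add: has_field_derivative_iff power_0_left)
  qed
qed

text \<open>The integral of the quadratic B-spline with knots \<open>0, 1, 2, 3\<close>.\<close>

lemma smooth_step_exists:
  obtains ss ss1 ss2 :: "real \<Rightarrow> real" and M :: real
  where "\<And>x. (ss has_real_derivative ss1 x) (at x)" "\<And>x. (ss1 has_real_derivative ss2 x) (at x)"
    "continuous_on UNIV ss2"
    "\<And>x. x \<le> 0 \<Longrightarrow> ss x = 0 \<and> ss1 x = 0 \<and> ss2 x = 0"
    "\<And>x. x \<ge> 3 \<Longrightarrow> ss x = 1 \<and> ss1 x = 0 \<and> ss2 x = 0"
    "\<And>x. \<bar>ss x\<bar> \<le> M \<and> \<bar>ss1 x\<bar> \<le> M \<and> \<bar>ss2 x\<bar> \<le> M"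
proof -
  \<comment> \<open>A third difference of truncated cubes. Beyond \<open>3\<close> every truncation
    is inactive and the third difference of \<open>x ^ 3\<close> is \<open>6\<close>, hence the
    division by \<open>6\<close>.\<close>
  define ss :: "real \<Rightarrow> real" where
    "ss x = (max 0 x ^ 3 - 3 * max 0 (x - 1) ^ 3 + 3 * max 0 (x - 2) ^ 3 - max 0 (x - 3) ^ 3) / 6" for x
  define ss1 :: "real \<Rightarrow> real" where
    "ss1 x = (max 0 x ^ 2 - 3 * max 0 (x - 1) ^ 2 + 3 * max 0 (x - 2) ^ 2 - max 0 (x - 3) ^ 2) / 2" for x
  define ss2 :: "real \<Rightarrow> real" where
    "ss2 x = max 0 x - 3 * max 0 (x - 1) + 3 * max 0 (x - 2) - max 0 (x - 3)" for x
  have dl: "((\<lambda>x::real. x - c) has_real_derivative 1) (at x)" for c x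
    by (auto intro!: derivative_eq_intros)
  have p3: "((\<lambda>x::real. max 0 (x - c) ^ 3) has_real_derivative 3 * max 0 (x - c) ^ 2) (at x)" for c x
    using DERIV_chain2[where f = "\<lambda>x. max 0 x ^ 3" and g = "\<lambda>x. x - c", OF DERIV_pos_part_power dl] by simp
  have p2: "((\<lambda>x::real. max 0 (x - c) ^ 2) has_real_derivative 2 * max 0 (x - c)) (at x)" for c x
    using DERIV_chain2[where f = "\<lambda>x. max 0 x ^ 2" and g = "\<lambda>x. x - c", OF DERIV_pos_part_power dl] by simp
  have d: "(ss has_real_derivative ss1 x) (at x)" for x
    unfolding ss_def ss1_def
    by (rule p3 p3[of 0, simplified] derivative_eq_intros refl)+ (simp_all add: divide_simps)
  have d1: "(ss1 has_real_derivative ss2 x) (at x)" for x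
    unfolding ss1_def ss2_def
    by (rule p2 p2[of 0, simplified] derivative_eq_intros refl)+ (simp_all add: divide_simps)
  have c2: "continuous_on UNIV ss2"
    unfolding ss2_def by (intro continuous_intros)
  have lo: "ss x = 0 \<and> ss1 x = 0 \<and> ss2 x = 0" if "x \<le> 0" for x
    using that by (simp add: ss_def ss1_def ss2_def max_absorb1)
  have hi: "ss x = 1 \<and> ss1 x = 0 \<and> ss2 x = 0" if "x \<ge> 3" for x
    using that by (simp add: ss_def ss1_def ss2_def max_absorb2 power2_eq_square power3_eq_cube algebra_simps)
  have bd: "\<exists>B. \<forall>x. \<bar>f x\<bar> \<le> B" if "continuous_on UNIV f" "\<And>x. x \<le> 0 \<Longrightarrow> f x = 0" "\<And>x. x \<ge> 3 \<Longrightarrow> f x = c" for f :: "real \<Rightarrow> real" and c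
  proof -
    have "compact (f ` {0..3})"
      using that(1) by (intro compact_continuous_image) (auto intro: continuous_on_subset)
    then obtain B where B: "\<forall>y\<in>f ` {0..3}. norm y \<le> B"
      using compact_imp_bounded bounded_iff by blast
    have "\<bar>f x\<bar> \<le> max B \<bar>c\<bar>" for x
    proof -
      consider "x < 0" | "x > 3" | "x \<in> {0..3}" by force
      then show ?thesis
      proof cases
        case 3
        then have "norm (f x) \<le> B" using B by blast
        then show ?thesis by simp
      qed (use that(2,3)[of x] in auto)
    qed
    then show ?thesis by blast
  qed
  have cc: "continuous_on UNIV ss" "continuous_on UNIV ss1"
    using d d1 by (meson DERIV_isCont continuous_at_imp_continuous_on)+
  obtain B0 where B0: "\<And>x. \<bar>ss x\<bar> \<le> B0" using bd[OF cc(1), of 1] lo hi by blast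
  obtain B1 where B1: "\<And>x. \<bar>ss1 x\<bar> \<le> B1" using bd[OF cc(2), of 0] lo hi by blast
  obtain B2 where B2: "\<And>x. \<bar>ss2 x\<bar> \<le> B2" using bd[OF c2, of 0] lo hi by blast
  have "\<bar>ss x\<bar> \<le> max B0 (max B1 B2) \<and> \<bar>ss1 x\<bar> \<le> max B0 (max B1 B2) \<and> \<bar>ss2 x\<bar> \<le> max B0 (max B1 B2)" for x
    using B0[of x] B1[of x] B2[of x] by linarith
  then show ?thesis using that[of ss ss1 ss2, OF d d1 c2 lo hi] by blast
qed

text \<open>Serves to bound the integral of \<open>1 / sinh r\<close> over a ball of radius
  \<open>4 * \<eta>\<close> by \<open>64 * pi * \<eta> ^ 2\<close>, which compensates the factor
  \<open>1 / \<eta> ^ 2\<close> from the second derivative of a cut-off at scale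
  \<open>\<eta>\<close>.\<close>

lemma cosh_le_1_plus_square:
  fixes x :: real assumes "0 \<le> x" "x \<le> 1" shows "cosh x \<le> 1 + x\<^sup>2"
proof -
  have a: "exp x \<le> 1 + x + x\<^sup>2" using assms by (intro exp_bound) auto
  have "exp (- x) \<le> inverse (1 + x)"
    using exp_ge_add_one_self[of x] assms by (simp add: exp_minus le_imp_inverse_le)
  also have "\<dots> \<le> 1 - x + x\<^sup>2"
  proof -
    have "1 \<le> (1 - x + x\<^sup>2) * (1 + x)" using assms by (simp add: algebra_simps power2_eq_square)
    then show ?thesis using assms by (simp add: inverse_eq_divide pos_divide_le_eq)
  qed
  finally show ?thesis using a by (simp add: cosh_def)
qed

text \<open>The area \<open>4 * pi * (sinh r) ^ 2\<close> of spheres absorbs the singularity and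
  leaves \<open>4 * pi * sinh r\<close>, with primitive \<open>4 * pi * cosh r\<close>.\<close>

lemma integrable_inverse_sinh_hdist:
  assumes P: "P \<in> hyp3" and b: "b \<ge> 0"
  shows "integrable hyp_vol (\<lambda>Q. indicator {..b} (hdist P Q) / sinh (hdist P Q))"
    and "(\<integral>Q. indicator {..b} (hdist P Q) / sinh (hdist P Q) \<partial>hyp_vol) = 4 * pi * (cosh b - 1)"
proof -
  have eq: "(\<lambda>r. indicator {0..} r * (4 * pi * (sinh r)\<^sup>2 * (indicator {..b} r / sinh r)))
      = (\<lambda>r :: real. 4 * pi * sinh r * indicator {0..b} r)"
    by (rule ext) (auto simp: indicator_def power2_eq_square)
  have "has_bochner_integral lborel (\<lambda>r. 4 * pi * sinh r * indicator {0..b} r) (4 * pi * cosh b - 4 * pi * cosh 0)"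
    using b by (intro has_bochner_integral_FTC_Icc_real) (auto intro!: derivative_eq_intros continuous_intros)
  note h = this[unfolded has_bochner_integral_iff]
  have m: "(\<lambda>r :: real. indicator {..b} r / sinh r) \<in> borel_measurable borel" by measurable
  show "integrable hyp_vol (\<lambda>Q. indicator {..b} (hdist P Q) / sinh (hdist P Q))"
    using h unfolding integrable_radial[OF P m] eq by simp
  show "(\<integral>Q. indicator {..b} (hdist P Q) / sinh (hdist P Q) \<partial>hyp_vol) = 4 * pi * (cosh b - 1)"
    using h unfolding integral_radial[OF P m] eq by (simp add: algebra_simps)
qed

lemma indicator_continuous_borel:
  fixes u :: "complex \<times> real \<Rightarrow> complex"
  assumes "continuous_on hyp3 u"
  shows "(\<lambda>Q. indicator hyp3 Q *\<^sub>R u Q) \<in> borel_measurable borel"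
  using assms by (rule borel_measurable_continuous_on_indicator[OF hyp3_borel])

lemma bounded_on_hyp_ball:
  fixes u :: "complex \<times> real \<Rightarrow> complex"
  assumes "continuous_on hyp3 u" "P \<in> hyp3" "b \<ge> 0"
  obtains B where "\<And>Q. Q \<in> hyp3 \<Longrightarrow> hdist P Q \<le> b \<Longrightarrow> norm (u Q) \<le> B" "B \<ge> 0"
proof -
  have "compact (u ` {Q \<in> hyp3. hcosh P Q \<le> cosh b})"
    using assms by (intro compact_continuous_image compact_hcosh_ball) (auto intro: continuous_on_subset)
  then obtain B where "\<forall>y\<in>u ` {Q \<in> hyp3. hcosh P Q \<le> cosh b}. norm y \<le> B"
    using compact_imp_bounded bounded_iff by blast
  then show ?thesis using that[of "max B 0"] assms by (force simp: hdist_le_iff le_max_iff_disj)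
qed

text \<open>The majorant is a constant times \<open>1 / sinh r\<close> on the ball of radius
  \<open>b\<close>. Convergence is assumed for \<open>r > 0\<close> only: at distance
  \<open>0\<close> the division by \<open>sinh 0 = 0\<close> makes every integrand vanish.\<close>

lemma integral_radial_kernel_dominated:
  fixes u :: "complex \<times> real \<Rightarrow> complex" and f :: "nat \<Rightarrow> real \<Rightarrow> real"
  assumes u: "continuous_on hyp3 u" and P: "P \<in> hyp3" and b: "b \<ge> 0"
    and f [measurable]: "\<And>n. f n \<in> borel_measurable borel" and f0 [measurable]: "f0 \<in> borel_measurable borel"
    and bnd: "\<And>n r. r \<ge> 0 \<Longrightarrow> \<bar>f n r\<bar> \<le> M" and supp: "\<And>n r. r > b \<Longrightarrow> f n r = 0"
    and lim: "\<And>r. r > 0 \<Longrightarrow> (\<lambda>n. f n r) \<longlonglongrightarrow> f0 r"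
  shows "integrable hyp_vol (\<lambda>Q. u Q * of_real (f n (hdist P Q) / sinh (hdist P Q)))"
    and "integrable hyp_vol (\<lambda>Q. u Q * of_real (f0 (hdist P Q) / sinh (hdist P Q)))"
    and "(\<lambda>n. \<integral>Q. u Q * of_real (f n (hdist P Q) / sinh (hdist P Q)) \<partial>hyp_vol)
      \<longlonglongrightarrow> (\<integral>Q. u Q * of_real (f0 (hdist P Q) / sinh (hdist P Q)) \<partial>hyp_vol)"
proof -
  obtain B where B: "\<And>Q. Q \<in> hyp3 \<Longrightarrow> hdist P Q \<le> b \<Longrightarrow> norm (u Q) \<le> B" "B \<ge> 0"
    using bounded_on_hyp_ball[OF u P b] by blast
  have M: "M \<ge> 0" using bnd[of 0 0] by linarith
  have eq: "u Q * of_real (h (hdist P Q) / sinh (hdist P Q))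
      = (indicator hyp3 Q *\<^sub>R u Q) * of_real (h (hdist P Q) / sinh (hdist P Q))" for h Q
    using hdist_outside[OF P, of Q] by (cases "Q \<in> hyp3") auto
  have meas: "(\<lambda>Q. u Q * of_real (h (hdist P Q) / sinh (hdist P Q))) \<in> borel_measurable hyp_vol"
    if [measurable]: "h \<in> borel_measurable borel" for h
    unfolding eq using indicator_continuous_borel[OF u] by measurable
  let ?w = "\<lambda>Q. B * M * (indicator {..b} (hdist P Q) / sinh (hdist P Q))"
  have w: "integrable hyp_vol ?w"
    using integrable_inverse_sinh_hdist(1)[OF P b] by (rule integrable_mult_right)
  have dom: "norm (u Q * of_real (f n (hdist P Q) / sinh (hdist P Q))) \<le> ?w Q" for n Q
  proof (cases "Q \<in> hyp3 \<and> hdist P Q \<le> b")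
    case True
    have "sinh (hdist P Q) \<ge> 0" using hdist_nonneg by simp
    then have "norm (u Q * of_real (f n (hdist P Q) / sinh (hdist P Q))) = norm (u Q) * \<bar>f n (hdist P Q)\<bar> * (1 / sinh (hdist P Q))"
      by (simp add: norm_mult norm_divide)
    also have "\<dots> \<le> B * M * (1 / sinh (hdist P Q))"
      using B(1)[of Q] bnd[OF hdist_nonneg, of n P Q] True B(2) hdist_nonneg
      by (intro mult_right_mono mult_mono) auto
    finally show ?thesis using True by simp
  next
    case False
    then have "hdist P Q = 0 \<or> hdist P Q > b" using hdist_outside[OF P, of Q] by auto
    then show ?thesis using supp[of "hdist P Q" n] B(2) M hdist_nonneg[of P Q] by (auto intro!: mult_nonneg_nonneg divide_nonneg_nonneg)
  qed
  have pt: "(\<lambda>n. u Q * of_real (f n (hdist P Q) / sinh (hdist P Q))) \<longlonglongrightarrow> u Q * of_real (f0 (hdist P Q) / sinh (hdist P Q))" for Q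
  proof (cases "hdist P Q > 0")
    case True
    then show ?thesis using lim by (intro tendsto_intros) auto
  next
    case False
    then have "hdist P Q = 0" using hdist_nonneg[of P Q] by linarith
    then show ?thesis by simp
  qed
  note dc = _ _ w AE_I2[OF pt] AE_I2[OF dom]
  show "integrable hyp_vol (\<lambda>Q. u Q * of_real (f n (hdist P Q) / sinh (hdist P Q)))"
    by (rule Bochner_Integration.integrable_bound[OF w meas[OF f]], rule AE_I2, rule order_trans[OF dom])
       (simp only: real_norm_def abs_ge_self)
  show "integrable hyp_vol (\<lambda>Q. u Q * of_real (f0 (hdist P Q) / sinh (hdist P Q)))"
    by (rule integrable_dominated_convergence[OF dc]) (use meas f f0 in auto)
  show "(\<lambda>n. \<integral>Q. u Q * of_real (f n (hdist P Q) / sinh (hdist P Q)) \<partial>hyp_vol)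
      \<longlonglongrightarrow> (\<integral>Q. u Q * of_real (f0 (hdist P Q) / sinh (hdist P Q)) \<partial>hyp_vol)"
    by (rule integral_dominated_convergence[OF dc]) (use meas f f0 in auto)
qed

lemma partial_const [simp]: "partial v (\<lambda>_. c) = (\<lambda>_. 0)"
  by (rule ext) (simp add: partial_def vector_derivative_const_at)

lemma C2_on_const: "C2_on S (\<lambda>_. c)"
  by (simp add: C2_on_def)

lemma hyp_laplacian_const: "hyp_laplacian (\<lambda>_. c) Q = 0"
  by (simp add: hyp_laplacian_def)

text \<open>With \<open>F'' + m F = \<kappa>\<close> and \<open>F\<close> vanishing beyond \<open>1\<close>, the function
  \<open>F (hdist P \<cdot>) / sinh (hdist P \<cdot>)\<close> is a fundamental solution up to the factor \<open>F(0)\<close>. The singularity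
  at \<open>P\<close> is cut off at scale \<open>\<eta>\<close>; the mass of the error term is found by testing against the
  constant function, which is an eigenfunction for \<open>m = -1\<close>.\<close>

theorem eigenfunction_mean_value:
  fixes u :: "complex \<times> real \<Rightarrow> complex" and S C \<kappa> :: "real \<Rightarrow> real"
  assumes C2: "C2_on hyp3 u" and P: "P \<in> hyp3"
    and eig: "\<And>Q. Q \<in> hyp3 \<Longrightarrow> - hyp_laplacian u Q = of_real (1 + m) * u Q"
    and S: "\<And>x. (S has_real_derivative C x) (at x)"
    and C: "\<And>x. (C has_real_derivative - m * S x) (at x)"
    and S0: "S 0 = 0" and C0: "C 0 = 1"
    and \<kappa>: "continuous_on UNIV \<kappa>" and \<kappa>1: "\<And>s. s \<ge> 1 \<Longrightarrow> \<kappa> s = 0"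
  shows "integrable hyp_vol (\<lambda>Q. u Q * of_real (\<kappa> (hdist P Q) / sinh (hdist P Q)))"
    and "(\<integral>Q. u Q * of_real (\<kappa> (hdist P Q) / sinh (hdist P Q)) \<partial>hyp_vol)
      = of_real (4 * pi * integral {0..1} (\<lambda>s. \<kappa> s * S s)) * u P"
proof -
  have cont: "continuous_on UNIV f" if "\<And>x. (f has_real_derivative f' x) (at x)" for f f' :: "real \<Rightarrow> real"
    using that by (meson DERIV_isCont continuous_at_imp_continuous_on)
  have cS: "continuous_on UNIV S" and cC: "continuous_on UNIV C"
    using cont[OF S] cont[OF C] by auto
  \<comment> \<open>The Wronskian of \<open>C\<close> and \<open>S\<close> is constantly
    \<open>1\<close>, the normalisation that variation of parameters relies on.\<close>
  have pyth: "(C x)\<^sup>2 + m * (S x)\<^sup>2 = 1" for x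
  proof -
    have "((\<lambda>x. (C x)\<^sup>2 + m * (S x)\<^sup>2) has_real_derivative 0) (at x)" for x
      by (rule derivative_eq_intros S C refl)+ (simp add: algebra_simps)
    then have "(C x)\<^sup>2 + m * (S x)\<^sup>2 = (C 0)\<^sup>2 + m * (S 0)\<^sup>2"
      by (intro DERIV_isconst_all) auto
    then show ?thesis by (simp add: S0 C0)
  qed
  have anti: "\<exists>A. (\<forall>x. (A has_real_derivative - (\<kappa> x * f x)) (at x)) \<and> (\<forall>x\<ge>1. A x = 0)"
    if "continuous_on UNIV f" for f
  proof -
    have "continuous_on UNIV (\<lambda>x. \<kappa> x * f x)" by (intro continuous_intros \<kappa> that)
    from continuous_real_antiderivative[OF this]
    obtain A0 where A0: "\<And>x. (A0 has_real_derivative \<kappa> x * f x) (at x)" by metis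
    have "A0 1 - A0 x = 0" if "x \<ge> 1" for x
    proof (cases "x = 1")
      case False
      have "A0 x = A0 1"
      proof (rule DERIV_isconst_end[where f = A0])
        show "1 < x" using that False by simp
        show "continuous_on {1..x} A0" using cont[OF A0] continuous_on_subset by blast
        show "(A0 has_real_derivative 0) (at y)" if "1 < y" "y < x" for y
          using A0[of y] \<kappa>1[of y] that by simp
      qed
      then show ?thesis by simp
    qed simp
    then show ?thesis
      using A0 by (intro exI[of _ "\<lambda>x. A0 1 - A0 x"]) (auto intro!: derivative_eq_intros)
  qed
  obtain A where A: "\<And>x. (A has_real_derivative - (\<kappa> x * S x)) (at x)" and A1: "\<And>x. x \<ge> 1 \<Longrightarrow> A x = 0"
    using anti[OF cS] by blast
  obtain B where B: "\<And>x. (B has_real_derivative - (\<kappa> x * C x)) (at x)" and B1: "\<And>x. x \<ge> 1 \<Longrightarrow> B x = 0"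
    using anti[OF cC] by blast
  \<comment> \<open>Variation of parameters for \<open>F'' + m * F = \<kappa>\<close>. Here
    \<open>A\<close> and \<open>B\<close> are the integrals of \<open>\<kappa> * S\<close> and
    \<open>\<kappa> * C\<close> from \<open>r\<close> to \<open>1\<close>, so \<open>F\<close>
    vanishes beyond \<open>1\<close> and \<open>F 0 = A 0\<close> is the transform of
    \<open>\<kappa>\<close>.\<close>
  define F where "F r = C r * A r - S r * B r" for r
  define F1 where "F1 r = - m * S r * A r - C r * B r" for r
  have dF: "(F has_real_derivative F1 r) (at r)" for r
    unfolding F_def F1_def by (rule derivative_eq_intros S C A B refl)+ (simp add: algebra_simps)
  have dF1: "(F1 has_real_derivative \<kappa> r - m * F r) (at r)" for r
  proof -
    have "(F1 has_real_derivative \<kappa> r * ((C r)\<^sup>2 + m * (S r)\<^sup>2) - m * F r) (at r)"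
      unfolding F_def F1_def
      by (rule derivative_eq_intros S C A B refl)+ (simp add: algebra_simps power2_eq_square)
    then show ?thesis by (simp add: pyth)
  qed
  have F0: "F 0 = integral {0..1} (\<lambda>s. \<kappa> s * S s)"
  proof -
    have "((\<lambda>s. \<kappa> s * S s) has_integral (- A 1 - - A 0)) {0..1}"
      by (rule fundamental_theorem_of_calculus)
         (use DERIV_minus[OF A] in \<open>auto simp: has_real_derivative_iff_has_vector_derivative intro: has_vector_derivative_at_within\<close>)
    then show ?thesis by (simp add: F_def S0 C0 A1 integral_unique)
  qed
  have Fz: "F r = 0 \<and> F1 r = 0 \<and> \<kappa> r = 0" if "r \<ge> 1" for r
    using that A1 B1 \<kappa>1 by (simp add: F_def F1_def)
  have cF: "continuous_on UNIV F" "continuous_on UNIV F1"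
    using cont[OF dF] cont[OF dF1] by auto
  have "\<exists>M. \<forall>r\<in>{0..1}. \<bar>f r\<bar> \<le> M" if "continuous_on UNIV f" for f :: "real \<Rightarrow> real"
  proof -
    have "compact (f ` {0..1})"
      using that by (intro compact_continuous_image) (auto intro: continuous_on_subset)
    then show ?thesis using compact_imp_bounded bounded_iff by (metis imageI real_norm_def)
  qed
  from this[OF cF(1)] this[OF cF(2)] this[OF \<kappa>]
  obtain M1 M2 M3 where M': "\<And>r. r \<in> {0..1} \<Longrightarrow> \<bar>F r\<bar> \<le> M1" "\<And>r. r \<in> {0..1} \<Longrightarrow> \<bar>F1 r\<bar> \<le> M2"
      "\<And>r. r \<in> {0..1} \<Longrightarrow> \<bar>\<kappa> r\<bar> \<le> M3" by metis
  define M where "M = max 0 (max M1 (max M2 M3))"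
  have M: "\<bar>F r\<bar> \<le> M" "\<bar>F1 r\<bar> \<le> M" "\<bar>\<kappa> r\<bar> \<le> M" "M \<ge> 0" if "r \<ge> 0" for r
  proof -
    have m: "M \<ge> 0" "M1 \<le> M" "M2 \<le> M" "M3 \<le> M" by (simp_all add: M_def)
    show "M \<ge> 0" by (rule m)
    show "\<bar>F r\<bar> \<le> M" "\<bar>F1 r\<bar> \<le> M" "\<bar>\<kappa> r\<bar> \<le> M"
      using M'[of r] Fz[of r] that m by (cases "r \<le> 1"; simp)+
  qed
  obtain h h1 h2 :: "real \<Rightarrow> real" and N where
    h: "\<And>x. (h has_real_derivative h1 x) (at x)" and h1: "\<And>x. (h1 has_real_derivative h2 x) (at x)"
    and ch2: "continuous_on UNIV h2"
    and hlo: "\<And>x. x \<le> 0 \<Longrightarrow> h x = 0 \<and> h1 x = 0 \<and> h2 x = 0"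
    and hhi: "\<And>x. x \<ge> 3 \<Longrightarrow> h x = 1 \<and> h1 x = 0 \<and> h2 x = 0"
    and hN: "\<And>x. \<bar>h x\<bar> \<le> N \<and> \<bar>h1 x\<bar> \<le> N \<and> \<bar>h2 x\<bar> \<le> N"
    by (rule smooth_step_exists) (rule that; assumption)
  have N: "N \<ge> 0" using hN[of 0] by linarith
  have ch: "continuous_on UNIV h" "continuous_on UNIV h1" using cont[OF h] cont[OF h1] by auto
  \<comment> \<open>The shift by \<open>4\<close> gives \<open>4 * \<eta> n \<le> 1\<close>: the
    cut-off acts inside the unit ball, and \<open>cosh_le_1_plus_square\<close> applies at
    \<open>4 * \<eta> n\<close>.\<close>
  define \<eta> :: "nat \<Rightarrow> real" where "\<eta> n = inverse (real (n + 4))" for n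
  have \<eta>: "\<eta> n > 0" "4 * \<eta> n \<le> 1" for n by (auto simp: \<eta>_def field_simps)
  have \<eta>0: "\<eta> \<longlonglongrightarrow> 0"
  proof -
    have "(\<lambda>n. inverse (real (Suc (n + 3)))) \<longlonglongrightarrow> 0"
      using LIMSEQ_inverse_real_of_nat by (rule LIMSEQ_ignore_initial_segment)
    then show ?thesis by (simp add: \<eta>_def[abs_def] add.commute)
  qed
  define H where "H n r = h (r / \<eta> n - 1)" for n r
  define H1 where "H1 n r = h1 (r / \<eta> n - 1) / \<eta> n" for n r
  define H2 where "H2 n r = h2 (r / \<eta> n - 1) / (\<eta> n)\<^sup>2" for n r
  have dlin: "((\<lambda>r. r / \<eta> n - 1) has_real_derivative 1 / \<eta> n) (at r)" for n r
    using \<eta>(1)[of n] by (auto intro!: derivative_eq_intros)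
  have dH: "(H n has_real_derivative H1 n r) (at r)" for n r
    unfolding H_def H1_def using DERIV_chain2[where f = h and g = "\<lambda>r. r / \<eta> n - 1", OF h dlin] by simp
  have dH1: "(H1 n has_real_derivative H2 n r) (at r)" for n r
    using DERIV_cdivide[OF DERIV_chain2[where f = h1 and g = "\<lambda>r. r / \<eta> n - 1", OF h1 dlin], where c = "\<eta> n"]
    unfolding H1_def H2_def by (simp add: power2_eq_square)
  have cH2: "continuous_on UNIV (H2 n)" for n
  proof -
    have "continuous_on UNIV (\<lambda>r. h2 (r / \<eta> n - 1))"
      using continuous_on_compose2[OF ch2, of UNIV "\<lambda>r. r / \<eta> n - 1"] \<eta>(1)[of n]
      by (simp add: continuous_intros)
    then show ?thesis unfolding H2_def using \<eta>(1)[of n] by (intro continuous_intros) auto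
  qed
  have Hlo: "H n r = 0 \<and> H1 n r = 0 \<and> H2 n r = 0" if "r \<le> \<eta> n" for n r
    using hlo[of "r / \<eta> n - 1"] that \<eta>(1)[of n] by (simp add: H_def H1_def H2_def divide_le_eq)
  have Hhi: "H n r = 1 \<and> H1 n r = 0 \<and> H2 n r = 0" if "r \<ge> 4 * \<eta> n" for n r
    using hhi[of "r / \<eta> n - 1"] that \<eta>(1)[of n] by (simp add: H_def H1_def H2_def le_divide_eq)
  have HN: "\<bar>H n r\<bar> \<le> N" for n r using hN by (simp add: H_def)
  \<comment> \<open>The terms of \<open>G2\<close> in which the cut-off is differentiated, supported
    between \<open>\<eta> n\<close> and \<open>4 * \<eta> n\<close>. Their pairing with
    \<open>u\<close> is computed twice: Green's identity gives the limit
    \<open>- ?I u \<kappa>\<close>, and concentration at \<open>P\<close> gives \<open>u P\<close>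
    times the limit of their total mass.\<close>
  define \<psi> where "\<psi> n r = H2 n r * F r + 2 * H1 n r * F1 r" for n r
  define G where "G n r = H n r * F r" for n r
  define G1 where "G1 n r = H1 n r * F r + H n r * F1 r" for n r
  define G2 where "G2 n r = \<psi> n r + H n r * (\<kappa> r - m * F r)" for n r
  have dG: "(G n has_real_derivative G1 n r) (at r)" for n r
    unfolding G_def G1_def by (rule derivative_eq_intros dH dF refl)+ (simp add: algebra_simps)
  have dG1: "(G1 n has_real_derivative G2 n r) (at r)" for n r
    unfolding G1_def G2_def \<psi>_def by (rule derivative_eq_intros dH dH1 dF dF1 refl)+ (simp add: algebra_simps)
  have cH: "continuous_on UNIV (H n)" "continuous_on UNIV (H1 n)" for n
    using cont[OF dH] cont[OF dH1] by auto
  have c\<psi>: "continuous_on UNIV (\<psi> n)" for n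
    unfolding \<psi>_def by (intro continuous_intros cH2 cH cF)
  have cG2: "continuous_on UNIV (G2 n)" for n
    unfolding G2_def by (intro continuous_intros c\<psi> cH cF \<kappa>)
  have Gz: "G n r = 0 \<and> G1 n r = 0 \<and> G2 n r = 0" if "r < \<eta> n \<or> r > 1" for n r
    using that Hlo[of r n] Fz[of r] by (auto simp: G_def G1_def G2_def \<psi>_def)
  note bm = borel_measurable_continuous_onI
  let ?\<rho> = "hdist P"
  let ?I = "\<lambda>(v :: complex \<times> real \<Rightarrow> complex) (f :: real \<Rightarrow> real). \<integral>Q. v Q * of_real (f (?\<rho> Q) / sinh (?\<rho> Q)) \<partial>hyp_vol"
  let ?int = "\<lambda>(v :: complex \<times> real \<Rightarrow> complex) (f :: real \<Rightarrow> real). integrable hyp_vol (\<lambda>Q. v Q * of_real (f (?\<rho> Q) / sinh (?\<rho> Q)))"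
  have cu: "continuous_on hyp3 u" using C2_on_continuous(1)[OF C2, of "(0, 1)"] by (simp add: Basis_complex_real)
  have int_b: "?int v f" if "continuous_on hyp3 v" "continuous_on UNIV f" "\<And>r. r \<ge> 1 \<Longrightarrow> f r = 0" for v f
  proof -
    have "compact (f ` {0..1})"
      using that(2) by (intro compact_continuous_image) (auto intro: continuous_on_subset)
    then obtain K where K: "\<And>r. r \<in> {0..1} \<Longrightarrow> \<bar>f r\<bar> \<le> K"
      using compact_imp_bounded bounded_iff by (metis imageI real_norm_def)
    show ?thesis
    proof (rule integral_radial_kernel_dominated(2)[OF that(1) P, of 1 "\<lambda>_. f" f "max K 0"])
      show "\<bar>f r\<bar> \<le> max K 0" if "r \<ge> 0" for r
        using K[of r] that \<open>\<And>r. r \<ge> 1 \<Longrightarrow> f r = 0\<close>[of r] by (cases "r \<le> 1") (auto simp: le_max_iff_disj)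
    qed (use that(3) bm[OF that(2)] in auto)
  qed
  show "?int u \<kappa>" by (rule int_b[OF cu \<kappa> \<kappa>1])
  have lim: "(\<lambda>n. ?I v (\<lambda>r. H n r * f r)) \<longlonglongrightarrow> ?I v f"
    if v: "continuous_on hyp3 v" and f: "continuous_on UNIV f" and f1: "\<And>r. r \<ge> 1 \<Longrightarrow> f r = 0"
      and K: "\<And>r. r \<ge> 0 \<Longrightarrow> \<bar>f r\<bar> \<le> K" for v f K
  proof -
    show ?thesis
    proof (rule integral_radial_kernel_dominated(3)[OF v P, of 1 "\<lambda>n r. H n r * f r" f "N * K"])
      show "(\<lambda>r. H n r * f r) \<in> borel_measurable borel" for n
        by (intro bm continuous_intros cH f)
      show "f \<in> borel_measurable borel" by (intro bm f)
      show "\<bar>H n r * f r\<bar> \<le> N * K" if "r \<ge> 0" for n r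
        unfolding abs_mult by (intro mult_mono HN N K that) simp
      show "H n r * f r = 0" if "r > 1" for n r using that f1 by simp
      show "(\<lambda>n. H n r * f r) \<longlonglongrightarrow> f r" if "r > 0" for r
      proof -
        have "\<forall>\<^sub>F n in sequentially. \<eta> n < r / 4"
          using order_tendstoD(2)[OF \<eta>0, of "r / 4"] that by simp
        then have "\<forall>\<^sub>F n in sequentially. H n r * f r = f r"
          by eventually_elim (use Hhi[of _ r] in auto)
        then show ?thesis by (rule tendsto_eventually)
      qed
    qed simp
  qed
  have \<psi>z: "\<psi> n r = 0" if "r \<ge> 1" for n r using Fz[OF that] by (simp add: \<psi>_def)
  \<comment> \<open>The separate parameter \<open>m'\<close> allows two uses: \<open>m' = m\<close>
    for \<open>u\<close> itself, and \<open>m' = -1\<close> for the constant function, whose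
    eigenvalue is \<open>0\<close>, to find the mass.\<close>
  have zero: "?I v (\<lambda>r. \<psi> n r) = - ?I v (\<lambda>r. H n r * (\<kappa> r - (m - m') * F r))"
    if v: "C2_on hyp3 v" and ev: "\<And>Q. Q \<in> hyp3 \<Longrightarrow> - hyp_laplacian v Q = of_real (1 + m') * v Q" for v m' n
  proof -
    have cv: "continuous_on hyp3 v" using C2_on_continuous(1)[OF v, of "(0, 1)"] by (simp add: Basis_complex_real)
    have "?I v (\<lambda>r. G2 n r + m' * G n r) = 0"
      by (rule integral_eigenfunction_radial_ode[OF v P ev dG dG1 cG2 \<eta>(1)[of n]]; (assumption | erule Gz))
    also have "?I v (\<lambda>r. G2 n r + m' * G n r) = (\<integral>Q. v Q * of_real (\<psi> n (?\<rho> Q) / sinh (?\<rho> Q))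
        + v Q * of_real (H n (?\<rho> Q) * (\<kappa> (?\<rho> Q) - (m - m') * F (?\<rho> Q)) / sinh (?\<rho> Q)) \<partial>hyp_vol)"
      by (intro Bochner_Integration.integral_cong refl)
         (simp add: G2_def G_def add_divide_distrib[symmetric] distrib_left[symmetric] of_real_add[symmetric] del: of_real_add,
          simp add: algebra_simps)
    also have "\<dots> = ?I v (\<lambda>r. \<psi> n r) + ?I v (\<lambda>r. H n r * (\<kappa> r - (m - m') * F r))"
      by (intro Bochner_Integration.integral_add int_b cv c\<psi> \<psi>z continuous_intros cH \<kappa> cF) (auto simp: Fz)
    finally show ?thesis by (simp add: eq_neg_iff_add_eq_0)
  qed
  define J where "J = (\<lambda>r. \<kappa> r - (m + 1) * F r)"
  have cJ: "continuous_on UNIV J" unfolding J_def by (intro continuous_intros \<kappa> cF)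
  have L1: "(\<lambda>n. ?I u (\<psi> n)) \<longlonglongrightarrow> - ?I u \<kappa>"
    using tendsto_minus[OF lim[OF cu \<kappa> \<kappa>1 M(3)]] zero[OF C2 eig] by simp
  have L2: "(\<lambda>n. ?I (\<lambda>_. 1) (\<psi> n)) \<longlonglongrightarrow> - ?I (\<lambda>_. 1) J"
  proof -
    have "\<bar>J r\<bar> \<le> M + \<bar>m + 1\<bar> * M" if "r \<ge> 0" for r
      using M[OF that] unfolding J_def
      by (intro order_trans[OF abs_triangle_ineq4] add_mono) (auto simp: abs_mult mult_left_mono)
    moreover have "J r = 0" if "r \<ge> 1" for r using Fz[OF that] by (simp add: J_def)
    ultimately have "(\<lambda>n. ?I (\<lambda>_. 1) (\<lambda>r. H n r * J r)) \<longlonglongrightarrow> ?I (\<lambda>_. 1) J"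
      by (intro lim cJ) auto
    from tendsto_minus[OF this] show ?thesis
      using zero[OF C2_on_const[of hyp3 1], of "-1"] by (simp add: hyp_laplacian_const J_def)
  qed
  \<comment> \<open>\<open>J r * sinh r\<close> is the derivative of
    \<open>F1 r * sinh r - F r * cosh r\<close>. At \<open>1\<close> this vanishes, and at
    \<open>0\<close> it leaves \<open>F 0\<close>.\<close>
  have IJ: "?I (\<lambda>_. 1) J = of_real (4 * pi * F 0)"
  proof -
    have [measurable]: "J \<in> borel_measurable borel" by (intro bm cJ)
    have "?I (\<lambda>_. 1) J = of_real (\<integral>Q. J (?\<rho> Q) / sinh (?\<rho> Q) \<partial>hyp_vol)"
      by (subst integral_complex_of_real[symmetric]) simp
    also have "(\<integral>Q. J (?\<rho> Q) / sinh (?\<rho> Q) \<partial>hyp_vol) = (\<integral>r. indicator {0..} r * (4 * pi * (sinh r)\<^sup>2 * (J r / sinh r)) \<partial>lborel)"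
      by (rule integral_radial[OF P]) measurable
    also have "\<dots> = (\<integral>r. (4 * pi * (J r * sinh r)) * indicator {0..1} r \<partial>lborel)"
      by (intro Bochner_Integration.integral_cong refl) (use Fz in \<open>auto simp: indicator_def power2_eq_square J_def\<close>)
    also have "\<dots> = 4 * pi * (F1 1 * sinh 1 - F 1 * cosh 1) - 4 * pi * (F1 0 * sinh 0 - F 0 * cosh 0)"
    proof (rule integral_FTC_Icc_real)
      show "((\<lambda>r. 4 * pi * (F1 r * sinh r - F r * cosh r)) has_real_derivative 4 * pi * (J r * sinh r)) (at r)" for r
        unfolding J_def by (rule derivative_eq_intros dF dF1 refl)+ (simp add: algebra_simps)
      show "isCont (\<lambda>r. 4 * pi * (J r * sinh r)) r" for r
        using cJ by (intro continuous_intros) (auto simp: continuous_on_eq_continuous_at)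
    qed simp
    finally show ?thesis using Fz[of 1] by simp
  qed
  have L3: "(\<lambda>n. ?I (\<lambda>Q. u Q - u P) (\<psi> n)) \<longlonglongrightarrow> 0"
  proof (rule LIMSEQ_I)
    fix e :: real assume e: "e > 0"
    define K where "K = 3 * N * M"
    have K: "K \<ge> 0" using N M(4)[of 0] by (simp add: K_def)
    have \<psi>b: "\<bar>\<psi> n r\<bar> \<le> K / (\<eta> n)\<^sup>2 * indicator {..4 * \<eta> n} r" if r: "r \<ge> 0" for n r
    proof (cases "r \<le> 4 * \<eta> n")
      case True
      have "\<bar>H2 n r\<bar> \<le> N / (\<eta> n)\<^sup>2" "\<bar>H1 n r\<bar> \<le> N / \<eta> n"
        using hN[of "r / \<eta> n - 1"] \<eta>(1)[of n] by (auto simp: H1_def H2_def divide_right_mono)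
      moreover have "N / \<eta> n \<le> N / (\<eta> n)\<^sup>2"
        using \<eta>[of n] N by (intro divide_left_mono) (auto simp: power2_eq_square mult_le_cancel_left1)
      ultimately have H: "\<bar>H2 n r\<bar> \<le> N / (\<eta> n)\<^sup>2" "\<bar>H1 n r\<bar> \<le> N / (\<eta> n)\<^sup>2" by linarith+
      have "\<bar>H2 n r * F r\<bar> \<le> N / (\<eta> n)\<^sup>2 * M" "\<bar>H1 n r * F1 r\<bar> \<le> N / (\<eta> n)\<^sup>2 * M"
        unfolding abs_mult by (intro mult_mono H M[OF r]; use N in simp)+
      then have "\<bar>\<psi> n r\<bar> \<le> N / (\<eta> n)\<^sup>2 * M + 2 * (N / (\<eta> n)\<^sup>2 * M)"
        unfolding \<psi>_def by (intro order_trans[OF abs_triangle_ineq] add_mono) (auto simp: abs_mult)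
      then show ?thesis using True by (simp add: K_def mult_ac)
    next
      case False
      then show ?thesis using Hhi[of n r] by (simp add: \<psi>_def)
    qed
    \<comment> \<open>Although \<open>\<psi> n\<close> grows like \<open>K / (\<eta> n) ^ 2\<close>,
      its mass stays bounded: \<open>64 * pi\<close> is \<open>4 * pi * 4 ^ 2\<close>, from a ball
      of radius \<open>4 * \<eta> n\<close>. Continuity of \<open>u\<close> at \<open>P\<close> then
      makes \<open>e'\<close> arbitrarily small.\<close>
    have IB: "norm (?I v (\<psi> n)) \<le> e' * (64 * pi * K)"
      if v: "continuous_on hyp3 v" and vb: "\<And>Q. Q \<in> hyp3 \<Longrightarrow> ?\<rho> Q \<le> 4 * \<eta> n \<Longrightarrow> norm (v Q) \<le> e'" and e': "e' \<ge> 0" for v e' n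
    proof -
      have "norm (?I v (\<psi> n)) \<le> (\<integral>Q. e' * (K / (\<eta> n)\<^sup>2) * (indicator {..4 * \<eta> n} (?\<rho> Q) / sinh (?\<rho> Q)) \<partial>hyp_vol)"
      proof (rule Bochner_Integration.integral_norm_bound_integral)
        show "?int v (\<psi> n)" by (rule int_b[OF v c\<psi> \<psi>z])
        show "integrable hyp_vol (\<lambda>Q. e' * (K / (\<eta> n)\<^sup>2) * (indicator {..4 * \<eta> n} (?\<rho> Q) / sinh (?\<rho> Q)))"
          using \<eta>(1)[of n] by (intro integrable_mult_right integrable_inverse_sinh_hdist(1)[OF P]) simp
        fix Q
        have sh: "sinh (?\<rho> Q) \<ge> 0" using hdist_nonneg by simp
        show "norm (v Q * of_real (\<psi> n (?\<rho> Q) / sinh (?\<rho> Q))) \<le> e' * (K / (\<eta> n)\<^sup>2) * (indicator {..4 * \<eta> n} (?\<rho> Q) / sinh (?\<rho> Q))"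
        proof (cases "Q \<in> hyp3 \<and> ?\<rho> Q \<le> 4 * \<eta> n")
          case True
          have "norm (v Q * of_real (\<psi> n (?\<rho> Q) / sinh (?\<rho> Q))) = norm (v Q) * \<bar>\<psi> n (?\<rho> Q)\<bar> / sinh (?\<rho> Q)"
            using sh by (simp add: norm_mult norm_divide)
          also have "\<dots> \<le> e' * (K / (\<eta> n)\<^sup>2 * indicator {..4 * \<eta> n} (?\<rho> Q)) / sinh (?\<rho> Q)"
            using True vb[of Q] \<psi>b[OF hdist_nonneg, of n P Q] sh e' by (intro divide_right_mono mult_mono) auto
          finally show ?thesis by simp
        next
          case False
          then have "?\<rho> Q = 0 \<or> \<psi> n (?\<rho> Q) = 0"
            using hdist_outside[OF P, of Q] \<psi>b[OF hdist_nonneg, of n P Q] by (cases "Q \<in> hyp3") auto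
          then show ?thesis using K e' sh by (auto intro!: mult_nonneg_nonneg divide_nonneg_nonneg)
        qed
      qed
      also have "\<dots> = e' * (K / (\<eta> n)\<^sup>2) * (4 * pi * (cosh (4 * \<eta> n) - 1))"
        unfolding integral_mult_right_zero
        by (subst integrable_inverse_sinh_hdist(2)[OF P]) (use \<eta>(1)[of n] in auto)
      also have "\<dots> \<le> e' * (K / (\<eta> n)\<^sup>2) * (4 * pi * (4 * \<eta> n)\<^sup>2)"
        using cosh_le_1_plus_square[of "4 * \<eta> n"] \<eta>[of n] e' K by (intro mult_left_mono) auto
      also have "\<dots> = e' * (64 * pi * K)"
        using \<eta>(1)[of n] by (simp add: field_simps power2_eq_square)
      finally show ?thesis .
    qed
    define D where "D = 64 * pi * K + 1"
    define e' where "e' = e / (2 * D)"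
    have D: "D > 0" unfolding D_def using K by (intro add_nonneg_pos) auto
    have e': "e' > 0" using e D by (simp add: e'_def)
    have "open (hyp3 \<inter> u -` ball (u P) e')"
      using continuous_on_open_vimage[OF open_hyp3, of u] cu by (simp add: Int_commute)
    then obtain c where c: "c > 1" "\<And>Q. Q \<in> hyp3 \<Longrightarrow> hcosh P Q \<le> c \<Longrightarrow> Q \<in> hyp3 \<inter> u -` ball (u P) e'"
      using hcosh_ball_subset[OF P, of "hyp3 \<inter> u -` ball (u P) e'"] P e' by auto
    define d where "d = arcosh c"
    have "d \<noteq> 0" "d \<ge> 0" using c(1) by (simp_all add: d_def)
    then have "d > 0" by simp
    have "norm (u Q - u P) \<le> e'" if "Q \<in> hyp3" "?\<rho> Q \<le> d" for Q
    proof -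
      have "hcosh P Q \<le> c" using hdist_le_iff[OF P that(1) \<open>d \<ge> 0\<close>] that(2) c(1) by (simp add: d_def)
      then show ?thesis using c(2)[OF that(1)] by (simp add: dist_norm norm_minus_commute)
    qed
    note d = \<open>d > 0\<close> this
    have "\<forall>\<^sub>F n in sequentially. \<eta> n < d / 4"
      using order_tendstoD(2)[OF \<eta>0, of "d / 4"] d by simp
    then obtain n0 where n0: "\<And>n. n \<ge> n0 \<Longrightarrow> \<eta> n < d / 4"
      by (auto simp: eventually_sequentially)
    have "norm (?I (\<lambda>Q. u Q - u P) (\<psi> n) - 0) < e" if "n \<ge> n0" for n
    proof -
      have "norm (?I (\<lambda>Q. u Q - u P) (\<psi> n)) \<le> e' * (64 * pi * K)"
        by (rule IB) (use n0[OF that] d(2) e' in \<open>auto intro!: continuous_intros cu\<close>)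
      also have "\<dots> \<le> e' * D" unfolding D_def using e' by (intro mult_left_mono) auto
      also have "\<dots> = e / 2" using D by (simp add: e'_def)
      also have "\<dots> < e" using e by simp
      finally show ?thesis by simp
    qed
    then show "\<exists>no. \<forall>n\<ge>no. norm (?I (\<lambda>Q. u Q - u P) (\<psi> n) - 0) < e" by blast
  qed
  have split: "?I u (\<psi> n) = ?I (\<lambda>Q. u Q - u P) (\<psi> n) + u P * ?I (\<lambda>_. 1) (\<psi> n)" for n
  proof -
    have "?I u (\<psi> n) = (\<integral>Q. (u Q - u P) * of_real (\<psi> n (?\<rho> Q) / sinh (?\<rho> Q))
        + u P * (1 * of_real (\<psi> n (?\<rho> Q) / sinh (?\<rho> Q))) \<partial>hyp_vol)"
      by (intro Bochner_Integration.integral_cong refl) (simp add: left_diff_distrib diff_divide_distrib)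
    also have "\<dots> = ?I (\<lambda>Q. u Q - u P) (\<psi> n) + (\<integral>Q. u P * (1 * of_real (\<psi> n (?\<rho> Q) / sinh (?\<rho> Q))) \<partial>hyp_vol)"
    proof (rule Bochner_Integration.integral_add)
      show "?int (\<lambda>Q. u Q - u P) (\<psi> n)"
        by (intro int_b c\<psi> continuous_intros cu) (rule \<psi>z)
      have "?int (\<lambda>_. 1) (\<psi> n)" by (intro int_b c\<psi> continuous_intros) (rule \<psi>z)
      then show "integrable hyp_vol (\<lambda>Q. u P * (1 * of_real (\<psi> n (?\<rho> Q) / sinh (?\<rho> Q))))"
        by (rule integrable_mult_right)
    qed
    finally show ?thesis by (simp only: integral_mult_right_zero)
  qed
  have "(\<lambda>n. ?I u (\<psi> n)) \<longlonglongrightarrow> 0 + u P * - ?I (\<lambda>_. 1) J"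
    unfolding split by (intro tendsto_intros L2 L3)
  from LIMSEQ_unique[OF L1 this] show "?I u \<kappa> = of_real (4 * pi * integral {0..1} (\<lambda>s. \<kappa> s * S s)) * u P"
    unfolding IJ F0 by simp
qed

section \<open>The action on hyperbolic space and discrete subgroups\<close>

text \<open>The Hermitian model of hyperbolic space. In it the fractional linear action becomes
  linear, so that composition and invariance of distance turn into matrix identities.\<close>

definition hmat :: "complex \<times> real \<Rightarrow> complex^2^2" where
  "hmat P = vector [vector [of_real ((cmod (fst P))\<^sup>2 + (snd P)\<^sup>2) / of_real (snd P), fst P / of_real (snd P)],
                    vector [cnj (fst P) / of_real (snd P), 1 / of_real (snd P)]]"

definition adj :: "complex^2^2 \<Rightarrow> complex^2^2" where
  "adj A = (\<chi> i j. cnj (A $ j $ i))"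

lemma hmat_nth [simp]:
  "hmat P $ 1 $ 1 = of_real ((cmod (fst P))\<^sup>2 + (snd P)\<^sup>2) / of_real (snd P)"
  "hmat P $ 1 $ 2 = fst P / of_real (snd P)"
  "hmat P $ 2 $ 1 = cnj (fst P) / of_real (snd P)"
  "hmat P $ 2 $ 2 = 1 / of_real (snd P)"
  by (simp_all add: hmat_def)

lemma of_real_cmod_square: "(complex_of_real (cmod z))\<^sup>2 = z * cnj z"
  by (metis complex_norm_square of_real_power)

lemma matrix_mul_add_right: "(A + B) ** C = A ** C + B ** C" for A :: "complex^2^2"
  by (simp add: vec_eq_iff matrix_matrix_mult_def distrib_right sum.distrib)

lemma adj_mult: "adj (A ** B) = adj B ** adj A"
  by (simp add: adj_def vec_eq_iff matrix_matrix_mult_def mult.commute)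

lemma det_adj: "det (adj A) = cnj (det A)"
  by (simp add: adj_def det_2 mult.commute)

text \<open>The action is the action \<open>H \<mapsto> A H A\<^sup>*\<close> on positive definite Hermitian matrices of determinant \<open>1\<close>.\<close>

lemma hmat_act:
  assumes A: "det A = 1" and P: "P \<in> hyp3"
  shows "hmat (sl2_act A P) = A ** hmat P ** adj A"
proof -
  define a b c d where abcd: "a = A $ 1 $ 1" "b = A $ 1 $ 2" "c = A $ 2 $ 1" "d = A $ 2 $ 2"
  obtain z y where Pzy: "P = (z, y)" by force
  have y: "y > 0" using P by (simp add: Pzy hyp3_def)
  have D: "a * d - b * c = 1" using A by (simp add: det_2 abcd)
  then have D': "cnj a * cnj d - cnj b * cnj c = 1" by (metis complex_cnj_diff complex_cnj_mult complex_cnj_one)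
  define N where "N = (cmod (c * z + d))\<^sup>2 + (cmod c)\<^sup>2 * y\<^sup>2"
  define w where "w = (a * z + b) * cnj (c * z + d) + a * cnj c * of_real (y\<^sup>2)"
  have act: "sl2_act A P = (w / of_real N, y / N)"
    by (simp add: sl2_act_def Let_def Pzy abcd N_def w_def)
  have N: "N > 0"
    using sl2_act_mem_hyp3[OF A P] y unfolding act hyp3_def by (simp add: zero_less_divide_iff)
  have cN: "complex_of_real N \<noteq> 0" "complex_of_real y \<noteq> 0" using N y by simp_all
  have Ne: "of_real N = (c * z + d) * cnj (c * z + d) + c * cnj c * of_real y ^ 2"
    unfolding N_def by (simp add: of_real_cmod_square)
  define M where "M = (a * z + b) * cnj (a * z + b) + a * cnj a * of_real y ^ 2"
  have key: "w * cnj w + of_real y ^ 2 = of_real N * M"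
  proof -
    have "of_real N * M - w * cnj w = of_real y ^ 2 * ((a * d - b * c) * (cnj a * cnj d - cnj b * cnj c))"
      unfolding Ne M_def w_def by (simp add: algebra_simps power2_eq_square)
    then show ?thesis using D D' by (simp add: algebra_simps)
  qed
  have e11: "of_real ((cmod (w / of_real N))\<^sup>2 + (y / N)\<^sup>2) / of_real (y / N) = M / of_real y"
  proof -
    have "complex_of_real ((cmod (w / of_real N))\<^sup>2 + (y / N)\<^sup>2) = (w * cnj w + of_real y ^ 2) / of_real N ^ 2"
      by (simp add: norm_divide power_divide complex_norm_square add_divide_distrib del: of_real_power)
         (simp add: complex_norm_square)
    then show ?thesis unfolding key using cN by (simp add: field_simps power2_eq_square)
  qed
  have "hmat (sl2_act A P) $ i $ j = (A ** hmat P ** adj A) $ i $ j" for i j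
    using exhaust_2[of i] exhaust_2[of j]
  proof (elim disjE; simp only:)
    have "hmat (sl2_act A P) $ 1 $ 1 = M / of_real y"
      unfolding act hmat_nth fst_conv snd_conv by (rule e11)
    also have "M / of_real y = (A ** hmat P ** adj A) $ 1 $ 1"
      using cN
      by (simp add: matrix_matrix_mult_def sum_2 adj_def abcd[symmetric] Pzy M_def of_real_cmod_square)
         (simp add: field_simps power2_eq_square)
    finally show "hmat (sl2_act A P) $ 1 $ 1 = (A ** hmat P ** adj A) $ 1 $ 1" .
    show "hmat (sl2_act A P) $ 1 $ 2 = (A ** hmat P ** adj A) $ 1 $ 2"
      unfolding act using cN
      by (simp add: matrix_matrix_mult_def sum_2 adj_def abcd[symmetric] Pzy w_def of_real_cmod_square)
         (simp add: field_simps power2_eq_square)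
    show "hmat (sl2_act A P) $ 2 $ 1 = (A ** hmat P ** adj A) $ 2 $ 1"
      unfolding act using cN
      by (simp add: matrix_matrix_mult_def sum_2 adj_def abcd[symmetric] Pzy w_def of_real_cmod_square)
         (simp add: field_simps power2_eq_square)
    show "hmat (sl2_act A P) $ 2 $ 2 = (A ** hmat P ** adj A) $ 2 $ 2"
      unfolding act using cN
      by (simp add: matrix_matrix_mult_def sum_2 adj_def abcd[symmetric] Pzy Ne of_real_cmod_square)
         (simp add: field_simps power2_eq_square)
  qed
  then show ?thesis by (simp add: vec_eq_iff)
qed

lemma hmat_inj:
  assumes "P \<in> hyp3" "Q \<in> hyp3" "hmat P = hmat Q"
  shows "P = Q"
proof -
  have "hmat P $ 2 $ 2 = hmat Q $ 2 $ 2" "hmat P $ 1 $ 2 = hmat Q $ 1 $ 2" using assms(3) by simp_all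
  then have "snd P = snd Q" "fst P = fst Q" using assms(1,2) by (auto simp: hyp3_def)
  then show ?thesis by (simp add: prod_eq_iff)
qed

text \<open>Read off in the Hermitian model, where it is associativity of the matrix product;
  injectivity of \<open>hmat\<close> transports it back.\<close>

lemma sl2_act_mult:
  assumes "det A = 1" "det B = 1" "P \<in> hyp3"
  shows "sl2_act (A ** B) P = sl2_act A (sl2_act B P)"
proof (rule hmat_inj)
  show "sl2_act (A ** B) P \<in> hyp3" "sl2_act A (sl2_act B P) \<in> hyp3"
    using assms by (auto intro!: sl2_act_mem_hyp3 simp: det_mul)
  show "hmat (sl2_act (A ** B) P) = hmat (sl2_act A (sl2_act B P))"
    using assms by (simp add: hmat_act sl2_act_mem_hyp3 det_mul adj_mult matrix_mul_assoc)
qed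

text \<open>Expresses the distance through a determinant, which congruence by a matrix of
  determinant \<open>1\<close> leaves unchanged. Invariance of \<open>hcosh\<close> is then
  immediate.\<close>

lemma det_hmat_add:
  assumes "P \<in> hyp3" "Q \<in> hyp3"
  shows "det (hmat P + hmat Q) = of_real (2 * hcosh P Q + 2)"
proof -
  obtain z y where P: "P = (z, y)" by force
  obtain w v where Q: "Q = (w, v)" by force
  have yv: "y > 0" "v > 0" using assms by (simp_all add: P Q hyp3_def)
  have c: "complex_of_real y \<noteq> 0" "complex_of_real v \<noteq> 0" using yv by simp_all
  have "complex_of_real (hcosh P Q) = ((z - w) * cnj (z - w) + of_real y ^ 2 + of_real v ^ 2) / (2 * of_real y * of_real v)"
    by (simp add: hcosh_def P Q of_real_cmod_square)
  then show ?thesis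
    using c by (simp add: det_2 P Q of_real_cmod_square) (simp add: field_simps power2_eq_square)
qed

lemma hcosh_act:
  assumes "det A = 1" "P \<in> hyp3" "Q \<in> hyp3"
  shows "hcosh (sl2_act A P) (sl2_act A Q) = hcosh P Q"
proof -
  have "of_real (2 * hcosh (sl2_act A P) (sl2_act A Q) + 2) = det (hmat (sl2_act A P) + hmat (sl2_act A Q))"
    using assms by (simp add: det_hmat_add sl2_act_mem_hyp3)
  also have "hmat (sl2_act A P) + hmat (sl2_act A Q) = A ** (hmat P + hmat Q) ** adj A"
    using assms by (simp add: hmat_act matrix_add_ldistrib matrix_mul_add_right)
  also have "det \<dots> = of_real (2 * hcosh P Q + 2)"
    using assms by (simp add: det_mul det_adj det_hmat_add)
  finally have "2 * hcosh (sl2_act A P) (sl2_act A Q) + 2 = 2 * hcosh P Q + 2"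
    unfolding of_real_eq_iff .
  then show ?thesis by simp
qed

lemma hcosh_commute: "hcosh P Q = hcosh Q P"
  by (simp add: hcosh_def norm_minus_commute algebra_simps)

text \<open>A crude multiplicative substitute for the triangle inequality, sufficient for finiteness
  statements. It combines the parallelogram bound for the horizontal parts with the two estimates of
  \<open>y2\<close> by \<open>y1\<close> and by \<open>y3\<close>.\<close>

lemma hcosh_triangle:
  assumes "P \<in> hyp3" "Q \<in> hyp3" "R \<in> hyp3"
  shows "hcosh P R \<le> 8 * hcosh P Q * hcosh Q R"
proof -
  obtain z1 y1 where P: "P = (z1, y1)" by force
  obtain z2 y2 where Q: "Q = (z2, y2)" by force
  obtain z3 y3 where R: "R = (z3, y3)" by force
  have y: "y1 > 0" "y2 > 0" "y3 > 0" using assms by (simp_all add: P Q R hyp3_def)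
  define p q where pq: "p = hcosh P Q" "q = hcosh Q R"
  have p: "(cmod (z1 - z2))\<^sup>2 + y1\<^sup>2 + y2\<^sup>2 = 2 * p * y1 * y2" and q: "(cmod (z2 - z3))\<^sup>2 + y2\<^sup>2 + y3\<^sup>2 = 2 * q * y2 * y3"
    using y by (simp_all add: pq P Q R hcosh_def)
  have pq1: "p \<ge> 1" "q \<ge> 1" using hcosh_ge_1 assms by (simp_all add: pq)
  have tri: "(cmod (z1 - z3))\<^sup>2 \<le> 2 * (cmod (z1 - z2))\<^sup>2 + 2 * (cmod (z2 - z3))\<^sup>2"
  proof -
    have "cmod (z1 - z3) \<le> cmod (z1 - z2) + cmod (z2 - z3)"
      using norm_triangle_ineq[of "z1 - z2" "z2 - z3"] by simp
    then have "(cmod (z1 - z3))\<^sup>2 \<le> (cmod (z1 - z2) + cmod (z2 - z3))\<^sup>2"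
      by (intro power_mono) auto
    also have "\<dots> \<le> 2 * (cmod (z1 - z2))\<^sup>2 + 2 * (cmod (z2 - z3))\<^sup>2"
      using zero_le_power2[of "cmod (z1 - z2) - cmod (z2 - z3)"] by (simp add: power2_eq_square algebra_simps)
    finally show ?thesis .
  qed
  have y2a: "y2 \<le> 2 * p * y1"
  proof -
    have "y2\<^sup>2 \<le> 2 * p * y1 * y2" using p zero_le_power2[of "cmod (z1 - z2)"] zero_le_power2[of y1] by linarith
    then show ?thesis using y by (simp add: power2_eq_square)
  qed
  have y2b: "y2 \<le> 2 * q * y3"
  proof -
    have "y2\<^sup>2 \<le> 2 * q * y2 * y3" using q zero_le_power2[of "cmod (z2 - z3)"] zero_le_power2[of y3] by linarith
    then have "y2 * y2 \<le> (2 * q * y3) * y2" by (simp add: power2_eq_square mult_ac)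
    then show ?thesis using y by simp
  qed
  have "(cmod (z1 - z3))\<^sup>2 + y1\<^sup>2 + y3\<^sup>2 \<le> 4 * p * y1 * y2 + 4 * q * y2 * y3"
    using tri p q zero_le_power2[of y1] zero_le_power2[of y2] zero_le_power2[of y3] by linarith
  also have "\<dots> \<le> 4 * p * y1 * (2 * q * y3) + 4 * q * (2 * p * y1) * y3"
    using y2a y2b y pq1 by (intro add_mono mult_left_mono mult_right_mono) auto
  also have "\<dots> = 8 * p * q * (2 * y1 * y3)" by simp
  finally have "((cmod (z1 - z3))\<^sup>2 + y1\<^sup>2 + y3\<^sup>2) / (2 * y1 * y3) \<le> 8 * p * q"
    using y by (simp add: pos_divide_le_eq)
  moreover have "hcosh P R = ((cmod (z1 - z3))\<^sup>2 + y1\<^sup>2 + y3\<^sup>2) / (2 * y1 * y3)"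
    by (simp add: hcosh_def P R)
  ultimately show ?thesis by (simp add: pq)
qed

lemma base_point_hyp3: "(0, 1) \<in> hyp3" by (simp add: hyp3_def)

text \<open>Both sides are the trace of \<open>A ** adj A\<close>, because
  \<open>hmat (0, 1)\<close> is the identity. Matrix size is thereby controlled by the displacement
  of the base point.\<close>

lemma sum_norm_entries_act:
  assumes "det A = 1"
  shows "(\<Sum>i\<in>UNIV. \<Sum>j\<in>UNIV. (cmod (A $ i $ j))\<^sup>2) = 2 * hcosh (0, 1) (sl2_act A (0, 1))"
proof -
  let ?Q = "sl2_act A (0, 1)"
  have Q: "snd ?Q > 0" using sl2_act_mem_hyp3[OF assms base_point_hyp3] by (simp add: hyp3_def)
  have "hmat (0, 1) = mat 1"
    by (simp add: vec_eq_iff forall_2 mat_def)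
  then have h: "hmat ?Q = A ** adj A" using hmat_act[OF assms base_point_hyp3] by simp
  have "complex_of_real (2 * hcosh (0, 1) ?Q) = hmat ?Q $ 1 $ 1 + hmat ?Q $ 2 $ 2"
    using Q by (simp add: hcosh_def field_simps)
  also have "\<dots> = of_real (\<Sum>i\<in>UNIV. \<Sum>j\<in>UNIV. (cmod (A $ i $ j))\<^sup>2)"
    unfolding h by (simp add: matrix_matrix_mult_def sum_2 adj_def of_real_cmod_square)
  finally show ?thesis by (simp only: of_real_eq_iff)
qed

definition sl2_inv :: "complex^2^2 \<Rightarrow> complex^2^2" where
  "sl2_inv A = vector [vector [A $ 2 $ 2, - A $ 1 $ 2], vector [- A $ 2 $ 1, A $ 1 $ 1]]"

lemma sl2_inv:
  assumes "det A = 1"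
  shows "A ** sl2_inv A = mat 1" "sl2_inv A ** A = mat 1" "det (sl2_inv A) = 1"
  using assms by (simp_all add: sl2_inv_def vec_eq_iff forall_2 matrix_matrix_mult_def sum_2 mat_def det_2 algebra_simps)

lemma sl2_act_inv:
  assumes "det A = 1" "P \<in> hyp3"
  shows "sl2_act A (sl2_act (sl2_inv A) P) = P" "sl2_act (sl2_inv A) (sl2_act A P) = P"
  using assms sl2_inv[OF assms(1)] by (simp_all add: sl2_act_mult[symmetric] sl2_act_one)

lemma matrix_mul_diff_left: "A ** (B - C) = A ** B - A ** C" for A :: "complex^2^2"
  by (simp add: vec_eq_iff matrix_matrix_mult_def right_diff_distrib sum_subtractf)

lemma uminus_mat_1_mult: "- mat 1 ** A = - A" for A :: "complex^2^2"
  by (simp add: vec_eq_iff forall_2 matrix_matrix_mult_def sum_2 mat_def)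

lemma mult_uminus_mat_1: "A ** - mat 1 = - A" for A :: "complex^2^2"
  by (simp add: vec_eq_iff forall_2 matrix_matrix_mult_def sum_2 mat_def)

lemma coset_SL2C: "{mat 1, - mat 1} #>\<^bsub>SL2C\<^esub> A = {A, - A}"
  by (auto simp: r_coset_def SL2C_def uminus_mat_1_mult)

lemma normal_center_SL2C: "{mat 1, - mat 1} \<lhd> SL2C"
proof (rule group.normalI[OF group_SL2C])
  have d: "det (- mat 1 :: complex^2^2) = 1" by (simp add: det_2 mat_def)
  show "subgroup {mat 1, - mat 1} SL2C"
  proof (rule group.subgroupI[OF group_SL2C])
    fix A assume A: "A \<in> {mat 1, - mat 1 :: complex^2^2}"
    then have "A \<otimes>\<^bsub>SL2C\<^esub> A = \<one>\<^bsub>SL2C\<^esub>" "A \<in> carrier SL2C"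
      using d by (auto simp: SL2C_def uminus_mat_1_mult)
    then have "inv\<^bsub>SL2C\<^esub> A = A" by (metis group.inv_equality group_SL2C)
    then show "inv\<^bsub>SL2C\<^esub> A \<in> {mat 1, - mat 1}" using A by simp
  qed (use d in \<open>auto simp: SL2C_def uminus_mat_1_mult\<close>)
  show "\<forall>x\<in>carrier SL2C. {mat 1, - mat 1} #>\<^bsub>SL2C\<^esub> x = x <#\<^bsub>SL2C\<^esub> {mat 1, - mat 1}"
    by (auto simp: r_coset_def l_coset_def SL2C_def uminus_mat_1_mult mult_uminus_mat_1)
qed

lemma group_PSL2C: "group PSL2C"
  unfolding PSL2C_def by (rule normal.factorgroup_is_group[OF normal_center_SL2C])

lemma norm_mat_le: "norm X \<le> (\<Sum>i\<in>UNIV. \<Sum>j\<in>UNIV. cmod (X $ i $ j))" for X :: "complex^2^2"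
proof -
  have "norm X \<le> (\<Sum>i\<in>UNIV. norm (X $ i))" by (simp add: norm_vec_def L2_set_le_sum)
  also have "\<dots> \<le> (\<Sum>i\<in>UNIV. \<Sum>j\<in>UNIV. cmod (X $ i $ j))"
    by (intro sum_mono) (simp add: norm_vec_def L2_set_le_sum)
  finally show ?thesis .
qed

section \<open>Lifts of a discrete subgroup and proper discontinuity\<close>

locale discrete_PSL2C =
  fixes \<Gamma> :: "(complex^2^2) set set"
  assumes discrete: "discrete_subgroup \<Gamma>"
begin

lemma subgroup: "subgroup \<Gamma> PSL2C"
  using discrete by (simp add: discrete_subgroup_def)

lemma mem_lift:
  assumes "A \<in> \<Union>\<Gamma>" shows "det A = 1" "{A, - A} \<in> \<Gamma>"
proof -
  obtain X where X: "A \<in> X" "X \<in> \<Gamma>" using assms by auto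
  then have "X \<in> carrier PSL2C" using subgroup subgroup.subset by blast
  then obtain B where B: "X = {B, - B}" "det B = 1" by (auto simp: PSL2C_carrier)
  then have "det (- B) = 1" by (simp add: det_2)
  then show "det A = 1" using X B by auto
  show "{A, - A} \<in> \<Gamma>" using X B by (auto simp: insert_commute)
qed

lemma one_mem_lift: "mat 1 \<in> \<Union>\<Gamma>"
proof -
  have "\<one>\<^bsub>PSL2C\<^esub> = {mat 1, - mat 1}" by (simp add: PSL2C_def FactGroup_def)
  then have "{mat 1, - mat 1} \<in> \<Gamma>" using subgroup.one_closed[OF subgroup] by simp
  then show ?thesis by auto
qed

lemma mult_mem_lift:
  assumes "A \<in> \<Union>\<Gamma>" "B \<in> \<Union>\<Gamma>" shows "A ** B \<in> \<Union>\<Gamma>"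
proof -
  have "{A, - A} \<otimes>\<^bsub>PSL2C\<^esub> {B, - B} \<in> \<Gamma>"
    using subgroup.m_closed[OF subgroup] mem_lift assms by blast
  moreover have "A ** B \<in> {A, - A} \<otimes>\<^bsub>PSL2C\<^esub> {B, - B}"
    by (auto simp: PSL2C_def FactGroup_def set_mult_def SL2C_def)
  ultimately show ?thesis by blast
qed

text \<open>The inverse coset only supplies some \<open>B\<close> with \<open>B ** A\<close> equal
  to \<open>mat 1\<close> up to sign; the coset contains both signs of \<open>B\<close>, so this is
  enough.\<close>

lemma inv_mem_lift:
  assumes A: "A \<in> \<Union>\<Gamma>" shows "sl2_inv A \<in> \<Union>\<Gamma>"
proof -
  define X where "X = {A, - A}"
  have X: "X \<in> \<Gamma>" "X \<in> carrier PSL2C" using mem_lift[OF A] subgroup.subset[OF subgroup] by (auto simp: X_def)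
  have iX: "inv\<^bsub>PSL2C\<^esub> X \<in> \<Gamma>" using subgroup.m_inv_closed[OF subgroup X(1)] .
  then have "inv\<^bsub>PSL2C\<^esub> X \<in> carrier PSL2C" using subgroup.subset[OF subgroup] by blast
  then obtain B where B: "inv\<^bsub>PSL2C\<^esub> X = {B, - B}" by (auto simp: PSL2C_carrier)
  have "inv\<^bsub>PSL2C\<^esub> X \<otimes>\<^bsub>PSL2C\<^esub> X = {mat 1, - mat 1}"
    using group.l_inv[OF group_PSL2C X(2)] by (simp add: PSL2C_def FactGroup_def)
  moreover have "B ** A \<in> inv\<^bsub>PSL2C\<^esub> X \<otimes>\<^bsub>PSL2C\<^esub> X"
    unfolding B by (auto simp: PSL2C_def FactGroup_def set_mult_def SL2C_def X_def)
  ultimately have "B ** A = mat 1 \<or> B ** A = - mat 1" by auto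
  then have "(B ** A) ** sl2_inv A = sl2_inv A \<or> (B ** A) ** sl2_inv A = - sl2_inv A"
    by (auto simp: uminus_mat_1_mult)
  moreover have "(B ** A) ** sl2_inv A = B"
    using sl2_inv[OF mem_lift(1)[OF A]] by (simp add: matrix_mul_assoc[symmetric])
  ultimately have "sl2_inv A = B \<or> sl2_inv A = - B" by auto
  then show ?thesis using iX B by auto
qed

text \<open>Unwinds the quotient topology: an open set isolating the trivial coset in
  \<open>\<Gamma>\<close> pulls back to a relatively open set of matrices, and a ball around
  \<open>mat 1\<close> inside it meets the lift only in the two representatives of that
  coset.\<close>

lemma discrete_at_one:
  obtains e where "e > 0" "\<And>A. A \<in> \<Union>\<Gamma> \<Longrightarrow> dist A (mat 1) < e \<Longrightarrow> A = mat 1 \<or> A = - mat 1"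
proof -
  have "openin (subtopology PSL2C_topology \<Gamma>) {{mat 1, - mat 1}}"
    using discrete mem_lift(2)[OF one_mem_lift] by (simp add: discrete_subgroup_def)
  then obtain U where U: "openin PSL2C_topology U" "{{mat 1, - mat 1}} = U \<inter> \<Gamma>"
    by (auto simp: openin_subtopology)
  have "openin (top_of_set (carrier SL2C)) {A \<in> carrier SL2C. {A, - A} \<in> U}"
    using U(1) unfolding PSL2C_topology_def openin_quot_topology coset_SL2C by simp
  then obtain V where V: "open V" "{A \<in> carrier SL2C. {A, - A} \<in> U} = carrier SL2C \<inter> V"
    by (auto simp: openin_open)
  have "mat 1 \<in> {A \<in> carrier SL2C. {A, - A} \<in> U}"
    using U(2) by (auto simp: SL2C_def)
  then obtain e where e: "e > 0" "ball (mat 1) e \<subseteq> V"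
    using V open_contains_ball by blast
  show ?thesis
  proof (rule that[OF e(1)])
    fix A assume A: "A \<in> \<Union>\<Gamma>" "dist A (mat 1) < e"
    then have "A \<in> carrier SL2C \<inter> V" using e mem_lift(1)[OF A(1)] by (auto simp: SL2C_def dist_commute)
    then have "{A, - A} \<in> U \<inter> \<Gamma>" using V mem_lift(2)[OF A(1)] by blast
    then have "{A, - A} = {mat 1, - mat 1}" unfolding U(2)[symmetric] by (rule singletonD)
    then have "A \<in> {mat 1, - mat 1}" by (metis insertI1)
    then show "A = mat 1 \<or> A = - mat 1" by simp
  qed
qed

text \<open>An infinite bounded set would accumulate. For two of its members \<open>A\<close>,
  \<open>B\<close> that are close together, \<open>sl2_inv A ** B\<close> lies near
  \<open>mat 1\<close>, hence equals it up to sign; so a small ball around the limit point holds at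
  most two members.\<close>

lemma finite_bounded_lift: "finite {A \<in> \<Union>\<Gamma>. \<forall>i j. cmod (A $ i $ j) \<le> R}" (is "finite ?S")
proof (rule ccontr)
  assume inf: "infinite ?S"
  obtain e where e: "e > 0" "\<And>A. A \<in> \<Union>\<Gamma> \<Longrightarrow> dist A (mat 1) < e \<Longrightarrow> A = mat 1 \<or> A = - mat 1"
    using discrete_at_one by blast
  define r where "r = max R 0 + 1"
  have r: "r > 0" "R \<le> r" by (auto simp: r_def)
  \<comment> \<open>Each entry of \<open>sl2_inv A ** (B - A)\<close> is a sum of two products below
    \<open>r * \<delta>\<close>, thus below \<open>e / 4\<close>; four entries then give norm below
    \<open>e\<close>.\<close>
  define \<delta> where "\<delta> = e / (8 * r)"
  have \<delta>: "\<delta> > 0" using e r by (simp add: \<delta>_def)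
  have near: "B = A \<or> B = - A" if A: "A \<in> ?S" and B: "B \<in> ?S" and AB: "dist B A < \<delta>" for A B
  proof -
    have "cmod (A $ i $ k) \<le> r" for i k using A r(2) by (auto intro: order_trans[OF _ r(2)])
    then have iA: "cmod (sl2_inv A $ i $ k) \<le> r" for i k
      using exhaust_2[of i] exhaust_2[of k] by (auto simp: sl2_inv_def)
    have dA: "det A = 1" using A mem_lift by blast
    have "sl2_inv A ** B - mat 1 = sl2_inv A ** (B - A)"
      using sl2_inv[OF dA] by (simp add: matrix_mul_diff_left)
    moreover have "cmod ((sl2_inv A ** (B - A)) $ i $ j) < e / 4" for i j
    proof -
      have BA: "cmod ((B - A) $ k $ j) < \<delta>" for k
      proof -
        have "cmod ((B - A) $ k $ j) \<le> norm ((B - A) $ k)" by (rule Finite_Cartesian_Product.norm_nth_le)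
        also have "\<dots> \<le> norm (B - A)" by (rule Finite_Cartesian_Product.norm_nth_le)
        finally show ?thesis using AB by (simp add: dist_norm)
      qed
      have "cmod ((sl2_inv A ** (B - A)) $ i $ j) \<le> (\<Sum>k\<in>UNIV. cmod (sl2_inv A $ i $ k) * cmod ((B - A) $ k $ j))"
        unfolding matrix_matrix_mult_def by (simp add: norm_mult[symmetric] sum_norm_le del: vector_minus_component)
      also have "\<dots> < (\<Sum>k\<in>(UNIV :: 2 set). r * \<delta>)"
      proof (rule sum_strict_mono)
        fix k :: 2
        have "cmod (sl2_inv A $ i $ k) * cmod ((B - A) $ k $ j) \<le> r * cmod ((B - A) $ k $ j)"
          using iA by (intro mult_right_mono) auto
        also have "\<dots> < r * \<delta>" using BA r by simp
        finally show "cmod (sl2_inv A $ i $ k) * cmod ((B - A) $ k $ j) < r * \<delta>" .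
      qed auto
      also have "\<dots> = e / 4" using r by (simp add: \<delta>_def)
      finally show ?thesis .
    qed
    then have "(\<Sum>i\<in>UNIV. \<Sum>j\<in>UNIV. cmod ((sl2_inv A ** (B - A)) $ i $ j)) < (\<Sum>i\<in>(UNIV :: 2 set). \<Sum>j\<in>(UNIV :: 2 set). e / 4)"
      by (intro sum_strict_mono) auto
    then have "norm (sl2_inv A ** (B - A)) < e"
      using norm_mat_le[of "sl2_inv A ** (B - A)"] by simp
    ultimately have "dist (sl2_inv A ** B) (mat 1) < e" by (simp add: dist_norm)
    moreover have "sl2_inv A ** B \<in> \<Union>\<Gamma>"
      using A B inv_mem_lift mult_mem_lift by blast
    ultimately have "sl2_inv A ** B = mat 1 \<or> sl2_inv A ** B = - mat 1" using e by blast
    then have "A ** (sl2_inv A ** B) = A \<or> A ** (sl2_inv A ** B) = - A"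
      by (auto simp: mult_uminus_mat_1)
    then show ?thesis using sl2_inv[OF dA] by (simp add: matrix_mul_assoc)
  qed
  have "?S \<subseteq> cball 0 (4 * r)"
  proof
    fix A assume A: "A \<in> ?S"
    have "norm A \<le> (\<Sum>i\<in>UNIV. \<Sum>j\<in>UNIV. cmod (A $ i $ j))" by (rule norm_mat_le)
    also have "\<dots> \<le> (\<Sum>i\<in>(UNIV :: 2 set). \<Sum>j\<in>(UNIV :: 2 set). r)"
      using A r by (intro sum_mono) (auto intro: order_trans)
    finally show "A \<in> cball 0 (4 * r)" by simp
  qed
  then obtain x where "x islimpt ?S"
    using inf compact_eq_Bolzano_Weierstrass[of "cball (0 :: complex^2^2) (4 * r)"] by auto
  then have infb: "infinite (?S \<inter> ball x (\<delta> / 2))"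
    using \<delta> by (auto simp: islimpt_eq_infinite_ball)
  then have "?S \<inter> ball x (\<delta> / 2) \<noteq> {}" by (metis finite.emptyI)
  then obtain A where A: "A \<in> ?S \<inter> ball x (\<delta> / 2)" by blast
  have "?S \<inter> ball x (\<delta> / 2) \<subseteq> {A, - A}"
  proof
    fix B assume B: "B \<in> ?S \<inter> ball x (\<delta> / 2)"
    have "dist B A \<le> dist x B + dist x A" by (metis dist_commute dist_triangle)
    also have "\<dots> < \<delta>" using A B by auto
    finally show "B \<in> {A, - A}" using near A B by auto
  qed
  then show False using infb finite_subset by blast
qed

lemma countable_lift: "countable (\<Union>\<Gamma>)"
proof -
  have "\<Union>\<Gamma> \<subseteq> (\<Union>n. {A \<in> \<Union>\<Gamma>. \<forall>i j. cmod (A $ i $ j) \<le> real n})"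
  proof
    fix A assume A: "A \<in> \<Union>\<Gamma>"
    obtain n where n: "real n \<ge> norm A" using real_arch_simple by blast
    have "cmod (A $ i $ j) \<le> real n" for i j
      using Finite_Cartesian_Product.norm_nth_le[of "A $ i" j] Finite_Cartesian_Product.norm_nth_le[of A i] n by linarith
    then show "A \<in> (\<Union>n. {A \<in> \<Union>\<Gamma>. \<forall>i j. cmod (A $ i $ j) \<le> real n})" using A by blast
  qed
  then show ?thesis
    by (rule countable_subset) (rule countable_UN, simp, rule countable_finite, rule finite_bounded_lift)
qed

lemma finite_lift_moving_little: "finite {A \<in> \<Union>\<Gamma>. hcosh (0, 1) (sl2_act A (0, 1)) \<le> R}"
proof -
  have "cmod (A $ i $ j) \<le> sqrt (2 * R)"
    if A: "A \<in> \<Union>\<Gamma>" and R: "hcosh (0, 1) (sl2_act A (0, 1)) \<le> R" for A i j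
  proof -
    have d: "det A = 1" using A by (rule mem_lift)
    have "(cmod (A $ i $ j))\<^sup>2 \<le> (\<Sum>j\<in>UNIV. (cmod (A $ i $ j))\<^sup>2)"
      by (rule member_le_sum) auto
    also have "\<dots> \<le> (\<Sum>i\<in>UNIV. \<Sum>j\<in>UNIV. (cmod (A $ i $ j))\<^sup>2)"
      by (rule member_le_sum[of i UNIV "\<lambda>i. \<Sum>j\<in>UNIV. (cmod (A $ i $ j))\<^sup>2"]) (auto intro: sum_nonneg)
    also have "\<dots> \<le> 2 * R" using sum_norm_entries_act[OF d] R by simp
    finally show "cmod (A $ i $ j) \<le> sqrt (2 * R)" by (rule real_le_rsqrt)
  qed
  then show ?thesis
    by (intro finite_subset[OF _ finite_bounded_lift[of "sqrt (2 * R)"]]) auto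
qed

lemma finite_lift_close:
  assumes "P \<in> hyp3"
  shows "finite {A \<in> \<Union>\<Gamma>. hcosh (0, 1) (sl2_act A P) \<le> R}"
proof (rule finite_subset[OF _ finite_lift_moving_little[of "8 * \<bar>R\<bar> * hcosh P (0, 1)"]], rule subsetI)
  fix A assume "A \<in> {A \<in> \<Union>\<Gamma>. hcosh (0, 1) (sl2_act A P) \<le> R}"
  then have A: "A \<in> \<Union>\<Gamma>" and R: "hcosh (0, 1) (sl2_act A P) \<le> R" by simp_all
  have d: "det A = 1" using A by (rule mem_lift)
  have "hcosh (0, 1) (sl2_act A (0, 1)) \<le> 8 * hcosh (0, 1) (sl2_act A P) * hcosh (sl2_act A P) (sl2_act A (0, 1))"
    using assms d base_point_hyp3 by (intro hcosh_triangle sl2_act_mem_hyp3)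
  also have "hcosh (sl2_act A P) (sl2_act A (0, 1)) = hcosh P (0, 1)"
    using assms d base_point_hyp3 by (intro hcosh_act)
  also have "8 * hcosh (0, 1) (sl2_act A P) * hcosh P (0, 1) \<le> 8 * \<bar>R\<bar> * hcosh P (0, 1)"
    using R hcosh_ge_1[OF assms base_point_hyp3] by (intro mult_right_mono) auto
  finally show "A \<in> {A \<in> \<Union>\<Gamma>. hcosh (0, 1) (sl2_act A (0, 1)) \<le> 8 * \<bar>R\<bar> * hcosh P (0, 1)}"
    using A by blast
qed

text \<open>Proper discontinuity in the form used for unfolding: the cardinality of this set bounds
  how often an integral over the ball can cover a fundamental domain.\<close>

lemma finite_lift_ball:
  assumes P: "P \<in> hyp3"
  shows "finite {A \<in> \<Union>\<Gamma>. \<exists>Q\<in>hyp3. hcosh P Q \<le> r \<and> hcosh P (sl2_act A Q) \<le> r}"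
proof (rule finite_subset[OF _ finite_lift_close[OF P, of "8 * (8 * hcosh (0, 1) P * \<bar>r\<bar>) * \<bar>r\<bar>"]], rule subsetI)
  fix A assume "A \<in> {A \<in> \<Union>\<Gamma>. \<exists>Q\<in>hyp3. hcosh P Q \<le> r \<and> hcosh P (sl2_act A Q) \<le> r}"
  then obtain Q where A: "A \<in> \<Union>\<Gamma>" and Q: "Q \<in> hyp3" "hcosh P Q \<le> r" "hcosh P (sl2_act A Q) \<le> r" by blast
  have d: "det A = 1" using A by (rule mem_lift)
  have AQ: "sl2_act A Q \<in> hyp3" "sl2_act A P \<in> hyp3" using d Q P by (auto intro: sl2_act_mem_hyp3)
  have "hcosh (0, 1) (sl2_act A P) \<le> 8 * hcosh (0, 1) (sl2_act A Q) * hcosh (sl2_act A Q) (sl2_act A P)"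
    using AQ base_point_hyp3 by (intro hcosh_triangle)
  also have "hcosh (sl2_act A Q) (sl2_act A P) = hcosh P Q"
    using P Q d by (simp add: hcosh_act hcosh_commute)
  also have "8 * hcosh (0, 1) (sl2_act A Q) * hcosh P Q \<le> 8 * (8 * hcosh (0, 1) P * \<bar>r\<bar>) * \<bar>r\<bar>"
  proof -
    have "hcosh (0, 1) (sl2_act A Q) \<le> 8 * hcosh (0, 1) P * hcosh P (sl2_act A Q)"
      using AQ P base_point_hyp3 by (intro hcosh_triangle)
    also have "\<dots> \<le> 8 * hcosh (0, 1) P * \<bar>r\<bar>"
      using Q hcosh_ge_1[OF base_point_hyp3 P] by (intro mult_left_mono) auto
    finally show ?thesis
      using Q hcosh_ge_1[OF P Q(1)] hcosh_ge_1[OF base_point_hyp3 P] hcosh_ge_1[OF base_point_hyp3 AQ(1)]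
      by (intro mult_mono) auto
  qed
  finally show "A \<in> {A \<in> \<Union>\<Gamma>. hcosh (0, 1) (sl2_act A P) \<le> 8 * (8 * hcosh (0, 1) P * \<bar>r\<bar>) * \<bar>r\<bar>}"
    using A by blast
qed

end

section \<open>Invariance of the hyperbolic volume\<close>

lemma sinh_gt_self: "x < sinh x" if "x > 0" for x :: real
proof -
  have "(\<lambda>x. sinh x - x) 0 < (\<lambda>x. sinh x - x) x"
  proof (rule DERIV_pos_imp_increasing_open[OF that])
    fix y :: real assume y: "0 < y" "y < x"
    have "cosh y > 1" using y cosh_real_nonneg_less_iff[of 0 y] by simp
    then show "\<exists>z. ((\<lambda>x. sinh x - x) has_real_derivative z) (at y) \<and> 0 < z"
      by (intro exI[of _ "cosh y - 1"]) (auto intro!: derivative_eq_intros)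
  qed (auto intro!: continuous_intros)
  then show ?thesis by simp
qed

definition hyp_ball :: "complex \<times> real \<Rightarrow> real \<Rightarrow> (complex \<times> real) set" where
  "hyp_ball P c = {Q \<in> hyp3. hcosh P Q < c}"

definition hyp_ball_vol :: "real \<Rightarrow> ennreal" where
  "hyp_ball_vol c = ennreal (pi * (sinh (2 * arcosh c) - 2 * arcosh c))"

lemma hyp_ball_borel [measurable]: "hyp_ball P c \<in> sets borel"
  unfolding hyp_ball_def by measurable

lemma emeasure_hyp_ball:
  assumes "P \<in> hyp3" "c > 1"
  shows "emeasure hyp_vol (hyp_ball P c) = hyp_ball_vol c"
proof -
  have "arcosh c > 0" using assms by (metis arcosh_eq_0_iff_real arcosh_nonneg_real less_eq_real_def less_irrefl)
  then show ?thesis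
    using hyp_ball_volume[OF assms(1), of "arcosh c"] assms by (simp add: hyp_ball_def hyp_ball_vol_def)
qed

lemma hyp_ball_vol_pos:
  assumes "c > 1" shows "hyp_ball_vol c \<noteq> 0" "hyp_ball_vol c \<noteq> \<infinity>"
proof -
  have "arcosh c > 0" using assms by (metis arcosh_eq_0_iff_real arcosh_nonneg_real less_eq_real_def less_irrefl)
  then show "hyp_ball_vol c \<noteq> 0" using sinh_gt_self[of "2 * arcosh c"]
    by (simp add: hyp_ball_vol_def ennreal_eq_0_iff not_le)
qed (simp add: hyp_ball_vol_def)

text \<open>The shift by \<open>2\<close> keeps the parameter above \<open>1\<close>, the range in
  which the volume of a ball is prescribed.\<close>

lemma hyp_ball_cover: "(\<Union>n. hyp_ball (0, 1) (real n + 2) \<union> - hyp3) = UNIV"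
proof (safe intro!: UNIV_I)
  fix z :: complex and y :: real
  obtain n where "hcosh (0, 1) (z, y) < real n" using reals_Archimedean2 by blast
  then show "(z, y) \<in> (\<Union>n. hyp_ball (0, 1) (real n + 2) \<union> - hyp3)"
    by (auto simp: hyp_ball_def intro!: exI[of _ n])
qed

text \<open>Christensen's argument that a measure is determined by its values on balls, if these do not
  depend on the centre. By Fatou's lemma \<open>M U\<close> is at most the lower limit of the averages over
  \<open>U\<close> of \<open>N (U \<inter> B(x, c\<^sub>n)) / V(c\<^sub>n)\<close>; by Fubini's theorem these averages are at most \<open>N U\<close>.\<close>

locale hyp_ball_measure = sigma_finite_measure M for M :: "(complex \<times> real) measure" +
  assumes sets_M [simp, measurable_cong]: "sets M = sets borel"
    and null: "emeasure M (- hyp3) = 0"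
    and ball_vol: "\<And>P c. P \<in> hyp3 \<Longrightarrow> c > 1 \<Longrightarrow> emeasure M (hyp_ball P c) = hyp_ball_vol c"

lemma hyp_ball_measureI:
  fixes M :: "(complex \<times> real) measure"
  assumes sets: "sets M = sets borel"
    and null: "emeasure M (- hyp3) = 0"
    and vol: "\<And>P c. P \<in> hyp3 \<Longrightarrow> c > 1 \<Longrightarrow> emeasure M (hyp_ball P c) = hyp_ball_vol c"
  shows "hyp_ball_measure M"
proof
  have spM: "space M = UNIV" using sets_eq_imp_space_eq[OF sets] by simp
  let ?A = "range (\<lambda>n. hyp_ball (0, 1) (real n + 2) \<union> - hyp3)"
  have fin: "emeasure M (hyp_ball (0, 1) (real n + 2) \<union> - hyp3) \<noteq> \<infinity>" for n
  proof -
    have "emeasure M (hyp_ball (0, 1) (real n + 2) \<union> - hyp3) \<le> emeasure M (hyp_ball (0, 1) (real n + 2)) + emeasure M (- hyp3)"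
      using sets by (intro emeasure_subadditive) auto
    also have "\<dots> = hyp_ball_vol (real n + 2)" using null vol[OF base_point_hyp3, of "real n + 2"] by simp
    finally show ?thesis using hyp_ball_vol_pos(2)[of "real n + 2"] by (auto simp: top_unique)
  qed
  show "\<exists>A. countable A \<and> A \<subseteq> sets M \<and> \<Union> A = space M \<and> (\<forall>a\<in>A. emeasure M a \<noteq> \<infinity>)"
    using hyp_ball_cover fin sets spM by (intro exI[of _ ?A]) auto
qed (use assms in auto)

lemma hcosh_pair_borel [measurable]:
  assumes [measurable]: "f \<in> borel_measurable M" "g \<in> borel_measurable M"
  shows "(\<lambda>x. hcosh (f x) (g x)) \<in> borel_measurable M"
  unfolding hcosh_def by measurable

lemma hyp_ball_measure_le:
  assumes M: "hyp_ball_measure M" and N: "hyp_ball_measure N" and U: "open U" "U \<subseteq> hyp3"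
  shows "emeasure M U \<le> emeasure N U"
proof -
  interpret M: hyp_ball_measure M by fact
  interpret N: hyp_ball_measure N by fact
  interpret MN: pair_sigma_finite M N ..
  have [measurable]: "U \<in> sets borel" using U by simp
  have [measurable]: "U \<in> sets M" "U \<in> sets N" using U by simp_all
  have sp: "space M = UNIV" "space N = UNIV" using sets_eq_imp_space_eq[OF M.sets_M] sets_eq_imp_space_eq[OF N.sets_M] by simp_all
  \<comment> \<open>These bounds on \<open>hcosh\<close> decrease to \<open>1\<close>, so the balls
    shrink to their centres.\<close>
  define C :: "nat \<Rightarrow> real" where "C n = 1 + inverse (real (Suc n))" for n
  have C: "C n > 1" for n by (simp add: C_def)
  define k :: "nat \<Rightarrow> complex \<times> real \<Rightarrow> complex \<times> real \<Rightarrow> ennreal" where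
    "k n x y = indicator U x * indicator U y * indicator {..<C n} (hcosh x y)" for n x y
  have [measurable]: "(\<lambda>p. k n (fst p) (snd p)) \<in> borel_measurable (M \<Otimes>\<^sub>M N)" for n
    unfolding k_def by measurable
  have [measurable]: "(\<lambda>y. k n x y) \<in> borel_measurable N" "(\<lambda>x. k n x y) \<in> borel_measurable M" for n x y
    unfolding k_def by measurable
  let ?V = "\<lambda>n. hyp_ball_vol (C n)"
  have V: "?V n / ?V n = 1" for n using hyp_ball_vol_pos[OF C[of n]] by (simp add: ennreal_divide_self less_top)
  have "emeasure M U = (\<integral>\<^sup>+x. indicator U x \<partial>M)" by simp
  also have "\<dots> \<le> (\<integral>\<^sup>+x. liminf (\<lambda>n. (\<integral>\<^sup>+y. k n x y \<partial>N) / ?V n) \<partial>M)"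
  proof (rule nn_integral_mono)
    fix x
    show "indicator U x \<le> liminf (\<lambda>n. (\<integral>\<^sup>+y. k n x y \<partial>N) / ?V n)"
    proof (cases "x \<in> U")
      case True
      then have x: "x \<in> hyp3" using U by auto
      obtain c where c: "c > 1" "\<And>Q. Q \<in> hyp3 \<Longrightarrow> hcosh x Q \<le> c \<Longrightarrow> Q \<in> U"
        using hcosh_ball_subset[OF x U(1) True] by blast
      have "\<forall>\<^sub>F n in sequentially. inverse (real (Suc n)) < c - 1"
        using order_tendstoD(2)[OF LIMSEQ_inverse_real_of_nat, of "c - 1"] c(1) by simp
      \<comment> \<open>Once the ball around \<open>x\<close> fits inside \<open>U\<close>, the
        quotient is exactly \<open>1\<close>: the prescribed ball volume divided by itself.\<close>
      then have "\<forall>\<^sub>F n in sequentially. 1 \<le> (\<integral>\<^sup>+y. k n x y \<partial>N) / ?V n"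
      proof eventually_elim
        case (elim n)
        have "k n x y = indicator (hyp_ball x (C n)) y" for y
        proof -
          have "y \<in> U \<and> hcosh x y < C n \<longleftrightarrow> y \<in> hyp_ball x (C n)"
            using c(2)[of y] elim U by (auto simp: hyp_ball_def C_def)
          then show ?thesis using True by (auto simp: k_def indicator_def)
        qed
        then have "(\<integral>\<^sup>+y. k n x y \<partial>N) = emeasure N (hyp_ball x (C n))" by simp
        then show ?case using N.ball_vol[OF x C] V by simp
      qed
      then show ?thesis using True by (simp add: Liminf_bounded)
    qed simp
  qed
  also have "\<dots> \<le> liminf (\<lambda>n. \<integral>\<^sup>+x. (\<integral>\<^sup>+y. k n x y \<partial>N) / ?V n \<partial>M)"
    by (rule nn_integral_liminf) measurable
  also have "\<dots> \<le> liminf (\<lambda>n. emeasure N U)"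
  proof (rule Liminf_mono, rule always_eventually, rule allI)
    fix n
    have "(\<integral>\<^sup>+x. (\<integral>\<^sup>+y. k n x y \<partial>N) / ?V n \<partial>M) = (\<integral>\<^sup>+x. \<integral>\<^sup>+y. k n x y \<partial>N \<partial>M) / ?V n"
      by (rule nn_integral_divide) measurable
    also have "(\<integral>\<^sup>+x. \<integral>\<^sup>+y. k n x y \<partial>N \<partial>M) = (\<integral>\<^sup>+y. \<integral>\<^sup>+x. k n x y \<partial>M \<partial>N)"
      using MN.Fubini[of "\<lambda>p. k n (fst p) (snd p)"] by simp
    also have "\<dots> \<le> (\<integral>\<^sup>+y. indicator U y * ?V n \<partial>N)"
    proof (rule nn_integral_mono)
      fix y
      show "(\<integral>\<^sup>+x. k n x y \<partial>M) \<le> indicator U y * ?V n"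
      proof (cases "y \<in> U")
        case True
        then have y: "y \<in> hyp3" using U by auto
        have "(\<integral>\<^sup>+x. k n x y \<partial>M) \<le> (\<integral>\<^sup>+x. indicator (hyp_ball y (C n)) x \<partial>M)"
          using U True by (intro nn_integral_mono) (auto simp: k_def indicator_def hyp_ball_def hcosh_commute)
        then show ?thesis using M.ball_vol[OF y C] True by simp
      qed (simp add: k_def)
    qed
    also have "\<dots> = emeasure N U * ?V n" by (subst nn_integral_multc) auto
    finally have "(\<integral>\<^sup>+x. (\<integral>\<^sup>+y. k n x y \<partial>N) / ?V n \<partial>M) \<le> emeasure N U * ?V n / ?V n"
      by (simp add: divide_right_mono_ennreal)
    also have "\<dots> = emeasure N U" using V[of n] by (simp add: ennreal_times_divide[symmetric])
    finally show "(\<integral>\<^sup>+x. (\<integral>\<^sup>+y. k n x y \<partial>N) / ?V n \<partial>M) \<le> emeasure N U" .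
  qed
  also have "\<dots> = emeasure N U" by (simp add: Liminf_const)
  finally show ?thesis .
qed

text \<open>The measures live on the whole ambient space while balls see only the half-space. The
  generating sets therefore join an open part of \<open>hyp3\<close> to an arbitrary Borel part of
  the complement, which is null for both measures.\<close>

lemma hyp_ball_measure_unique:
  assumes M: "hyp_ball_measure M" and N: "hyp_ball_measure N"
  shows "M = N"
proof -
  interpret M: hyp_ball_measure M by fact
  interpret N: hyp_ball_measure N by fact
  let ?E = "{U \<union> X | U X. open U \<and> U \<subseteq> hyp3 \<and> X \<in> sets borel \<and> X \<subseteq> - hyp3}"
  have em: "emeasure L (U \<union> X) = emeasure L U"
    if L: "hyp_ball_measure L" and U: "open U" "X \<in> sets borel" "X \<subseteq> - hyp3" for L U X
  proof -
    interpret L: hyp_ball_measure L by fact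
    have "emeasure L X \<le> emeasure L (- hyp3)" using U by (intro emeasure_mono) auto
    then have "X \<in> null_sets L" using L.null U by (auto simp: null_sets_def)
    then show ?thesis using U by (simp add: emeasure_Un_null_set)
  qed
  have sig: "sigma_sets UNIV ?E = sets (borel :: (complex \<times> real) measure)"
  proof
    have "?E \<subseteq> sets borel" by (auto intro!: sets.Un)
    then show "sigma_sets UNIV ?E \<subseteq> sets borel"
      using sets.sigma_sets_subset[of ?E borel] by simp
    have "W \<in> ?E" if "open W" for W
      using that open_hyp3 by (intro CollectI exI[of _ "W \<inter> hyp3"] exI[of _ "W - hyp3"]) (auto intro: open_Int)
    then show "sets (borel :: (complex \<times> real) measure) \<subseteq> sigma_sets UNIV ?E"
      unfolding borel_def by (auto intro!: sigma_sets_mono)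
  qed
  have ball_open: "open (hyp_ball P c)" if "P \<in> hyp3" for P c
  proof -
    have "open (hyp3 \<inter> hcosh P -` {..<c})"
      using continuous_on_open_vimage[OF open_hyp3, of "hcosh P"] continuous_on_hcosh[OF that] by (auto simp: Int_commute)
    moreover have "hyp_ball P c = hyp3 \<inter> hcosh P -` {..<c}" by (auto simp: hyp_ball_def)
    ultimately show ?thesis by simp
  qed
  let ?A = "range (\<lambda>n. hyp_ball (0, 1) (real n + 2) \<union> - hyp3)"
  show ?thesis
  proof (rule measure_eqI_generator_eq_countable[where E = ?E and \<Omega> = UNIV and A = ?A])
    show "Int_stable ?E"
    proof (rule Int_stableI)
      fix a b assume "a \<in> ?E" "b \<in> ?E"
      then obtain U X V Y where *: "a = U \<union> X" "open U" "U \<subseteq> hyp3" "X \<in> sets borel" "X \<subseteq> - hyp3"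
        "b = V \<union> Y" "open V" "V \<subseteq> hyp3" "Y \<in> sets borel" "Y \<subseteq> - hyp3" by blast
      then have "a \<inter> b = (U \<inter> V) \<union> (X \<inter> Y)" by blast
      moreover have "open (U \<inter> V)" "U \<inter> V \<subseteq> hyp3" "X \<inter> Y \<in> sets borel" "X \<inter> Y \<subseteq> - hyp3"
        using * by (simp_all add: open_Int le_infI1)
      ultimately show "a \<inter> b \<in> ?E" by blast
    qed
    show "emeasure M X = emeasure N X" if XE: "X \<in> ?E" for X
    proof -
      obtain U Y where X: "X = U \<union> Y" "open U" "U \<subseteq> hyp3" "Y \<in> sets borel" "Y \<subseteq> - hyp3" using XE by blast
      have "emeasure M U = emeasure N U"
        using hyp_ball_measure_le[OF M N X(2,3)] hyp_ball_measure_le[OF N M X(2,3)] by (rule antisym)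
      then show ?thesis using em[OF M X(2,4,5)] em[OF N X(2,4,5)] X(1) by simp
    qed
    show "sets M = sigma_sets UNIV ?E" "sets N = sigma_sets UNIV ?E" using sig by simp_all
    show "?A \<subseteq> ?E"
    proof
      fix a assume "a \<in> ?A"
      then obtain n where "a = hyp_ball (0, 1) (real n + 2) \<union> - hyp3" by blast
      moreover have "hyp_ball (0, 1) (real n + 2) \<subseteq> hyp3" "- hyp3 \<in> sets borel" by (auto simp: hyp_ball_def)
      ultimately show "a \<in> ?E" using ball_open[OF base_point_hyp3, of "real n + 2"] by blast
    qed
    show "\<Union> ?A = UNIV" by (rule hyp_ball_cover)
    show "emeasure M a \<noteq> \<infinity>" if aA: "a \<in> ?A" for a
    proof -
      obtain n where a: "a = hyp_ball (0, 1) (real n + 2) \<union> - hyp3" using aA by blast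
      have "emeasure M a = hyp_ball_vol (real n + 2)"
        unfolding a using em[OF M ball_open[OF base_point_hyp3]] M.ball_vol[OF base_point_hyp3, of "real n + 2"] by simp
      then show ?thesis using hyp_ball_vol_pos(2)[of "real n + 2"] by simp
    qed
  qed auto
qed

lemma cnj_borel [measurable]: "cnj \<in> borel_measurable borel"
  by (intro borel_measurable_continuous_onI continuous_intros)

lemma sl2_act_borel [measurable]: "sl2_act A \<in> borel_measurable borel"
  unfolding sl2_act_def Let_def by measurable

text \<open>No Jacobian is computed: the map preserves \<open>hcosh\<close>, so preimages of balls
  are balls of the same size up to null sets, and the uniqueness of a measure with these ball
  volumes applies.\<close>

theorem hyp_vol_invariant:
  assumes A: "det A = 1"
  shows "distr hyp_vol borel (sl2_act A) = hyp_vol"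
proof (rule hyp_ball_measure_unique)
  have null: "emeasure hyp_vol (- hyp3) = 0"
    using AE_hyp_vol_hyp3 by (subst (asm) AE_iff_measurable[where N = "- hyp3"]) auto
  show "hyp_ball_measure hyp_vol"
    by (rule hyp_ball_measureI) (auto simp: null emeasure_hyp_ball)
  show "hyp_ball_measure (distr hyp_vol borel (sl2_act A))"
  proof (rule hyp_ball_measureI)
    have "sl2_act A -` (- hyp3) \<inter> space hyp_vol \<subseteq> - hyp3"
      using sl2_act_mem_hyp3[OF A] by blast
    then have "emeasure hyp_vol (sl2_act A -` (- hyp3) \<inter> space hyp_vol) \<le> emeasure hyp_vol (- hyp3)"
      by (intro emeasure_mono) auto
    then show "emeasure (distr hyp_vol borel (sl2_act A)) (- hyp3) = 0"
      using null by (subst emeasure_distr) auto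
    fix P and c :: real assume P: "P \<in> hyp3" and c: "c > 1"
    define P' where "P' = sl2_act (sl2_inv A) P"
    have P': "P' \<in> hyp3" "sl2_act A P' = P"
      using sl2_act_mem_hyp3[OF sl2_inv(3)[OF A] P] sl2_act_inv(1)[OF A P] by (simp_all add: P'_def)
    have "emeasure (distr hyp_vol borel (sl2_act A)) (hyp_ball P c) = emeasure hyp_vol (sl2_act A -` hyp_ball P c)"
      by (subst emeasure_distr) auto
    also have "\<dots> = emeasure hyp_vol (hyp_ball P' c)"
    proof (rule emeasure_eq_AE)
      show "AE Q in hyp_vol. (Q \<in> sl2_act A -` hyp_ball P c) = (Q \<in> hyp_ball P' c)"
        using AE_hyp_vol_hyp3
      proof eventually_elim
        case (elim Q)
        have "hcosh P (sl2_act A Q) = hcosh P' Q"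
          using hcosh_act[OF A P'(1) elim] P'(2) by simp
        then show ?case using elim sl2_act_mem_hyp3[OF A elim] by (simp add: hyp_ball_def)
      qed
      show "sl2_act A -` hyp_ball P c \<in> sets hyp_vol"
        using measurable_sets[OF sl2_act_borel hyp_ball_borel, of A P c] by simp
    qed simp
    also have "\<dots> = hyp_ball_vol c" by (rule emeasure_hyp_ball[OF P'(1) c])
    finally show "emeasure (distr hyp_vol borel (sl2_act A)) (hyp_ball P c) = hyp_ball_vol c" .
  qed simp
qed

section \<open>Fundamental domains and unfolding\<close>

text \<open>Compares the distance to the base point first and breaks ties by coordinates, so that a
  finite set of points has exactly one least element; the relation is Borel, which keeps the
  resulting choice measurable.\<close>

definition lex_less :: "complex \<times> real \<Rightarrow> complex \<times> real \<Rightarrow> bool" where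
  "lex_less P Q \<longleftrightarrow> hcosh (0, 1) P < hcosh (0, 1) Q \<or> hcosh (0, 1) P = hcosh (0, 1) Q \<and>
     (Re (fst P) < Re (fst Q) \<or> Re (fst P) = Re (fst Q) \<and>
       (Im (fst P) < Im (fst Q) \<or> Im (fst P) = Im (fst Q) \<and> snd P < snd Q))"

lemma lex_less_total: "lex_less P Q \<or> lex_less Q P \<or> P = Q"
  by (auto simp: lex_less_def prod_eq_iff complex_eq_iff)

lemma lex_less_irrefl: "\<not> lex_less P P"
  by (simp add: lex_less_def)

lemma lex_less_trans: "lex_less P Q \<Longrightarrow> lex_less Q R \<Longrightarrow> lex_less P R"
  by (auto simp: lex_less_def)

lemma lex_less_min:
  assumes "finite S" "S \<noteq> {}"
  shows "\<exists>m\<in>S. \<forall>x\<in>S. \<not> lex_less x m"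
  using assms
proof (induction S rule: finite_ne_induct)
  case (singleton x)
  then show ?case by (simp add: lex_less_irrefl)
next
  case (insert x S)
  then obtain m where m: "m \<in> S" "\<And>y. y \<in> S \<Longrightarrow> \<not> lex_less y m" by blast
  show ?case
  proof (cases "lex_less x m")
    case True
    then have "\<not> lex_less y x" if "y \<in> S" for y using m(2)[OF that] lex_less_trans by blast
    then show ?thesis by (intro bexI[of _ x]) (auto simp: lex_less_irrefl)
  next
    case False
    then show ?thesis using m by (intro bexI[of _ m]) auto
  qed
qed

context discrete_PSL2C
begin

lemma hyp_orbit_subset: "P \<in> hyp3 \<Longrightarrow> hyp_orbit \<Gamma> P \<subseteq> hyp3"
  using mem_lift(1) sl2_act_mem_hyp3 unfolding hyp_orbit_def by blast

lemma hyp_orbit_act: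
  assumes A: "A \<in> \<Union>\<Gamma>" and P: "P \<in> hyp3"
  shows "hyp_orbit \<Gamma> (sl2_act A P) = hyp_orbit \<Gamma> P"
proof
  have "sl2_act B (sl2_act A P) \<in> hyp_orbit \<Gamma> P" if B: "B \<in> \<Union>\<Gamma>" for B
    using sl2_act_mult[OF mem_lift(1)[OF B] mem_lift(1)[OF A] P] mult_mem_lift[OF B A]
    unfolding hyp_orbit_def by (metis image_eqI)
  then show "hyp_orbit \<Gamma> (sl2_act A P) \<subseteq> hyp_orbit \<Gamma> P"
    unfolding hyp_orbit_def[of \<Gamma> "sl2_act A P"] by blast
  have "sl2_act B P \<in> hyp_orbit \<Gamma> (sl2_act A P)" if B: "B \<in> \<Union>\<Gamma>" for B
  proof -
    have "sl2_act (B ** sl2_inv A) (sl2_act A P) = sl2_act B (sl2_act (sl2_inv A) (sl2_act A P))"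
      using mem_lift(1)[OF A] mem_lift(1)[OF B] P
      by (intro sl2_act_mult) (auto simp: sl2_inv sl2_act_mem_hyp3)
    also have "\<dots> = sl2_act B P" using mem_lift(1)[OF A] P by (simp add: sl2_act_inv)
    finally show ?thesis
      using mult_mem_lift[OF B inv_mem_lift[OF A]] unfolding hyp_orbit_def by (metis image_eqI)
  qed
  then show "hyp_orbit \<Gamma> P \<subseteq> hyp_orbit \<Gamma> (sl2_act A P)"
    unfolding hyp_orbit_def[of \<Gamma> P] by blast
qed

text \<open>A Dirichlet domain centred at \<open>(0, 1)\<close> with ties broken by
  \<open>lex_less\<close>. Only finitely many lifts bring \<open>P\<close> at least as close to the
  base point as it is, so each orbit has a least element; measurability holds because the lift is
  countable.\<close>

lemma ex_fundamental_domain: "\<exists>F. fundamental_domain \<Gamma> F"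
proof -
  define F where "F = {P \<in> hyp3. \<forall>A\<in>\<Union>\<Gamma>. \<not> lex_less (sl2_act A P) P}"
  have "F = hyp3 \<inter> (\<Inter>A\<in>\<Union>\<Gamma>. {P \<in> space borel. \<not> lex_less (sl2_act A P) P})"
    by (auto simp: F_def)
  moreover have "{P \<in> space borel. \<not> lex_less (sl2_act A P) P} \<in> sets borel" for A
    unfolding lex_less_def by measurable
  then have "(\<Inter>A\<in>\<Union>\<Gamma>. {P \<in> space borel. \<not> lex_less (sl2_act A P) P}) \<in> sets borel"
    using one_mem_lift by (intro sets.countable_INT'[OF countable_lift]) blast+
  ultimately have F1: "F \<in> sets borel" by simp
  have F2: "F \<subseteq> hyp3" by (auto simp: F_def)
  have F3: "\<exists>!Q. Q \<in> F \<inter> hyp_orbit \<Gamma> P" if P: "P \<in> hyp3" for P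
  proof -
    define S where "S = (\<lambda>A. sl2_act A P) ` {A \<in> \<Union>\<Gamma>. hcosh (0, 1) (sl2_act A P) \<le> hcosh (0, 1) P}"
    have finS: "finite S" unfolding S_def by (intro finite_imageI finite_lift_close P)
    have neS: "S \<noteq> {}"
    proof -
      have "mat 1 \<in> {A \<in> \<Union>\<Gamma>. hcosh (0, 1) (sl2_act A P) \<le> hcosh (0, 1) P}"
        using one_mem_lift by (simp add: sl2_act_one)
      then show ?thesis unfolding S_def by blast
    qed
    obtain Q where Q: "Q \<in> S" "\<And>R. R \<in> S \<Longrightarrow> \<not> lex_less R Q"
      using lex_less_min[OF finS neS] by blast
    obtain A0 where A0: "A0 \<in> \<Union>\<Gamma>" "Q = sl2_act A0 P" "hcosh (0, 1) Q \<le> hcosh (0, 1) P"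
      using Q(1) by (auto simp: S_def)
    have Qo: "Q \<in> hyp_orbit \<Gamma> P" using A0 by (auto simp: hyp_orbit_def)
    have Qh: "Q \<in> hyp3" using Qo hyp_orbit_subset[OF P] by blast
    have "\<not> lex_less (sl2_act A Q) Q" if A: "A \<in> \<Union>\<Gamma>" for A
    proof
      assume l: "lex_less (sl2_act A Q) Q"
      then have "hcosh (0, 1) (sl2_act A Q) \<le> hcosh (0, 1) P" using A0(3) by (auto simp: lex_less_def)
      moreover have "sl2_act A Q = sl2_act (A ** A0) P"
        unfolding A0(2) using sl2_act_mult[OF mem_lift(1)[OF A] mem_lift(1)[OF A0(1)] P] by simp
      ultimately have "sl2_act A Q \<in> S"
        unfolding S_def using mult_mem_lift[OF A A0(1)] by (intro image_eqI[where x = "A ** A0"]) auto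
      then show False using Q(2) l by blast
    qed
    then have QF: "Q \<in> F" using Qh unfolding F_def by blast
    have "R = Q" if R: "R \<in> F \<inter> hyp_orbit \<Gamma> P" for R
    proof -
      have Rh: "R \<in> hyp3" using R by (auto simp: F_def)
      obtain A1 where A1: "A1 \<in> \<Union>\<Gamma>" "R = sl2_act A1 P" using R by (auto simp: hyp_orbit_def)
      have o: "hyp_orbit \<Gamma> R = hyp_orbit \<Gamma> P" "hyp_orbit \<Gamma> Q = hyp_orbit \<Gamma> P"
        using hyp_orbit_act[OF A1(1) P] hyp_orbit_act[OF A0(1) P] A1(2) A0(2) by simp_all
      have self: "X \<in> hyp_orbit \<Gamma> X" for X
        using one_mem_lift unfolding hyp_orbit_def by (metis image_eqI sl2_act_one)
      have "R \<in> hyp_orbit \<Gamma> Q" "Q \<in> hyp_orbit \<Gamma> R" using self[of R] self[of Q] o by auto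
      then have "\<not> lex_less R Q" "\<not> lex_less Q R" using R QF by (auto simp: F_def hyp_orbit_def)
      then show ?thesis using lex_less_total by blast
    qed
    then show ?thesis using Qo QF by blast
  qed
  show ?thesis unfolding fundamental_domain_def by (intro exI[of _ F] conjI ballI F1 F2 F3)
qed

text \<open>The same choice term as in \<open>orbit_vol\<close>, so that integrals over the orbit
  space become integrals over this set.\<close>

definition dom :: "(complex \<times> real) set" where
  "dom = (SOME F. fundamental_domain \<Gamma> F)"

lemma fundamental_domain_dom: "fundamental_domain \<Gamma> dom"
  unfolding dom_def using ex_fundamental_domain by (rule someI_ex)

lemma dom_borel [measurable]: "dom \<in> sets borel" and dom_hyp3: "dom \<subseteq> hyp3"
  using fundamental_domain_dom by (auto simp: fundamental_domain_def)

lemma dom_meets_orbit: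
  assumes "P \<in> hyp3" obtains A where "A \<in> \<Union>\<Gamma>" "sl2_act A P \<in> dom"
  using fundamental_domain_dom assms unfolding fundamental_domain_def hyp_orbit_def by blast

lemma hyp_orbit_measurable:
  "hyp_orbit \<Gamma> \<in> restrict_space hyp_vol dom \<rightarrow>\<^sub>M borel_of_topology (orbit_topology \<Gamma>)"
  unfolding borel_of_topology_def
proof (rule measurable_measure_of)
  show "{U. openin (orbit_topology \<Gamma>) U} \<subseteq> Pow (topspace (orbit_topology \<Gamma>))"
    using openin_subset by blast
  show "hyp_orbit \<Gamma> \<in> space (restrict_space hyp_vol dom) \<rightarrow> topspace (orbit_topology \<Gamma>)"
    using dom_hyp3 by (auto simp: space_restrict_space orbit_topology_def)
  fix U assume "U \<in> {U. openin (orbit_topology \<Gamma>) U}"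
  then have "openin (top_of_set hyp3) {P \<in> hyp3. hyp_orbit \<Gamma> P \<in> U}"
    by (simp add: orbit_topology_def openin_quot_topology)
  then have "open {P \<in> hyp3. hyp_orbit \<Gamma> P \<in> U}"
    using open_hyp3 openin_open_trans by blast
  then have "{P \<in> hyp3. hyp_orbit \<Gamma> P \<in> U} \<inter> dom \<in> sets (restrict_space hyp_vol dom)"
    unfolding sets_restrict_space by (intro image_eqI[where x = "{P \<in> hyp3. hyp_orbit \<Gamma> P \<in> U}"]) (simp_all add: Int_commute)
  moreover have "hyp_orbit \<Gamma> -` U \<inter> space (restrict_space hyp_vol dom) = {P \<in> hyp3. hyp_orbit \<Gamma> P \<in> U} \<inter> dom"
    using dom_hyp3 by (auto simp: space_restrict_space)
  ultimately show "hyp_orbit \<Gamma> -` U \<inter> space (restrict_space hyp_vol dom) \<in> sets (restrict_space hyp_vol dom)"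
    by simp
qed

lemma nn_integral_orbit_vol:
  assumes "g \<in> borel_measurable (orbit_vol \<Gamma>)"
  shows "(\<integral>\<^sup>+x. g x \<partial>orbit_vol \<Gamma>) = (\<integral>\<^sup>+Q. g (hyp_orbit \<Gamma> Q) * indicator dom Q \<partial>hyp_vol)"
proof -
  have "g \<in> borel_measurable (borel_of_topology (orbit_topology \<Gamma>))"
    using assms by (simp add: orbit_vol_def)
  then have "(\<integral>\<^sup>+x. g x \<partial>orbit_vol \<Gamma>) = (\<integral>\<^sup>+Q. g (hyp_orbit \<Gamma> Q) \<partial>restrict_space hyp_vol dom)"
    unfolding orbit_vol_def dom_def[symmetric] by (intro nn_integral_distr hyp_orbit_measurable) simp
  also have "\<dots> = (\<integral>\<^sup>+Q. g (hyp_orbit \<Gamma> Q) * indicator dom Q \<partial>hyp_vol)"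
    by (rule nn_integral_restrict_space) simp
  finally show ?thesis .
qed

text \<open>Unfolding as an inequality: translates of \<open>dom\<close> cover the ball, invariance
  of the volume moves each piece back into \<open>dom\<close>, and it remains to count how many
  pieces land on a given point.\<close>

lemma nn_integral_ball_le_dom:
  fixes r :: real and f :: "complex \<times> real \<Rightarrow> ennreal"
  assumes P: "P \<in> hyp3" and f [measurable]: "f \<in> borel_measurable borel"
    and inv: "\<And>A Q. A \<in> \<Union>\<Gamma> \<Longrightarrow> Q \<in> hyp3 \<Longrightarrow> f (sl2_act A Q) = f Q"
  defines "B \<equiv> {Q \<in> hyp3. hcosh P Q \<le> r}"
  shows "(\<integral>\<^sup>+Q. f Q * indicator B Q \<partial>hyp_vol)
    \<le> of_nat (card {A \<in> \<Union>\<Gamma>. \<exists>Q\<in>hyp3. hcosh P Q \<le> r \<and> hcosh P (sl2_act A Q) \<le> r}) * (\<integral>\<^sup>+Q. f Q * indicator dom Q \<partial>hyp_vol)"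
    (is "_ \<le> of_nat (card ?K) * _")
proof -
  have [measurable]: "B \<in> sets borel" unfolding B_def by measurable
  let ?L = "\<Union>\<Gamma>"
  note cL = countable_lift
  have "(\<integral>\<^sup>+Q. f Q * indicator B Q \<partial>hyp_vol)
      \<le> (\<integral>\<^sup>+Q. \<integral>\<^sup>+A. indicator dom (sl2_act A Q) * f Q * indicator B Q \<partial>count_space ?L \<partial>hyp_vol)"
  proof (rule nn_integral_mono)
    fix Q
    show "f Q * indicator B Q \<le> (\<integral>\<^sup>+A. indicator dom (sl2_act A Q) * f Q * indicator B Q \<partial>count_space ?L)"
    proof (cases "Q \<in> B")
      case True
      then obtain A where A: "A \<in> ?L" "sl2_act A Q \<in> dom" using dom_meets_orbit[of Q] by (auto simp: B_def)
      have "f Q * indicator B Q = indicator dom (sl2_act A Q) * f Q * indicator B Q" using A by simp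
      also have "\<dots> \<le> (\<integral>\<^sup>+A. indicator dom (sl2_act A Q) * f Q * indicator B Q \<partial>count_space ?L)"
        by (rule nn_integral_ge_point[OF A(1)])
      finally show ?thesis .
    qed simp
  qed
  also have "\<dots> = (\<integral>\<^sup>+A. \<integral>\<^sup>+Q. indicator dom (sl2_act A Q) * f Q * indicator B Q \<partial>hyp_vol \<partial>count_space ?L)"
    by (rule nn_integral_count_space_nn_integral[OF cL]) measurable
  also have "\<dots> = (\<integral>\<^sup>+A. \<integral>\<^sup>+Q. indicator dom Q * f Q * indicator B (sl2_act (sl2_inv A) Q) \<partial>hyp_vol \<partial>count_space ?L)"
  proof (rule nn_integral_cong, simp only: space_count_space)
    fix A assume A: "A \<in> ?L"
    note dA = mem_lift(1)[OF A]
    have "(\<integral>\<^sup>+Q. indicator dom (sl2_act A Q) * f Q * indicator B Q \<partial>hyp_vol)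
        = (\<integral>\<^sup>+Q. indicator dom (sl2_act A Q) * f (sl2_act A Q) * indicator B (sl2_act (sl2_inv A) (sl2_act A Q)) \<partial>hyp_vol)"
    proof (rule nn_integral_cong_AE)
      show "AE Q in hyp_vol. indicator dom (sl2_act A Q) * f Q * indicator B Q
         = indicator dom (sl2_act A Q) * f (sl2_act A Q) * indicator B (sl2_act (sl2_inv A) (sl2_act A Q))"
        using AE_hyp_vol_hyp3 by eventually_elim (simp add: inv[OF A] sl2_act_inv[OF dA])
    qed
    also have "\<dots> = (\<integral>\<^sup>+Q. indicator dom Q * f Q * indicator B (sl2_act (sl2_inv A) Q) \<partial>distr hyp_vol borel (sl2_act A))"
      by (subst nn_integral_distr) auto
    also have "\<dots> = (\<integral>\<^sup>+Q. indicator dom Q * f Q * indicator B (sl2_act (sl2_inv A) Q) \<partial>hyp_vol)"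
      by (simp only: hyp_vol_invariant[OF dA])
    finally show "(\<integral>\<^sup>+Q. indicator dom (sl2_act A Q) * f Q * indicator B Q \<partial>hyp_vol)
       = (\<integral>\<^sup>+Q. indicator dom Q * f Q * indicator B (sl2_act (sl2_inv A) Q) \<partial>hyp_vol)" .
  qed
  also have "\<dots> = (\<integral>\<^sup>+Q. \<integral>\<^sup>+A. indicator dom Q * f Q * indicator B (sl2_act (sl2_inv A) Q) \<partial>count_space ?L \<partial>hyp_vol)"
    by (rule nn_integral_count_space_nn_integral[OF cL, symmetric]) measurable
  also have "\<dots> \<le> (\<integral>\<^sup>+Q. of_nat (card ?K) * (f Q * indicator dom Q) \<partial>hyp_vol)"
  proof (rule nn_integral_mono)
    fix Q
    show "(\<integral>\<^sup>+A. indicator dom Q * f Q * indicator B (sl2_act (sl2_inv A) Q) \<partial>count_space ?L)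
        \<le> of_nat (card ?K) * (f Q * indicator dom Q)"
    proof (cases "Q \<in> dom")
      case True
      then have Q: "Q \<in> hyp3" using dom_hyp3 by auto
      define T where "T = {A \<in> ?L. sl2_act (sl2_inv A) Q \<in> B}"
      have finK: "finite ?K" by (rule finite_lift_ball[OF P])
      have T: "finite T \<and> card T \<le> card ?K"
      proof (cases "T = {}")
        case False
        \<comment> \<open>With \<open>A0\<close> fixed, \<open>A\<close> is sent to
          \<open>sl2_inv A ** A0\<close>. This element carries one point of the ball, the preimage
          of \<open>Q\<close> under \<open>A0\<close>, to another, the preimage of \<open>Q\<close>
          under \<open>A\<close>; so it belongs to \<open>?K\<close>.\<close>
        then obtain A0 where A0: "A0 \<in> T" by blast
        then have A0L: "A0 \<in> ?L" by (simp add: T_def)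
        note d0 = mem_lift(1)[OF A0L]
        have inj: "inj_on (\<lambda>A. sl2_inv A ** A0) T"
        proof (rule inj_onI)
          fix A A' assume AA: "A \<in> T" "A' \<in> T" "sl2_inv A ** A0 = sl2_inv A' ** A0"
          have d: "det A = 1" "det A' = 1" using AA mem_lift(1) by (auto simp: T_def)
          have "(sl2_inv A ** A0) ** sl2_inv A0 = (sl2_inv A' ** A0) ** sl2_inv A0" using AA(3) by simp
          then have "sl2_inv A = sl2_inv A'"
            by (simp add: matrix_mul_assoc[symmetric] sl2_inv(1)[OF d0])
          then have "A ** sl2_inv A ** A' = A ** (sl2_inv A' ** A')" by (simp add: matrix_mul_assoc)
          then show "A = A'" using d by (simp add: sl2_inv)
        qed
        have img: "(\<lambda>A. sl2_inv A ** A0) ` T \<subseteq> ?K"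
        proof (rule image_subsetI)
          fix A assume A: "A \<in> T"
          then have AL: "A \<in> ?L" and AB: "sl2_act (sl2_inv A) Q \<in> B" by (simp_all add: T_def)
          define Q0 where "Q0 = sl2_act (sl2_inv A0) Q"
          have Q0: "Q0 \<in> B" using A0 by (simp add: T_def Q0_def)
          have "sl2_act (sl2_inv A ** A0) Q0 = sl2_act (sl2_inv A) (sl2_act A0 Q0)"
            using Q0 sl2_inv(3)[OF mem_lift(1)[OF AL]] d0 by (intro sl2_act_mult) (auto simp: B_def)
          also have "sl2_act A0 Q0 = Q" unfolding Q0_def by (rule sl2_act_inv(1)[OF d0 Q])
          finally have "hcosh P (sl2_act (sl2_inv A ** A0) Q0) \<le> r" using AB by (simp add: B_def)
          moreover have "sl2_inv A ** A0 \<in> ?L" by (intro mult_mem_lift inv_mem_lift AL A0L)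
          moreover have "Q0 \<in> hyp3" "hcosh P Q0 \<le> r" using Q0 by (simp_all add: B_def)
          ultimately show "sl2_inv A ** A0 \<in> ?K" by blast
        qed
        show ?thesis
          using finK inj img card_inj_on_le[OF inj img finK] finite_imageD[OF finite_subset[OF img finK] inj] by simp
      qed simp
      have "(\<integral>\<^sup>+A. indicator dom Q * f Q * indicator B (sl2_act (sl2_inv A) Q) \<partial>count_space ?L)
          = f Q * (\<integral>\<^sup>+A. indicator T A \<partial>count_space ?L)"
        using True by (subst nn_integral_cmult[symmetric]) (auto intro!: nn_integral_cong simp: T_def indicator_def)
      also have "(\<integral>\<^sup>+A. indicator T A \<partial>count_space ?L) = of_nat (card T)"
      proof -
        have "T \<subseteq> ?L" by (auto simp: T_def)
        then show ?thesis using T by (subst nn_integral_indicator) auto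
      qed
      also have "f Q * of_nat (card T) \<le> of_nat (card ?K) * (f Q * indicator dom Q)"
      proof -
        have "f Q * of_nat (card T) \<le> f Q * of_nat (card ?K)" using T by (intro mult_left_mono) auto
        then show ?thesis using True by (simp add: mult.commute)
      qed
      finally show ?thesis .
    qed simp
  qed
  also have "\<dots> = of_nat (card ?K) * (\<integral>\<^sup>+Q. f Q * indicator dom Q \<partial>hyp_vol)"
    by (rule nn_integral_cmult) measurable
  finally show ?thesis .
qed

end

section \<open>Mean squares of exponential sums\<close>

lemma DERIV_cmod_square:
  assumes "(f has_vector_derivative f') (at x)"
  shows "((\<lambda>x. (cmod (f x))\<^sup>2) has_real_derivative 2 * (f x \<bullet> f')) (at x)"
proof -
  have "((\<lambda>x. f x \<bullet> f x) has_real_derivative f x \<bullet> f' + f' \<bullet> f x) (at x)"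
    unfolding has_field_derivative_def
    by (rule has_derivative_eq_rhs[OF has_derivative_inner[OF assms[unfolded has_vector_derivative_def] assms[unfolded has_vector_derivative_def]]])
       (auto simp: fun_eq_iff algebra_simps)
  then show ?thesis by (simp add: power2_norm_eq_inner inner_commute)
qed

text \<open>Integrate the derivative of the squared modulus times a linear weight that is
  \<open>-1\<close> at \<open>y\<close> and \<open>0\<close> at \<open>y + \<delta>\<close>. The
  parameter \<open>T\<close> splits the cross term by the inequality of arithmetic and geometric
  means; later it is the largest frequency.\<close>

lemma sobolev_pointwise:
  fixes f f' :: "real \<Rightarrow> complex"
  assumes f: "\<And>y. (f has_vector_derivative f' y) (at y)" and f': "continuous_on UNIV f'"
    and d: "\<delta> > 0" and T: "T > 0"
  shows "(cmod (f y))\<^sup>2 \<le> (\<integral>v. indicator {y..y + \<delta>} v * ((1 / \<delta> + T) * (cmod (f v))\<^sup>2 + (cmod (f' v))\<^sup>2 / T) \<partial>lborel)"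
proof -
  define \<phi> where "\<phi> v = (v - y - \<delta>) / \<delta> * (cmod (f v))\<^sup>2" for v
  define \<phi>' where "\<phi>' v = (cmod (f v))\<^sup>2 / \<delta> + (v - y - \<delta>) / \<delta> * (2 * (f v \<bullet> f' v))" for v
  have cf: "continuous_on UNIV f"
    using f by (meson continuous_at_imp_continuous_on has_vector_derivative_continuous)
  have dphi: "(\<phi> has_real_derivative \<phi>' v) (at v)" for v
  proof -
    have "((\<lambda>v. (v - y - \<delta>) / \<delta>) has_real_derivative 1 / \<delta>) (at v)"
      using d by (auto intro!: derivative_eq_intros)
    from DERIV_mult[OF this DERIV_cmod_square[OF f]] show ?thesis
      unfolding \<phi>_def \<phi>'_def by (simp add: mult_ac)
  qed
  have c\<phi>': "continuous_on UNIV \<phi>'"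
    unfolding \<phi>'_def using d by (intro continuous_intros cf f') auto
  let ?G = "\<lambda>v. (1 / \<delta> + T) * (cmod (f v))\<^sup>2 + (cmod (f' v))\<^sup>2 / T"
  have i1: "integrable lborel (\<lambda>v. indicator {y..y + \<delta>} v *\<^sub>R \<phi>' v)"
    by (intro borel_integrable_compact) (auto intro: continuous_on_subset[OF c\<phi>'])
  have i2: "integrable lborel (\<lambda>v. indicator {y..y + \<delta>} v *\<^sub>R ?G v)"
    using T by (intro borel_integrable_compact) (auto intro!: continuous_intros continuous_on_subset[OF cf] continuous_on_subset[OF f'])
  have "(cmod (f y))\<^sup>2 = \<phi> (y + \<delta>) - \<phi> y" using d by (simp add: \<phi>_def)
  also have "\<dots> = (\<integral>v. indicator {y..y + \<delta>} v *\<^sub>R \<phi>' v \<partial>lborel)"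
    using d dphi c\<phi>'
    by (intro integral_FTC_Icc[symmetric])
       (auto simp: has_real_derivative_iff_has_vector_derivative intro: has_vector_derivative_at_within continuous_on_subset)
  also have "\<dots> \<le> (\<integral>v. indicator {y..y + \<delta>} v *\<^sub>R ?G v \<partial>lborel)"
  proof (rule integral_mono[OF i1 i2])
    fix v
    show "indicator {y..y + \<delta>} v *\<^sub>R \<phi>' v \<le> indicator {y..y + \<delta>} v *\<^sub>R ?G v"
    proof (cases "v \<in> {y..y + \<delta>}")
      case True
      have "\<bar>(v - y - \<delta>) / \<delta>\<bar> \<le> 1" using True d by (auto simp: abs_le_iff field_simps)
      then have "\<bar>(v - y - \<delta>) / \<delta> * (2 * (f v \<bullet> f' v))\<bar> \<le> 1 * \<bar>2 * (f v \<bullet> f' v)\<bar>"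
        unfolding abs_mult by (intro mult_right_mono) auto
      also have "\<dots> \<le> 2 * (cmod (f v) * cmod (f' v))"
        using Cauchy_Schwarz_ineq2[of "f v" "f' v"] by (simp add: abs_mult)
      also have "\<dots> \<le> T * (cmod (f v))\<^sup>2 + (cmod (f' v))\<^sup>2 / T"
      proof -
        have "0 \<le> (T * cmod (f v) - cmod (f' v))\<^sup>2 / T" using T by simp
        also have "\<dots> = T * (cmod (f v))\<^sup>2 + (cmod (f' v))\<^sup>2 / T - 2 * (cmod (f v) * cmod (f' v))"
          using T by (simp add: field_simps power2_eq_square)
        finally show ?thesis by simp
      qed
      finally have "(v - y - \<delta>) / \<delta> * (2 * (f v \<bullet> f' v)) \<le> T * (cmod (f v))\<^sup>2 + (cmod (f' v))\<^sup>2 / T" by linarith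
      then show ?thesis using True by (simp add: \<phi>'_def algebra_simps)
    qed simp
  qed
  finally show ?thesis by simp
qed

text \<open>Separation makes the intervals \<open>{y k..y k + \<delta>}\<close> disjoint, so the
  pointwise bounds add up to one integral over \<open>{a..b}\<close>.\<close>

lemma gallagher:
  fixes f f' :: "real \<Rightarrow> complex" and y :: "'k \<Rightarrow> real"
  assumes f: "\<And>y. (f has_vector_derivative f' y) (at y)" and f': "continuous_on UNIV f'"
    and d: "\<delta> > 0" and T: "T > 0" and A: "finite A"
    and sep: "\<And>k l. k \<in> A \<Longrightarrow> l \<in> A \<Longrightarrow> k \<noteq> l \<Longrightarrow> \<bar>y k - y l\<bar> > \<delta>"
    and rng: "\<And>k. k \<in> A \<Longrightarrow> a \<le> y k \<and> y k + \<delta> \<le> b"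
  shows "(\<Sum>k\<in>A. (cmod (f (y k)))\<^sup>2) \<le> (1 / \<delta> + T) * (\<integral>v. indicator {a..b} v * (cmod (f v))\<^sup>2 \<partial>lborel)
    + (\<integral>v. indicator {a..b} v * (cmod (f' v))\<^sup>2 \<partial>lborel) / T"
proof -
  have cf: "continuous_on UNIV f"
    using f by (meson continuous_at_imp_continuous_on has_vector_derivative_continuous)
  let ?G = "\<lambda>v. (1 / \<delta> + T) * (cmod (f v))\<^sup>2 + (cmod (f' v))\<^sup>2 / T"
  have G: "?G v \<ge> 0" for v using d T by (intro add_nonneg_nonneg mult_nonneg_nonneg divide_nonneg_pos) auto
  have cG: "continuous_on UNIV ?G" using T by (intro continuous_intros cf f') auto
  have int: "integrable lborel (\<lambda>v. indicator {p..q} v * h v)" if "continuous_on UNIV h" for p q and h :: "real \<Rightarrow> real"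
    using borel_integrable_compact[of "{p..q}" h] continuous_on_subset[OF that] by auto
  have "(\<Sum>k\<in>A. (cmod (f (y k)))\<^sup>2) \<le> (\<Sum>k\<in>A. \<integral>v. indicator {y k..y k + \<delta>} v * ?G v \<partial>lborel)"
    by (intro sum_mono sobolev_pointwise f f' d T)
  also have "\<dots> = (\<integral>v. (\<Sum>k\<in>A. indicator {y k..y k + \<delta>} v * ?G v) \<partial>lborel)"
    by (rule Bochner_Integration.integral_sum[symmetric]) (rule int[OF cG])
  also have "\<dots> \<le> (\<integral>v. indicator {a..b} v * ?G v \<partial>lborel)"
  proof (rule integral_mono)
    show "integrable lborel (\<lambda>v. \<Sum>k\<in>A. indicator {y k..y k + \<delta>} v * ?G v)"
      by (intro Bochner_Integration.integrable_sum int[OF cG])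
    show "integrable lborel (\<lambda>v. indicator {a..b} v * ?G v)" by (rule int[OF cG])
    fix v
    show "(\<Sum>k\<in>A. indicator {y k..y k + \<delta>} v * ?G v) \<le> indicator {a..b} v * ?G v"
    proof (cases "\<exists>k\<in>A. v \<in> {y k..y k + \<delta>}")
      case True
      then obtain k where k: "k \<in> A" "v \<in> {y k..y k + \<delta>}" by blast
      have "v \<notin> {y l..y l + \<delta>}" if "l \<in> A - {k}" for l
        using sep[OF k(1), of l] that k(2) by auto
      then have "(\<Sum>l\<in>A - {k}. indicator {y l..y l + \<delta>} v * ?G v) = 0"
        by (intro sum.neutral) (auto simp: indicator_def)
      then have "(\<Sum>k\<in>A. indicator {y k..y k + \<delta>} v * ?G v) = indicator {y k..y k + \<delta>} v * ?G v"
        using sum.remove[OF A k(1), of "\<lambda>l. indicator {y l..y l + \<delta>} v * ?G v"] by simp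
      also have "\<dots> = indicator {a..b} v * ?G v" using k rng[OF k(1)] by (auto simp: indicator_def)
      finally show ?thesis by simp
    next
      case False
      then have "(\<Sum>k\<in>A. indicator {y k..y k + \<delta>} v * ?G v) = 0"
        by (intro sum.neutral) (auto simp: indicator_def)
      then show ?thesis using G[of v] by simp
    qed
  qed
  also have "\<dots> = (\<integral>v. (1 / \<delta> + T) * (indicator {a..b} v * (cmod (f v))\<^sup>2) + (indicator {a..b} v * (cmod (f' v))\<^sup>2) / T \<partial>lborel)"
    by (intro Bochner_Integration.integral_cong refl) (simp add: distrib_left mult_ac)
  also have "\<dots> = (1 / \<delta> + T) * (\<integral>v. indicator {a..b} v * (cmod (f v))\<^sup>2 \<partial>lborel)
    + (\<integral>v. indicator {a..b} v * (cmod (f' v))\<^sup>2 \<partial>lborel) / T"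
  proof -
    have "integrable lborel (\<lambda>v. indicator {a..b} v * (cmod (f v))\<^sup>2)" "integrable lborel (\<lambda>v. indicator {a..b} v * (cmod (f' v))\<^sup>2)"
      by (intro int continuous_intros cf f')+
    then show ?thesis by (subst Bochner_Integration.integral_add) auto
  qed
  finally show ?thesis .
qed

text \<open>The weight vanishes at the endpoints, so integration by parts yields quadratic decay.
  The constant covers both ranges: the total mass is \<open>32 / 3 \<le> 24 / 2\<close> for small
  \<open>\<tau>\<close>, and the boundary terms are at most \<open>12 / \<tau> ^ 2\<close> for large
  \<open>\<tau>\<close>.\<close>

lemma fourier_parabola_bound:
  "cmod (\<integral>y. indicator {-2..2} y *\<^sub>R (of_real (4 - y\<^sup>2) * exp (\<i> * of_real (\<tau> * y))) \<partial>lborel) \<le> 24 / (1 + \<tau>\<^sup>2)"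
proof (cases "\<bar>\<tau>\<bar> \<le> 1")
  case True
  have int: "integrable lborel (\<lambda>y. indicator {-2..2} y *\<^sub>R (of_real (4 - y\<^sup>2) * exp (\<i> * of_real (\<tau> * y))))"
    by (intro borel_integrable_compact continuous_intros) auto
  have hb: "has_bochner_integral lborel (\<lambda>y. (4 - y\<^sup>2) * indicator {-2..2} y) ((4 * 2 - 2 ^ 3 / 3) - (4 * (-2) - (-2) ^ 3 / 3) :: real)"
    by (intro has_bochner_integral_FTC_Icc_real) (auto intro!: derivative_eq_intros continuous_intros)
  then have int2: "integrable lborel (\<lambda>y. (4 - y\<^sup>2) * indicator {-2..2} y :: real)" by (simp add: has_bochner_integral_iff)
  have "cmod (\<integral>y. indicator {-2..2} y *\<^sub>R (of_real (4 - y\<^sup>2) * exp (\<i> * of_real (\<tau> * y))) \<partial>lborel)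
      \<le> (\<integral>y. (4 - y\<^sup>2) * indicator {-2..2} y \<partial>lborel)"
  proof (rule Bochner_Integration.integral_norm_bound_integral[OF int int2])
    fix y :: real
    have "y\<^sup>2 \<le> 4" if "y \<in> {-2..2}"
      using that abs_le_square_iff[of y 2] by (simp add: abs_le_iff)
    then show "cmod (indicator {-2..2} y *\<^sub>R (of_real (4 - y\<^sup>2) * exp (\<i> * of_real (\<tau> * y)))) \<le> (4 - y\<^sup>2) * indicator {-2..2} y"
      by (cases "y \<in> {-2..2}") (simp_all add: norm_mult del: of_real_diff of_real_mult)
  qed
  also have "\<dots> = 32 / 3" using hb by (simp add: has_bochner_integral_iff)
  also have "\<dots> \<le> 24 / (1 + \<tau>\<^sup>2)"
  proof -
    have "\<tau>\<^sup>2 \<le> 1" using True by (simp add: abs_square_le_1)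
    then show ?thesis by (simp add: field_simps add_pos_nonneg)
  qed
  finally show ?thesis .
next
  case False
  define D where "D = \<i> * complex_of_real \<tau>"
  have D: "D \<noteq> 0" "cmod D = \<bar>\<tau>\<bar>" using False by (auto simp: D_def norm_mult)
  \<comment> \<open>A primitive from repeated integration by parts, with \<open>D\<close> standing
    for \<open>\<i> * \<tau>\<close>. At both endpoints its term of order \<open>1 / D\<close> is
    zero.\<close>
  define \<Phi> where "\<Phi> y = exp (D * of_real y) * (of_real (4 - y\<^sup>2) / D + 2 * of_real y / D ^ 2 - 2 / D ^ 3)" for y :: real
  have "(\<Phi> has_vector_derivative of_real (4 - y\<^sup>2) * exp (\<i> * of_real (\<tau> * y))) (at y)" for y
  proof -
    have "((\<lambda>z. exp (D * z) * ((4 - z\<^sup>2) / D + 2 * z / D ^ 2 - 2 / D ^ 3)) has_field_derivative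
        exp (D * of_real y) * (4 - (of_real y)\<^sup>2)) (at (of_real y))"
      using D by (auto intro!: derivative_eq_intros simp: field_simps power2_eq_square power3_eq_cube)
    then have "((\<lambda>y. exp (D * of_real y) * ((4 - (of_real y)\<^sup>2) / D + 2 * of_real y / D ^ 2 - 2 / D ^ 3)) has_vector_derivative
        exp (D * of_real y) * (4 - (of_real y)\<^sup>2)) (at y)"
      by (rule has_vector_derivative_real_field)
    then show ?thesis by (simp add: \<Phi>_def[abs_def] D_def mult_ac)
  qed
  then have "(\<integral>y. indicator {-2..2} y *\<^sub>R (of_real (4 - y\<^sup>2) * exp (\<i> * of_real (\<tau> * y))) \<partial>lborel) = \<Phi> 2 - \<Phi> (-2)"
  proof (intro integral_FTC_Icc[where F = \<Phi>])
    show "continuous_on {-2..2} (\<lambda>y. complex_of_real (4 - y\<^sup>2) * exp (\<i> * complex_of_real (\<tau> * y)))"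
      by (intro continuous_intros)
  qed (auto intro: has_vector_derivative_at_within)
  also have "cmod \<dots> \<le> cmod (\<Phi> 2) + cmod (\<Phi> (-2))" by (rule norm_triangle_ineq4)
  also have "cmod (\<Phi> 2) \<le> 4 / \<bar>\<tau>\<bar> ^ 2 + 2 / \<bar>\<tau>\<bar> ^ 3"
  proof -
    have "cmod (\<Phi> 2) = cmod (4 / D ^ 2 - 2 / D ^ 3)"
      by (simp add: \<Phi>_def norm_mult D_def)
    also have "\<dots> \<le> cmod (4 / D ^ 2) + cmod (2 / D ^ 3)" by (rule norm_triangle_ineq4)
    finally show ?thesis by (simp only: norm_divide norm_power D norm_numeral)
  qed
  also have "cmod (\<Phi> (-2)) \<le> 4 / \<bar>\<tau>\<bar> ^ 2 + 2 / \<bar>\<tau>\<bar> ^ 3"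
  proof -
    have "cmod (\<Phi> (-2)) = cmod (- 4 / D ^ 2 - 2 / D ^ 3)"
      by (simp add: \<Phi>_def norm_mult D_def)
    also have "\<dots> \<le> cmod (- 4 / D ^ 2) + cmod (2 / D ^ 3)" by (rule norm_triangle_ineq4)
    finally show ?thesis by (simp only: norm_divide norm_power D norm_numeral norm_minus_cancel)
  qed
  also have "4 / \<bar>\<tau>\<bar> ^ 2 + 2 / \<bar>\<tau>\<bar> ^ 3 + (4 / \<bar>\<tau>\<bar> ^ 2 + 2 / \<bar>\<tau>\<bar> ^ 3) \<le> 24 / (1 + \<tau>\<^sup>2)"
  proof -
    have t: "\<bar>\<tau>\<bar> > 1" using False by simp
    have "\<bar>\<tau>\<bar> ^ 2 \<le> \<bar>\<tau>\<bar> ^ 3" using t by (intro power_increasing) auto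
    then have "2 / \<bar>\<tau>\<bar> ^ 3 \<le> 2 / \<bar>\<tau>\<bar> ^ 2"
      using t by (intro divide_left_mono mult_pos_pos zero_less_power) auto
    then have "4 / \<bar>\<tau>\<bar> ^ 2 + 2 / \<bar>\<tau>\<bar> ^ 3 + (4 / \<bar>\<tau>\<bar> ^ 2 + 2 / \<bar>\<tau>\<bar> ^ 3) \<le> 12 / \<bar>\<tau>\<bar> ^ 2" by simp
    also have "\<dots> \<le> 24 / (1 + \<tau>\<^sup>2)"
    proof -
      define q where "q = \<bar>\<tau>\<bar> ^ 2"
      have q: "q > 1" unfolding q_def using t by (rule one_less_power) simp
      have "12 / q = 12 * (1 + q) / (q * (1 + q))"
        by (rule nonzero_mult_divide_mult_cancel_right[symmetric]) (use q in simp)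
      also have "\<dots> \<le> 24 * q / (q * (1 + q))" using q by (intro divide_right_mono) auto
      also have "\<dots> = 24 / (1 + q)" using q by simp
      finally show ?thesis by (simp add: q_def)
    qed
    finally show ?thesis .
  qed
  finally show ?thesis by simp
qed

text \<open>On \<open>{-1..1}\<close> the weight \<open>4 - y ^ 2\<close> is at least
  \<open>3\<close>, so the sharp cut-off is dominated by one third of the parabola; hence
  \<open>8 = 24 / 3\<close>.\<close>

lemma mean_square_exponential_sum:
  fixes c :: "'j \<Rightarrow> complex" and t :: "'j \<Rightarrow> real"
  assumes J: "finite J"
  shows "(\<integral>y. indicator {-1..1} y * (cmod (\<Sum>j\<in>J. c j * exp (\<i> * of_real (t j * y))))\<^sup>2 \<partial>lborel)
    \<le> 8 * (\<Sum>j\<in>J. \<Sum>l\<in>J. cmod (c j) * cmod (c l) / (1 + (t j - t l)\<^sup>2))"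
proof -
  define S where "S y = (\<Sum>j\<in>J. c j * exp (\<i> * of_real (t j * y)))" for y :: real
  have cS: "continuous_on UNIV S" unfolding S_def by (intro continuous_intros)
  have i1: "integrable lborel (\<lambda>y. indicator {-1..1} y *\<^sub>R (cmod (S y))\<^sup>2)"
    by (intro borel_integrable_compact continuous_intros continuous_on_subset[OF cS]) auto
  have i2: "integrable lborel (\<lambda>y. indicator {-2..2} y *\<^sub>R ((4 - y\<^sup>2) * (cmod (S y))\<^sup>2))"
    by (intro borel_integrable_compact continuous_intros continuous_on_subset[OF cS]) auto
  have "3 * (\<integral>y. indicator {-1..1} y * (cmod (S y))\<^sup>2 \<partial>lborel) = (\<integral>y. 3 * (indicator {-1..1} y *\<^sub>R (cmod (S y))\<^sup>2) \<partial>lborel)"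
    by simp
  also have "\<dots> \<le> (\<integral>y. indicator {-2..2} y *\<^sub>R ((4 - y\<^sup>2) * (cmod (S y))\<^sup>2) \<partial>lborel)"
  proof (rule integral_mono[OF _ i2])
    show "integrable lborel (\<lambda>y. 3 * (indicator {-1..1} y *\<^sub>R (cmod (S y))\<^sup>2))" using i1 by simp
    fix y :: real
    show "3 * (indicator {-1..1} y *\<^sub>R (cmod (S y))\<^sup>2) \<le> indicator {-2..2} y *\<^sub>R ((4 - y\<^sup>2) * (cmod (S y))\<^sup>2)"
    proof (cases "y \<in> {-1..1}")
      case True
      then have "y\<^sup>2 \<le> 1" by (simp add: abs_square_le_1 abs_le_iff)
      then show ?thesis using True by (simp add: mult_right_mono)
    next
      case False
      have "y\<^sup>2 \<le> 4" if "y \<in> {-2..2}" using that abs_le_square_iff[of y 2] by (simp add: abs_le_iff)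
      then show ?thesis using False by (auto simp: indicator_def)
    qed
  qed
  also have "\<dots> = cmod (complex_of_real (\<integral>y. indicator {-2..2} y *\<^sub>R ((4 - y\<^sup>2) * (cmod (S y))\<^sup>2) \<partial>lborel))"
  proof -
    have "(\<integral>y. indicator {-2..2} y *\<^sub>R ((4 - y\<^sup>2) * (cmod (S y))\<^sup>2) \<partial>lborel) \<ge> 0"
    proof (rule Bochner_Integration.integral_nonneg)
      fix y :: real
      have "y\<^sup>2 \<le> 4" if "y \<in> {-2..2}" using that abs_le_square_iff[of y 2] by (simp add: abs_le_iff)
      then show "0 \<le> indicator {-2..2} y *\<^sub>R ((4 - y\<^sup>2) * (cmod (S y))\<^sup>2)" by (auto simp: indicator_def)
    qed
    then show ?thesis by (simp only: norm_of_real abs_of_nonneg)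
  qed
  also have "complex_of_real (\<integral>y. indicator {-2..2} y *\<^sub>R ((4 - y\<^sup>2) * (cmod (S y))\<^sup>2) \<partial>lborel)
     = (\<integral>y. complex_of_real (indicator {-2..2} y *\<^sub>R ((4 - y\<^sup>2) * (cmod (S y))\<^sup>2)) \<partial>lborel)"
    by (rule integral_complex_of_real[symmetric])
  also have "\<dots> = (\<integral>y. (\<Sum>j\<in>J. \<Sum>l\<in>J. (c j * cnj (c l)) * (indicator {-2..2} y *\<^sub>R (of_real (4 - y\<^sup>2) * exp (\<i> * of_real ((t j - t l) * y))))) \<partial>lborel)"
  proof (intro Bochner_Integration.integral_cong refl)
    fix y :: real
    have "complex_of_real ((cmod (S y))\<^sup>2) = S y * cnj (S y)" by (rule complex_norm_square)
    also have "\<dots> = (\<Sum>j\<in>J. \<Sum>l\<in>J. (c j * exp (\<i> * of_real (t j * y))) * cnj (c l * exp (\<i> * of_real (t l * y))))"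
      unfolding S_def cnj_sum sum_product ..
    also have "\<dots> = (\<Sum>j\<in>J. \<Sum>l\<in>J. (c j * cnj (c l)) * exp (\<i> * of_real ((t j - t l) * y)))"
      by (intro sum.cong refl) (simp add: exp_cnj algebra_simps flip: exp_add)
    finally have "complex_of_real ((cmod (S y))\<^sup>2) = (\<Sum>j\<in>J. \<Sum>l\<in>J. (c j * cnj (c l)) * exp (\<i> * of_real ((t j - t l) * y)))" .
    then show "of_real (indicator {-2..2} y *\<^sub>R ((4 - y\<^sup>2) * (cmod (S y))\<^sup>2))
      = (\<Sum>j\<in>J. \<Sum>l\<in>J. (c j * cnj (c l)) * (indicator {-2..2} y *\<^sub>R (of_real (4 - y\<^sup>2) * exp (\<i> * of_real ((t j - t l) * y)))))"
      by (simp add: scaleR_conv_of_real sum_distrib_left mult_ac del: of_real_power)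
  qed
  also have "\<dots> = (\<Sum>j\<in>J. \<Sum>l\<in>J. (c j * cnj (c l)) * (\<integral>y. indicator {-2..2} y *\<^sub>R (of_real (4 - y\<^sup>2) * exp (\<i> * of_real ((t j - t l) * y))) \<partial>lborel))"
  proof -
    have "integrable lborel (\<lambda>y. indicator {-2..2} y *\<^sub>R (of_real (4 - y\<^sup>2) * exp (\<i> * of_real (\<tau> * y))))" for \<tau>
      by (intro borel_integrable_compact continuous_intros) auto
    then have i: "integrable lborel (\<lambda>y. (c j * cnj (c l)) * (indicator {-2..2} y *\<^sub>R (of_real (4 - y\<^sup>2) * exp (\<i> * of_real ((t j - t l) * y)))))" for j l
      by (rule integrable_mult_right)
    show ?thesis
      by (subst Bochner_Integration.integral_sum, intro Bochner_Integration.integrable_sum i)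
         (intro sum.cong refl, subst Bochner_Integration.integral_sum, rule i, simp only: integral_mult_right_zero)
  qed
  also have "cmod \<dots> \<le> (\<Sum>j\<in>J. \<Sum>l\<in>J. cmod (c j) * cmod (c l) * (24 / (1 + (t j - t l)\<^sup>2)))"
    by (intro order_trans[OF norm_sum] sum_mono)
       (simp only: norm_mult complex_mod_cnj, intro mult_left_mono fourier_parabola_bound mult_nonneg_nonneg norm_ge_zero)
  also have "\<dots> = 24 * (\<Sum>j\<in>J. \<Sum>l\<in>J. cmod (c j) * cmod (c l) / (1 + (t j - t l)\<^sup>2))"
    by (simp add: sum_distrib_left mult_ac)
  finally show ?thesis by (simp add: S_def)
qed

lemma sum_inverse_one_plus_square_int:
  fixes N :: "int set" and m :: int
  assumes "finite N"
  shows "(\<Sum>n\<in>N. 1 / (1 + (of_int (n - m))\<^sup>2)) \<le> (5 :: real)"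
proof -
  \<comment> \<open>A telescoping strengthening of the bound \<open>5\<close>: it is an equality at
    \<open>k = 0\<close>, and the step from \<open>k\<close> to \<open>k + 1\<close> leaves room for
    the two new terms.\<close>
  have b: "(\<Sum>n\<in>{- int k..int k}. 1 / (1 + (of_int n)\<^sup>2)) \<le> 5 - 4 / (real k + 1)" for k
  proof (induction k)
    case (Suc k)
    have "{- int (Suc k)..int (Suc k)} = insert (- int (Suc k)) (insert (int (Suc k)) {- int k..int k})" by auto
    then have "(\<Sum>n\<in>{- int (Suc k)..int (Suc k)}. 1 / (1 + (of_int n)\<^sup>2))
        = 2 / (1 + (real k + 1)\<^sup>2) + (\<Sum>n\<in>{- int k..int k}. 1 / (1 + (real_of_int n)\<^sup>2))"
      by (simp add: power2_eq_square algebra_simps)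
    also have "\<dots> \<le> 2 / (1 + (real k + 1)\<^sup>2) + (5 - 4 / (real k + 1))" using Suc by simp
    also have "2 / (1 + (real k + 1)\<^sup>2) \<le> 4 / (real k + 1) - 4 / (real (Suc k) + 1)"
    proof -
      have "4 / (real k + 1) - 4 / (real (Suc k) + 1) = 4 / ((real k + 1) * (real k + 2))"
        by (simp add: field_simps)
      moreover have "2 / (1 + (real k + 1)\<^sup>2) \<le> 4 / ((real k + 1) * (real k + 2))"
      proof -
        have "(real k + 1) * (real k + 2) * 2 \<le> 4 * (1 + (real k + 1)\<^sup>2)"
          by (simp add: power2_eq_square algebra_simps)
        moreover have "1 + (real k + 1)\<^sup>2 > 0" by (simp add: add_pos_nonneg)
        ultimately show ?thesis by (simp add: divide_le_eq le_divide_eq mult_ac)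
      qed
      ultimately show ?thesis by simp
    qed
    finally show ?case by simp
  qed simp
  have fin: "finite ((\<lambda>n. n - m) ` N)" using assms by simp
  then obtain k where k: "(\<lambda>n. n - m) ` N \<subseteq> {- int k..int k}"
  proof -
    obtain B where B: "\<And>x. x \<in> (\<lambda>n. n - m) ` N \<Longrightarrow> \<bar>x\<bar> \<le> B"
    proof -
      have "\<forall>x\<in>(\<lambda>n. n - m) ` N. \<bar>x\<bar> \<le> (\<Sum>y\<in>(\<lambda>n. n - m) ` N. \<bar>y\<bar>)"
        using fin by (auto intro!: member_le_sum)
      then show ?thesis using that by blast
    qed
    have "(\<lambda>n. n - m) ` N \<subseteq> {- int (nat B)..int (nat B)}"
    proof
      fix x assume "x \<in> (\<lambda>n. n - m) ` N"
      from B[OF this] show "x \<in> {- int (nat B)..int (nat B)}" by auto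
    qed
    then show ?thesis using that by blast
  qed
  have "(\<Sum>n\<in>N. 1 / (1 + (of_int (n - m))\<^sup>2)) = (\<Sum>n\<in>(\<lambda>n. n - m) ` N. 1 / (1 + (real_of_int n)\<^sup>2))"
    by (subst sum.reindex) (auto simp: inj_on_def)
  also have "\<dots> \<le> (\<Sum>n\<in>{- int k..int k}. 1 / (1 + (real_of_int n)\<^sup>2))"
    using k by (intro sum_mono2) (auto intro!: divide_nonneg_nonneg add_nonneg_nonneg)
  also have "\<dots> \<le> 5 - 4 / (real k + 1)" by (rule b)
  also have "\<dots> \<le> 5" by simp
  finally show ?thesis .
qed

section \<open>The local Weyl bound\<close>

lemma square_integrable_product:
  assumes f: "square_integrable M f" and g: "square_integrable M g"
  shows "integrable M (\<lambda>x. f x * cnj (g x))"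
proof (rule Bochner_Integration.integrable_bound)
  show "integrable M (\<lambda>x. (cmod (f x))\<^sup>2 + (cmod (g x))\<^sup>2)"
    using f g by (auto simp: square_integrable_def)
  have [measurable]: "f \<in> borel_measurable M" "g \<in> borel_measurable M"
    using f g by (auto simp: square_integrable_def)
  show "(\<lambda>x. f x * cnj (g x)) \<in> borel_measurable M" by measurable
  have "cmod (f x * cnj (g x)) \<le> (cmod (f x))\<^sup>2 + (cmod (g x))\<^sup>2" for x
  proof -
    have "2 * (cmod (f x) * cmod (g x)) \<le> (cmod (f x))\<^sup>2 + (cmod (g x))\<^sup>2"
      using zero_le_power2[of "cmod (f x) - cmod (g x)"] unfolding power2_diff by simp
    moreover have "0 \<le> cmod (f x) * cmod (g x)" by simp
    ultimately show ?thesis unfolding norm_mult complex_mod_cnj by linarith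
  qed
  then show "AE x in M. cmod (f x * cnj (g x)) \<le> norm ((cmod (f x))\<^sup>2 + (cmod (g x))\<^sup>2)"
    by simp
qed

lemma integral_orthonormal_sum:
  assumes sq: "\<And>j. square_integrable M (u j)"
    and on: "\<And>i j. (\<integral>x. u i x * cnj (u j x) \<partial>M) = (if i = j then 1 else 0)"
    and J: "finite J"
  shows "integrable M (\<lambda>x. (cmod (\<Sum>j\<in>J. c j * u j x))\<^sup>2)"
    and "(\<integral>x. (cmod (\<Sum>j\<in>J. c j * u j x))\<^sup>2 \<partial>M) = (\<Sum>j\<in>J. (cmod (c j))\<^sup>2)"
proof -
  have eq: "complex_of_real ((cmod (\<Sum>j\<in>J. c j * u j x))\<^sup>2) = (\<Sum>i\<in>J. \<Sum>j\<in>J. (c i * cnj (c j)) * (u i x * cnj (u j x)))" for x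
    unfolding complex_norm_square cnj_sum sum_product by (intro sum.cong refl) (simp add: mult_ac)
  have i: "integrable M (\<lambda>x. (c i * cnj (c j)) * (u i x * cnj (u j x)))" for i j
    by (intro integrable_mult_right square_integrable_product sq)
  have int: "integrable M (\<lambda>x. complex_of_real ((cmod (\<Sum>j\<in>J. c j * u j x))\<^sup>2))"
    unfolding eq by (intro Bochner_Integration.integrable_sum i)
  then show "integrable M (\<lambda>x. (cmod (\<Sum>j\<in>J. c j * u j x))\<^sup>2)"
    using integrable_Re[OF int] by simp
  have "complex_of_real (\<integral>x. (cmod (\<Sum>j\<in>J. c j * u j x))\<^sup>2 \<partial>M) = (\<integral>x. complex_of_real ((cmod (\<Sum>j\<in>J. c j * u j x))\<^sup>2) \<partial>M)"
    by (rule integral_complex_of_real[symmetric])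
  also have "\<dots> = (\<Sum>i\<in>J. \<Sum>j\<in>J. (c i * cnj (c j)) * (if i = j then 1 else 0))"
    unfolding eq
    by (subst Bochner_Integration.integral_sum, intro Bochner_Integration.integrable_sum i)
       (intro sum.cong refl, subst Bochner_Integration.integral_sum, rule i, simp only: integral_mult_right_zero on)
  also have "\<dots> = (\<Sum>i\<in>J. c i * cnj (c i))"
    using J by (intro sum.cong refl) (simp add: if_distrib sum.delta' cong: if_cong)
  also have "\<dots> = complex_of_real (\<Sum>j\<in>J. (cmod (c j))\<^sup>2)"
    by (simp add: complex_norm_square del: of_real_power)
  finally show "(\<integral>x. (cmod (\<Sum>j\<in>J. c j * u j x))\<^sup>2 \<partial>M) = (\<Sum>j\<in>J. (cmod (c j))\<^sup>2)"
    unfolding of_real_eq_iff .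
qed

text \<open>\<open>S\<close> and \<open>C\<close> play the roles of \<open>sin (t s) / t\<close> and \<open>cos (t s)\<close>, where \<open>m = t\<^sup>2\<close> may be negative.\<close>

definition trig_pair :: "real \<Rightarrow> (real \<Rightarrow> real) \<Rightarrow> (real \<Rightarrow> real) \<Rightarrow> bool" where
  "trig_pair m S C \<longleftrightarrow> (\<forall>x. (S has_real_derivative C x) (at x)) \<and>
     (\<forall>x. (C has_real_derivative - m * S x) (at x)) \<and> S 0 = 0 \<and> C 0 = 1"

context discrete_PSL2C
begin

text \<open>Bessel's inequality for the automorphic kernel \<open>\<Sum>\<^sub>\<gamma> \<kappa>(d(P, \<gamma> Q)) / sinh d(P, \<gamma> Q)\<close>, in dual form:
  the kernel is tested against \<open>\<Sum>\<^sub>j T\<^sub>j cnj (u\<^sub>j(P)) u\<^sub>j\<close>, where \<open>T\<^sub>j\<close> is its eigenvalue.\<close>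

lemma kernel_bessel:
  assumes P: "P \<in> hyp3"
  defines "K \<equiv> real (card {A \<in> \<Union>\<Gamma>. \<exists>Q\<in>hyp3. hcosh P Q \<le> cosh 1 \<and> hcosh P (sl2_act A Q) \<le> cosh 1}) + 1"
  assumes sp: "spectral_system \<Gamma> u t" and J: "finite J"
    and \<kappa>: "continuous_on UNIV \<kappa>" and \<kappa>1: "\<And>s. s \<ge> 1 \<Longrightarrow> \<kappa> s = 0" and b: "\<And>s. s \<ge> 0 \<Longrightarrow> \<bar>\<kappa> s\<bar> \<le> b"
    and h0: "h0 > 0"
    and ev: "\<And>j. j \<in> J \<Longrightarrow> \<exists>m S C. (t j)\<^sup>2 = of_real m \<and> trig_pair m S C \<and> h0 \<le> integral {0..1} (\<lambda>s. \<kappa> s * S s)"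
  shows "(\<Sum>j\<in>J. (cmod (u j (hyp_orbit \<Gamma> P)))\<^sup>2) \<le> K * b\<^sup>2 / h0\<^sup>2"
proof -
  let ?p = "hyp_orbit \<Gamma> P"
  let ?\<rho> = "hdist P"
  define k where "k Q = \<kappa> (?\<rho> Q) / sinh (?\<rho> Q)" for Q
  have K: "K > 0" by (simp add: K_def add_nonneg_pos)
  have b0: "b \<ge> 0" using b[of 0] by linarith
  have sq: "\<And>j. square_integrable (orbit_vol \<Gamma>) (u j)"
    and on: "\<And>i j. (\<integral>x. u i x * cnj (u j x) \<partial>orbit_vol \<Gamma>) = (if i = j then 1 else 0)"
    and lap: "\<And>j. laplace_eigenfunction \<Gamma> (1 + (t j)\<^sup>2) (u j)"
    using sp by (simp_all add: spectral_system_def complete_orthonormal_def)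
  \<comment> \<open>The eigenvalue arises inside an existential over \<open>m\<close>,
    \<open>S\<close>, \<open>C\<close>. Isolating it as a number \<open>T\<close> allows one choice
    per index.\<close>
  define pr where "pr j T \<longleftrightarrow> h0 \<le> T \<and> integrable hyp_vol (\<lambda>Q. u j (hyp_orbit \<Gamma> Q) * of_real (k Q)) \<and>
      (\<integral>Q. u j (hyp_orbit \<Gamma> Q) * of_real (k Q) \<partial>hyp_vol) = of_real (4 * pi * T) * u j ?p" for j T
  have ex: "\<exists>T. pr j T" if j: "j \<in> J" for j
  proof -
    obtain m S C where m: "(t j)\<^sup>2 = of_real m" and tp: "trig_pair m S C" and T: "h0 \<le> integral {0..1} (\<lambda>s. \<kappa> s * S s)"
      using ev[OF j] by blast
    have C2: "C2_on hyp3 (u j \<circ> hyp_orbit \<Gamma>)"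
      and e: "\<And>Q. Q \<in> hyp3 \<Longrightarrow> - hyp_laplacian (u j \<circ> hyp_orbit \<Gamma>) Q = of_real (1 + m) * (u j \<circ> hyp_orbit \<Gamma>) Q"
      using lap[of j] m by (simp_all add: laplace_eigenfunction_def)
    have S: "\<And>x. (S has_real_derivative C x) (at x)" "\<And>x. (C has_real_derivative - m * S x) (at x)" "S 0 = 0" "C 0 = 1"
      using tp by (simp_all add: trig_pair_def)
    note mv = eigenfunction_mean_value[OF C2 P e S(1) S(2) S(3) S(4) \<kappa> \<kappa>1]
    show ?thesis
      using mv T by (intro exI[of _ "integral {0..1} (\<lambda>s. \<kappa> s * S s)"]) (simp add: k_def pr_def)
  qed
  define T where "T j = (SOME T. pr j T)" for j
  have "pr j (T j)" if "j \<in> J" for j using someI_ex[OF ex[OF that]] by (simp only: T_def)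
  then have T: "\<And>j. j \<in> J \<Longrightarrow> h0 \<le> T j"
    and Ti: "\<And>j. j \<in> J \<Longrightarrow> integrable hyp_vol (\<lambda>Q. u j (hyp_orbit \<Gamma> Q) * of_real (k Q))"
    and Te: "\<And>j. j \<in> J \<Longrightarrow> (\<integral>Q. u j (hyp_orbit \<Gamma> Q) * of_real (k Q) \<partial>hyp_vol) = of_real (4 * pi * T j) * u j ?p"
    by (simp_all add: pr_def)
  \<comment> \<open>With these coefficients \<open>X\<close> has two meanings: it is the squared
    norm of \<open>w\<close> by orthonormality, and it is the integral of \<open>W\<close> against
    the kernel by the mean value property.\<close>
  define c where "c j = of_real (4 * pi * T j) * cnj (u j ?p)" for j
  define w where "w x = (\<Sum>j\<in>J. c j * u j x)" for x
  define W where "W Q = w (hyp_orbit \<Gamma> Q)" for Q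
  define X where "X = (\<Sum>j\<in>J. (cmod (c j))\<^sup>2)"
  define B where "B = {Q \<in> hyp3. hcosh P Q \<le> cosh 1}"
  have [measurable]: "B \<in> sets borel" unfolding B_def by measurable
  have cW: "continuous_on hyp3 W"
  proof -
    have "continuous_on hyp3 (\<lambda>Q. u j (hyp_orbit \<Gamma> Q))" for j
      using lap[of j] C2_on_continuous(1)[of "u j \<circ> hyp_orbit \<Gamma>" "(0, 1)"]
      by (simp add: laplace_eigenfunction_def Basis_complex_real o_def)
    then show ?thesis unfolding W_def w_def by (intro continuous_intros)
  qed
  define f where "f Q = ennreal ((cmod (indicator hyp3 Q *\<^sub>R W Q))\<^sup>2)" for Q
  have fm [measurable]: "f \<in> borel_measurable borel"
    using indicator_continuous_borel[OF cW] unfolding f_def by measurable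
  have wm: "(\<lambda>x. ennreal ((cmod (w x))\<^sup>2)) \<in> borel_measurable (orbit_vol \<Gamma>)"
  proof -
    have [measurable]: "u j \<in> borel_measurable (orbit_vol \<Gamma>)" for j using sq by (simp add: square_integrable_def)
    show ?thesis unfolding w_def by measurable
  qed
  have nnX: "(\<integral>\<^sup>+x. ennreal ((cmod (w x))\<^sup>2) \<partial>orbit_vol \<Gamma>) = ennreal X"
    using integral_orthonormal_sum[where u = u and c = c, OF sq on J]
    by (subst nn_integral_eq_integral) (auto simp: w_def X_def)
  have "(\<integral>\<^sup>+Q. f Q * indicator B Q \<partial>hyp_vol)
      \<le> of_nat (card {A \<in> \<Union>\<Gamma>. \<exists>Q\<in>hyp3. hcosh P Q \<le> cosh 1 \<and> hcosh P (sl2_act A Q) \<le> cosh 1}) * (\<integral>\<^sup>+Q. f Q * indicator dom Q \<partial>hyp_vol)"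
    unfolding B_def
  proof (rule nn_integral_ball_le_dom[OF P fm])
    fix A Q assume A: "A \<in> \<Union>\<Gamma>" and Q: "Q \<in> hyp3"
    then show "f (sl2_act A Q) = f Q"
      using sl2_act_mem_hyp3[OF mem_lift(1)[OF A] Q] by (simp add: f_def W_def hyp_orbit_act)
  qed
  also have "(\<integral>\<^sup>+Q. f Q * indicator dom Q \<partial>hyp_vol) = (\<integral>\<^sup>+Q. ennreal ((cmod (w (hyp_orbit \<Gamma> Q)))\<^sup>2) * indicator dom Q \<partial>hyp_vol)"
    using dom_hyp3 by (intro nn_integral_cong) (auto simp: f_def W_def indicator_def)
  also have "\<dots> = ennreal X" using nn_integral_orbit_vol[OF wm] nnX by simp
  also have "of_nat (card {A \<in> \<Union>\<Gamma>. \<exists>Q\<in>hyp3. hcosh P Q \<le> cosh 1 \<and> hcosh P (sl2_act A Q) \<le> cosh 1}) * ennreal X \<le> ennreal K * ennreal X"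
    unfolding K_def by (intro mult_right_mono) (simp_all add: ennreal_of_nat_eq_real_of_nat)
  finally have nnB: "(\<integral>\<^sup>+Q. f Q * indicator B Q \<partial>hyp_vol) \<le> ennreal (K * X)"
    using K by (simp add: ennreal_mult' X_def sum_nonneg)
  have X0: "X \<ge> 0" by (simp add: X_def sum_nonneg)
  have fB: "f Q * indicator B Q = ennreal (indicator B Q * (cmod (W Q))\<^sup>2)" for Q
    by (auto simp: f_def B_def indicator_def)
  have mB: "(\<lambda>Q. indicator B Q * (cmod (W Q))\<^sup>2) \<in> borel_measurable hyp_vol"
  proof -
    have "(\<lambda>Q. indicator B Q * (cmod (W Q))\<^sup>2) = (\<lambda>Q. indicator B Q * (cmod (indicator hyp3 Q *\<^sub>R W Q))\<^sup>2)"
      by (auto simp: B_def indicator_def)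
    moreover have "(\<lambda>Q. indicator B Q * (cmod (indicator hyp3 Q *\<^sub>R W Q))\<^sup>2) \<in> borel_measurable hyp_vol"
      using indicator_continuous_borel[OF cW] by measurable
    ultimately show ?thesis by (simp only:)
  qed
  have iB: "integrable hyp_vol (\<lambda>Q. indicator B Q * (cmod (W Q))\<^sup>2)"
  proof (rule integrableI_nonneg[OF mB])
    show "(\<integral>\<^sup>+Q. ennreal (indicator B Q * (cmod (W Q))\<^sup>2) \<partial>hyp_vol) < \<infinity>"
      using nnB unfolding fB by (simp add: le_less_trans)
  qed auto
  have IB: "(\<integral>Q. indicator B Q * (cmod (W Q))\<^sup>2 \<partial>hyp_vol) \<le> K * X"
  proof -
    have "ennreal (\<integral>Q. indicator B Q * (cmod (W Q))\<^sup>2 \<partial>hyp_vol) = (\<integral>\<^sup>+Q. ennreal (indicator B Q * (cmod (W Q))\<^sup>2) \<partial>hyp_vol)"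
      by (rule nn_integral_eq_integral[OF iB, symmetric]) simp
    also have "\<dots> \<le> ennreal (K * X)" using nnB unfolding fB .
    finally show ?thesis using K X0 by (simp add: ennreal_le_iff)
  qed
  define g where "g r = (\<kappa> r / sinh r)\<^sup>2" for r
  have [measurable]: "\<kappa> \<in> borel_measurable borel" by (rule borel_measurable_continuous_onI[OF \<kappa>])
  have gm: "g \<in> borel_measurable borel" unfolding g_def by measurable
  let ?g = "\<lambda>r :: real. indicator {0..} r * (4 * pi * (sinh r)\<^sup>2 * g r)"
  \<comment> \<open>The volume density cancels the squared denominator of the kernel and leaves
    \<open>\<kappa> ^ 2\<close> on an interval of length \<open>1\<close>.\<close>
  have gb: "?g r \<le> 4 * pi * b\<^sup>2 * indicator {0..1} r"
    and g0: "?g r \<ge> 0" for r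
  proof -
    have "(\<kappa> r)\<^sup>2 \<le> b\<^sup>2" if "r \<ge> 0" using b[OF that] by (metis abs_ge_zero power2_abs power_mono)
    then have "(sinh r)\<^sup>2 * g r \<le> b\<^sup>2" if "r \<ge> 0" using that by (simp add: g_def power_divide)
    moreover have "g r = 0" if "r > 1" using \<kappa>1[of r] that by (simp add: g_def)
    ultimately show "?g r \<le> 4 * pi * b\<^sup>2 * indicator {0..1} r"
      by (auto simp: indicator_def mult.assoc)
    show "?g r \<ge> 0" by (simp add: g_def)
  qed
  have ig': "integrable lborel (\<lambda>r :: real. 4 * pi * b\<^sup>2 * indicator {0..1} r)" by simp
  have ig: "integrable lborel ?g"
  proof (rule Bochner_Integration.integrable_bound[OF ig'])
    show "?g \<in> borel_measurable lborel" using gm by measurable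
    show "AE r in lborel. norm (?g r) \<le> norm (4 * pi * b\<^sup>2 * indicator {0..1} r)"
      using gb g0 by (intro AE_I2) (metis abs_of_nonneg order_trans real_norm_def)
  qed
  have ik: "integrable hyp_vol (\<lambda>Q. (k Q)\<^sup>2)"
    using integrable_radial[OF P gm] ig by (simp add: k_def g_def)
  have Ik: "(\<integral>Q. (k Q)\<^sup>2 \<partial>hyp_vol) \<le> 4 * pi * b\<^sup>2"
  proof -
    have "(\<integral>Q. (k Q)\<^sup>2 \<partial>hyp_vol) = (\<integral>r. ?g r \<partial>lborel)"
      using integral_radial[OF P gm] by (simp add: k_def g_def)
    also have "\<dots> \<le> (\<integral>r. 4 * pi * b\<^sup>2 * indicator {0..1} (r :: real) \<partial>lborel)"
      by (rule integral_mono[OF ig ig' gb])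
    also have "\<dots> = 4 * pi * b\<^sup>2" by simp
    finally show ?thesis .
  qed
  have "complex_of_real X = (\<Sum>j\<in>J. c j * (of_real (4 * pi * T j) * u j ?p))"
    unfolding X_def of_real_sum
  proof (intro sum.cong refl)
    fix j
    have "complex_of_real ((cmod (c j))\<^sup>2) = c j * cnj (c j)" by (rule complex_norm_square)
    also have "cnj (c j) = of_real (4 * pi * T j) * u j ?p" by (simp add: c_def)
    finally show "complex_of_real ((cmod (c j))\<^sup>2) = c j * (of_real (4 * pi * T j) * u j ?p)" .
  qed
  also have "\<dots> = (\<Sum>j\<in>J. \<integral>Q. c j * (u j (hyp_orbit \<Gamma> Q) * of_real (k Q)) \<partial>hyp_vol)"
    by (intro sum.cong refl) (simp only: integral_mult_right_zero Te)
  also have "\<dots> = (\<integral>Q. (\<Sum>j\<in>J. c j * (u j (hyp_orbit \<Gamma> Q) * of_real (k Q))) \<partial>hyp_vol)"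
    by (rule Bochner_Integration.integral_sum[symmetric]) (intro integrable_mult_right Ti)
  also have "\<dots> = (\<integral>Q. W Q * of_real (k Q) \<partial>hyp_vol)"
    by (simp add: W_def w_def sum_distrib_right mult.assoc)
  finally have X: "complex_of_real X = (\<integral>Q. W Q * of_real (k Q) \<partial>hyp_vol)" .
  have iW: "integrable hyp_vol (\<lambda>Q. W Q * of_real (k Q))"
  proof -
    have "integrable hyp_vol (\<lambda>Q. (\<Sum>j\<in>J. c j * (u j (hyp_orbit \<Gamma> Q) * of_real (k Q))))"
      by (intro Bochner_Integration.integrable_sum integrable_mult_right Ti)
    then show ?thesis by (simp add: W_def w_def sum_distrib_right mult.assoc)
  qed
  have "X = cmod (complex_of_real X)" using X0 by simp
  \<comment> \<open>The weights \<open>K / 2\<close> and \<open>1 / (2 * K)\<close> are matched to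
    the bound \<open>K * X\<close> for the integral of the squared modulus of \<open>W\<close> over
    the ball: that part contributes \<open>X / 2\<close> and is absorbed on the left.\<close>
  also have "\<dots> \<le> (\<integral>Q. K / 2 * (k Q)\<^sup>2 + 1 / (2 * K) * (indicator B Q * (cmod (W Q))\<^sup>2) \<partial>hyp_vol)"
    unfolding X
  proof (rule Bochner_Integration.integral_norm_bound_integral[OF iW])
    show "integrable hyp_vol (\<lambda>Q. K / 2 * (k Q)\<^sup>2 + 1 / (2 * K) * (indicator B Q * (cmod (W Q))\<^sup>2))"
      by (intro Bochner_Integration.integrable_add integrable_mult_right ik iB)
    fix Q
    show "cmod (W Q * of_real (k Q)) \<le> K / 2 * (k Q)\<^sup>2 + 1 / (2 * K) * (indicator B Q * (cmod (W Q))\<^sup>2)"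
    proof (cases "Q \<in> B")
      case True
      have "0 \<le> (K * \<bar>k Q\<bar> - cmod (W Q))\<^sup>2 / (2 * K)" using K by simp
      also have "\<dots> = K / 2 * (k Q)\<^sup>2 + 1 / (2 * K) * (cmod (W Q))\<^sup>2 - cmod (W Q) * \<bar>k Q\<bar>"
        using K by (simp add: field_simps power2_eq_square abs_mult_self_eq)
      finally show ?thesis using True by (simp add: norm_mult)
    next
      case False
      have "k Q = 0"
      proof (cases "Q \<in> hyp3")
        case True
        then have "?\<rho> Q > 1" using False hdist_le_iff[OF P True, of 1] by (auto simp: B_def)
        then show ?thesis using \<kappa>1 by (simp add: k_def)
      qed (simp add: k_def hdist_outside[OF P])
      then show ?thesis using K by simp
    qed
  qed
  also have "\<dots> = K / 2 * (\<integral>Q. (k Q)\<^sup>2 \<partial>hyp_vol) + 1 / (2 * K) * (\<integral>Q. indicator B Q * (cmod (W Q))\<^sup>2 \<partial>hyp_vol)"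
    by (subst Bochner_Integration.integral_add)
       (simp_all only: integrable_mult_right[OF ik] integrable_mult_right[OF iB] integral_mult_right_zero)
  also have "\<dots> \<le> K / 2 * (4 * pi * b\<^sup>2) + 1 / (2 * K) * (K * X)"
    using K Ik IB by (intro add_mono mult_left_mono) auto
  also have "\<dots> = 2 * pi * K * b\<^sup>2 + X / 2" using K by simp
  finally have Xle: "X \<le> 4 * pi * K * b\<^sup>2" by simp
  have "16 * h0\<^sup>2 * (\<Sum>j\<in>J. (cmod (u j ?p))\<^sup>2) * pi * pi \<le> X"
  proof -
    have "16 * h0\<^sup>2 * (cmod (u j ?p))\<^sup>2 * pi * pi \<le> (cmod (c j))\<^sup>2" if "j \<in> J" for j
    proof -
      have "h0\<^sup>2 \<le> (T j)\<^sup>2" using T[OF that] h0 by (intro power_mono) auto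
      then have "h0\<^sup>2 * (16 * (cmod (u j ?p))\<^sup>2 * pi * pi) \<le> (T j)\<^sup>2 * (16 * (cmod (u j ?p))\<^sup>2 * pi * pi)"
        by (intro mult_right_mono) auto
      also have "\<dots> = (cmod (c j))\<^sup>2"
        by (simp add: c_def norm_mult power_mult_distrib power2_eq_square abs_mult_self_eq)
      finally show ?thesis by (simp add: mult_ac)
    qed
    then show ?thesis unfolding X_def sum_distrib_left sum_distrib_right by (intro sum_mono)
  qed
  then have "16 * h0\<^sup>2 * (\<Sum>j\<in>J. (cmod (u j ?p))\<^sup>2) * pi * pi \<le> 4 * pi * K * b\<^sup>2" using Xle by linarith
  then have le: "4 * h0\<^sup>2 * (\<Sum>j\<in>J. (cmod (u j ?p))\<^sup>2) * pi \<le> K * b\<^sup>2" by (simp add: mult_ac)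
  have "h0\<^sup>2 * (\<Sum>j\<in>J. (cmod (u j ?p))\<^sup>2) * 1 \<le> 4 * h0\<^sup>2 * (\<Sum>j\<in>J. (cmod (u j ?p))\<^sup>2) * pi"
    using pi_gt3 by (intro mult_mono) (auto intro!: mult_nonneg_nonneg sum_nonneg)
  with le have "(\<Sum>j\<in>J. (cmod (u j ?p))\<^sup>2) * h0\<^sup>2 \<le> K * b\<^sup>2" by (simp add: mult.commute)
  then show ?thesis using h0 by (simp add: pos_le_divide_eq)
qed

end

section \<open>Test kernels and lower bounds for their transforms\<close>

lemma trig_pair_real: "a \<noteq> 0 \<Longrightarrow> trig_pair (a\<^sup>2) (\<lambda>s. sin (a * s) / a) (\<lambda>s. cos (a * s))"
  unfolding trig_pair_def by (auto intro!: derivative_eq_intros simp: power2_eq_square)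

lemma trig_pair_imag: "a \<noteq> 0 \<Longrightarrow> trig_pair (- a\<^sup>2) (\<lambda>s. sinh (a * s) / a) (\<lambda>s. cosh (a * s))"
  unfolding trig_pair_def by (auto intro!: derivative_eq_intros simp: power2_eq_square)

lemma trig_pair_zero: "trig_pair 0 (\<lambda>s. s) (\<lambda>_. 1)"
  unfolding trig_pair_def by (auto intro!: derivative_eq_intros)

lemma cos_ge_half:
  fixes x :: real assumes x: "\<bar>x\<bar> \<le> 1" shows "cos x \<ge> 1 / 2"
proof -
  have "1 < pi / 3" using pi_gt3 by simp
  then have "cos (pi / 3) \<le> cos \<bar>x\<bar>" using x by (intro cos_monotone_0_pi_le) auto
  then show ?thesis by (simp add: cos_60)
qed

text \<open>From \<open>C \<ge> 1 / 2\<close> follows \<open>S s \<ge> s / 2\<close>, and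
  \<open>1 / 768\<close> is the integral of \<open>(1 / 4 - s) * (s / 2)\<close> over
  \<open>{0..1 / 4}\<close>. The width \<open>1 / 4\<close> suits real parameters up to
  \<open>4\<close>, for which the cosine has argument at most \<open>1\<close>.\<close>

lemma low_transform_lower_bound:
  assumes tp: "trig_pair m S C" and C: "\<And>s. 0 \<le> s \<Longrightarrow> s \<le> 1 / 4 \<Longrightarrow> C s \<ge> 1 / 2"
  shows "1 / 768 \<le> integral {0..1} (\<lambda>s. max 0 (1 / 4 - s) * S s)"
proof -
  have dS: "\<And>x. (S has_real_derivative C x) (at x)" and S0: "S 0 = 0" using tp by (auto simp: trig_pair_def)
  have cS: "continuous_on UNIV S" using dS by (meson DERIV_isCont continuous_at_imp_continuous_on)
  have Sge: "S s \<ge> s / 2" if "0 \<le> s" "s \<le> 1 / 4" for s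
  proof -
    have "(\<lambda>s. S s - s / 2) 0 \<le> (\<lambda>s. S s - s / 2) s"
    proof (rule DERIV_nonneg_imp_nondecreasing[OF that(1)])
      fix x assume x: "0 \<le> x" "x \<le> s"
      show "\<exists>y. ((\<lambda>s. S s - s / 2) has_real_derivative y) (at x) \<and> 0 \<le> y"
        using C[of x] x that by (intro exI[of _ "C x - 1 / 2"]) (auto intro!: derivative_eq_intros dS)
    qed
    then show ?thesis by (simp add: S0)
  qed
  let ?l = "\<lambda>s :: real. (1 / 4 - s) * (s / 2)"
  have hl: "(?l has_integral ((1 / 4)\<^sup>2 / 16 - (1 / 4) ^ 3 / 6) - (0\<^sup>2 / 16 - 0 ^ 3 / 6)) {0..1 / 4}"
    by (rule fundamental_theorem_of_calculus)
       (auto intro!: derivative_eq_intros has_vector_derivative_at_within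
         simp: has_real_derivative_iff_has_vector_derivative[symmetric] power2_eq_square field_simps)
  have cf: "continuous_on A (\<lambda>s. max 0 (1 / 4 - s) * S s)" for A
    by (intro continuous_intros continuous_on_subset[OF cS]) auto
  note ii = integrable_continuous_interval[OF cf]
  have "1 / 768 = integral {0..1 / 4} ?l" using integral_unique[OF hl] by (simp add: power2_eq_square power3_eq_cube)
  also have "\<dots> \<le> integral {0..1 / 4} (\<lambda>s. max 0 (1 / 4 - s) * S s)"
  proof (rule integral_le)
    show "?l integrable_on {0..1 / 4}" using hl by blast
    show "(\<lambda>s. max 0 (1 / 4 - s) * S s) integrable_on {0..1 / 4}" by (rule ii)
    show "?l s \<le> max 0 (1 / 4 - s) * S s" if "s \<in> {0..1 / 4}" for s
    proof -
      have "(1 / 4 - s) * (s / 2) \<le> (1 / 4 - s) * S s" using that Sge[of s] by (intro mult_left_mono) auto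
      then show ?thesis using that by simp
    qed
  qed
  also have "\<dots> = integral {0..1} (\<lambda>s. max 0 (1 / 4 - s) * S s)"
  proof -
    have "integral {1 / 4..1} (\<lambda>s. max 0 (1 / 4 - s) * S s) = integral {1 / 4..1} (\<lambda>_ :: real. 0)"
      by (intro integral_cong) auto
    then show ?thesis
      using Henstock_Kurzweil_Integration.integral_combine[of 0 "1 / 4" 1 "\<lambda>s. max 0 (1 / 4 - s) * S s"] ii[of 0 1] by simp
  qed
  finally show ?thesis .
qed

text \<open>The product of sines splits into a slow cosine of frequency at most \<open>1\<close>,
  contributing at least \<open>1 / 4\<close>, and a fast one of frequency \<open>q \<ge> 5\<close>,
  contributing at most \<open>2 / 25\<close>. The difference \<open>17 / 100\<close> is multiplied
  by \<open>\<tau> / (2 * a) \<ge> 3 / 8\<close>.\<close>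

lemma high_transform_lower_bound:
  fixes \<tau> a :: real
  assumes \<tau>: "\<tau> \<ge> 3" and a: "\<bar>a - \<tau>\<bar> \<le> 1"
  shows "1 / 16 \<le> integral {0..1} (\<lambda>s. \<tau> * sin (\<tau> * s) * max 0 (1 - s) * (sin (a * s) / a))"
proof -
  have a2: "a \<ge> 2" "a \<le> \<tau> + 1" using a \<tau> by auto
  define q where "q = \<tau> + a"
  have q: "q \<ge> 5" using \<tau> a by (auto simp: q_def)
  have h1: "((\<lambda>s :: real. (1 - s) * (1 / 2)) has_integral (1 / 2 - 1\<^sup>2 / 4) - (0 / 2 - 0\<^sup>2 / 4)) {0..1}"
    by (rule fundamental_theorem_of_calculus)
       (auto intro!: derivative_eq_intros has_vector_derivative_at_within
         simp: has_real_derivative_iff_has_vector_derivative[symmetric] field_simps)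
  have h2: "((\<lambda>s. (1 - s) * cos (q * s)) has_integral
      ((1 - 1) * sin (q * 1) / q - cos (q * 1) / q\<^sup>2) - ((1 - 0) * sin (q * 0) / q - cos (q * 0) / q\<^sup>2)) {0..1}"
  proof (rule fundamental_theorem_of_calculus)
    fix s :: real
    have "((\<lambda>s. (1 - s) * sin (q * s) / q - cos (q * s) / q\<^sup>2) has_real_derivative (1 - s) * cos (q * s)) (at s)"
      using q by (auto intro!: derivative_eq_intros simp: field_simps power2_eq_square)
    then show "((\<lambda>s. (1 - s) * sin (q * s) / q - cos (q * s) / q\<^sup>2) has_vector_derivative (1 - s) * cos (q * s)) (at s within {0..1})"
      by (simp add: has_real_derivative_iff_has_vector_derivative has_vector_derivative_at_within)
  qed simp
  have I1: "1 / 4 \<le> integral {0..1} (\<lambda>s. (1 - s) * cos ((\<tau> - a) * s))"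
  proof -
    have "1 / 4 = integral {0..1} (\<lambda>s :: real. (1 - s) * (1 / 2))" using integral_unique[OF h1] by simp
    also have "\<dots> \<le> integral {0..1} (\<lambda>s. (1 - s) * cos ((\<tau> - a) * s))"
    proof (rule integral_le)
      show "(\<lambda>s :: real. (1 - s) * (1 / 2)) integrable_on {0..1}" using h1 by blast
      show "(\<lambda>s. (1 - s) * cos ((\<tau> - a) * s)) integrable_on {0..1}"
        by (intro integrable_continuous_interval continuous_intros)
      fix s :: real assume s: "s \<in> {0..1}"
      have "\<bar>(\<tau> - a) * s\<bar> \<le> 1 * 1" unfolding abs_mult using a s by (intro mult_mono) auto
      then have "cos ((\<tau> - a) * s) \<ge> 1 / 2" by (intro cos_ge_half) simp
      then show "(1 - s) * (1 / 2) \<le> (1 - s) * cos ((\<tau> - a) * s)" using s by (intro mult_left_mono) auto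
    qed
    finally show ?thesis .
  qed
  have I2: "integral {0..1} (\<lambda>s. (1 - s) * cos (q * s)) \<le> 2 / 25"
  proof -
    have "integral {0..1} (\<lambda>s. (1 - s) * cos (q * s)) = (1 - cos q) / q\<^sup>2"
      using integral_unique[OF h2] by (simp add: diff_divide_distrib)
    also have "\<dots> \<le> 2 / q\<^sup>2" using cos_ge_minus_one[of q] by (intro divide_right_mono; linarith?) simp
    also have "\<dots> \<le> 2 / 5\<^sup>2" using q by (intro divide_left_mono power_mono) auto
    finally show ?thesis by simp
  qed
  have "integral {0..1} (\<lambda>s. \<tau> * sin (\<tau> * s) * max 0 (1 - s) * (sin (a * s) / a))
      = integral {0..1} (\<lambda>s. (\<tau> / (2 * a)) * ((1 - s) * cos ((\<tau> - a) * s) - (1 - s) * cos (q * s)))"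
  proof (rule integral_cong)
    fix s :: real assume s: "s \<in> {0..1}"
    have "2 * (sin (\<tau> * s) * sin (a * s)) = cos ((\<tau> - a) * s) - cos (q * s)"
      unfolding sin_times_sin q_def by (simp add: left_diff_distrib distrib_right)
    then have "(\<tau> / (2 * a)) * ((1 - s) * cos ((\<tau> - a) * s) - (1 - s) * cos (q * s)) = (\<tau> / (2 * a)) * ((1 - s) * (2 * (sin (\<tau> * s) * sin (a * s))))"
      by (simp add: right_diff_distrib)
    then show "\<tau> * sin (\<tau> * s) * max 0 (1 - s) * (sin (a * s) / a) = (\<tau> / (2 * a)) * ((1 - s) * cos ((\<tau> - a) * s) - (1 - s) * cos (q * s))"
      using s a2 by simp
  qed
  also have "\<dots> = (\<tau> / (2 * a)) * (integral {0..1} (\<lambda>s. (1 - s) * cos ((\<tau> - a) * s)) - integral {0..1} (\<lambda>s. (1 - s) * cos (q * s)))"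
    by (subst integral_mult_right, subst Henstock_Kurzweil_Integration.integral_diff)
       (auto intro!: integrable_continuous_interval continuous_intros)
  also have "\<dots> \<ge> (\<tau> / (2 * a)) * (17 / 100)"
    using I1 I2 \<tau> a2 by (intro mult_left_mono) auto
  moreover have "(\<tau> / (2 * a)) * (17 / 100) \<ge> 1 / 16"
  proof -
    have "\<tau> / (2 * a) \<ge> 3 / 8" using \<tau> a2 by (simp add: field_simps)
    then show ?thesis by simp
  qed
  ultimately show ?thesis by linarith
qed

context discrete_PSL2C
begin

text \<open>The window is treated according to \<open>\<tau>\<close>. Below \<open>3\<close> all
  real parameters in it are at most \<open>4\<close> in absolute value and share a kernel with the
  imaginary ones, whose \<open>C\<close> is a hyperbolic cosine and so at least \<open>1\<close>.
  From \<open>3\<close> on the oscillating kernel applies. \<open>D\<close> is obtained before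
  \<open>u\<close> and \<open>t\<close>.\<close>

theorem local_weyl_bound:
  assumes P: "P \<in> hyp3"
  obtains D where "D > 0"
    "\<And>u t J \<tau>. spectral_system \<Gamma> u t \<Longrightarrow> finite J \<Longrightarrow> \<tau> \<ge> 0 \<Longrightarrow>
       (\<And>j. j \<in> J \<Longrightarrow> Im (t j) = 0 \<and> \<bar>\<bar>Re (t j)\<bar> - \<tau>\<bar> \<le> 1) \<Longrightarrow>
       (\<Sum>j\<in>J. (cmod (u j (hyp_orbit \<Gamma> P)))\<^sup>2) \<le> D * (1 + \<tau>)\<^sup>2"
    "\<And>u t J. spectral_system \<Gamma> u t \<Longrightarrow> finite J \<Longrightarrow> (\<And>j. j \<in> J \<Longrightarrow> Re (t j) = 0) \<Longrightarrow>
       (\<Sum>j\<in>J. (cmod (u j (hyp_orbit \<Gamma> P)))\<^sup>2) \<le> D"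
proof -
  define K where "K = real (card {A \<in> \<Union>\<Gamma>. \<exists>Q\<in>hyp3. hcosh P Q \<le> cosh 1 \<and> hcosh P (sl2_act A Q) \<le> cosh 1}) + 1"
  have K: "K \<ge> 1" by (simp add: K_def)
  note bessel = kernel_bessel[OF P, folded K_def]
  have low: "(\<Sum>j\<in>J. (cmod (u j (hyp_orbit \<Gamma> P)))\<^sup>2) \<le> K * 768\<^sup>2"
    if sp: "spectral_system \<Gamma> u t" and J: "finite J" and t: "\<And>j. j \<in> J \<Longrightarrow> Re (t j) = 0 \<or> Im (t j) = 0 \<and> \<bar>Re (t j)\<bar> \<le> 4" for u t J
  proof -
    have "(\<Sum>j\<in>J. (cmod (u j (hyp_orbit \<Gamma> P)))\<^sup>2) \<le> K * 1\<^sup>2 / (1 / 768)\<^sup>2"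
    proof (rule bessel[OF sp J, where \<kappa> = "\<lambda>s. max 0 (1 / 4 - s)"])
      fix j assume j: "j \<in> J"
      have "\<exists>m S C. (t j)\<^sup>2 = of_real m \<and> trig_pair m S C \<and> (\<forall>s. 0 \<le> s \<longrightarrow> s \<le> 1 / 4 \<longrightarrow> C s \<ge> 1 / 2)"
      proof (cases "Re (t j) = 0")
        case True
        then have m: "(t j)\<^sup>2 = of_real (- (Im (t j))\<^sup>2)" by (simp add: complex_eq_iff power2_eq_square)
        show ?thesis
        proof (cases "Im (t j) = 0")
          case True
          then have "(t j)\<^sup>2 = of_real 0" using m by simp
          then show ?thesis using trig_pair_zero by (intro exI[of _ 0] exI[of _ "\<lambda>s. s"] exI[of _ "\<lambda>_. 1"]) simp
        next
          case False
          have "1 / 2 \<le> cosh x" for x :: real using cosh_real_ge_1[of x] by linarith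
          then show ?thesis using m trig_pair_imag[OF False] by blast
        qed
      next
        case False
        then have re: "Im (t j) = 0" "\<bar>Re (t j)\<bar> \<le> 4" using t[OF j] by auto
        then have "(t j)\<^sup>2 = of_real ((Re (t j))\<^sup>2)" by (simp add: complex_eq_iff power2_eq_square)
        moreover have "1 / 2 \<le> cos (Re (t j) * s)" if "0 \<le> s" "s \<le> 1 / 4" for s
        proof (rule cos_ge_half)
          have "\<bar>Re (t j) * s\<bar> \<le> 4 * (1 / 4)" unfolding abs_mult using re that by (intro mult_mono) auto
          then show "\<bar>Re (t j) * s\<bar> \<le> 1" by simp
        qed
        ultimately show ?thesis using trig_pair_real[OF False] by blast
      qed
      then obtain m S C where "(t j)\<^sup>2 = of_real m" "trig_pair m S C" "\<And>s. 0 \<le> s \<Longrightarrow> s \<le> 1 / 4 \<Longrightarrow> C s \<ge> 1 / 2" by blast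
      then show "\<exists>m S C. (t j)\<^sup>2 = of_real m \<and> trig_pair m S C \<and> 1 / 768 \<le> integral {0..1} (\<lambda>s. max 0 (1 / 4 - s) * S s)"
        using low_transform_lower_bound by blast
    qed (auto intro!: continuous_intros)
    then show ?thesis by (simp add: power_divide)
  qed
  have high: "(\<Sum>j\<in>J. (cmod (u j (hyp_orbit \<Gamma> P)))\<^sup>2) \<le> K * 256 * \<tau>\<^sup>2"
    if sp: "spectral_system \<Gamma> u t" and J: "finite J" and \<tau>: "\<tau> \<ge> 3"
      and t: "\<And>j. j \<in> J \<Longrightarrow> Im (t j) = 0 \<and> \<bar>\<bar>Re (t j)\<bar> - \<tau>\<bar> \<le> 1" for u t J \<tau>
  proof -
    have "(\<Sum>j\<in>J. (cmod (u j (hyp_orbit \<Gamma> P)))\<^sup>2) \<le> K * \<tau>\<^sup>2 / (1 / 16)\<^sup>2"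
    proof (rule bessel[OF sp J, where \<kappa> = "\<lambda>s. \<tau> * sin (\<tau> * s) * max 0 (1 - s)"])
      show "continuous_on UNIV (\<lambda>s. \<tau> * sin (\<tau> * s) * max 0 (1 - s))" by (intro continuous_intros)
      show "\<bar>\<tau> * sin (\<tau> * s) * max 0 (1 - s)\<bar> \<le> \<tau>" if "s \<ge> 0" for s
      proof -
        have "\<bar>\<tau> * sin (\<tau> * s) * max 0 (1 - s)\<bar> \<le> \<tau> * 1 * 1"
          unfolding abs_mult using \<tau> that by (intro mult_mono) auto
        then show ?thesis by simp
      qed
      fix j assume j: "j \<in> J"
      have re: "Im (t j) = 0" and ab: "\<bar>\<bar>Re (t j)\<bar> - \<tau>\<bar> \<le> 1" using t[OF j] by auto
      have "(t j)\<^sup>2 = of_real (\<bar>Re (t j)\<bar>\<^sup>2)" using re by (simp add: complex_eq_iff power2_eq_square)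
      moreover have "\<bar>Re (t j)\<bar> \<noteq> 0" using ab \<tau> by auto
      ultimately show "\<exists>m S C. (t j)\<^sup>2 = of_real m \<and> trig_pair m S C \<and>
          1 / 16 \<le> integral {0..1} (\<lambda>s. \<tau> * sin (\<tau> * s) * max 0 (1 - s) * S s)"
        using trig_pair_real high_transform_lower_bound[OF \<tau> ab] by blast
    qed auto
    then show ?thesis by (simp add: power_divide)
  qed
  show ?thesis
  proof (rule that[of "K * 768\<^sup>2"])
    show "K * 768\<^sup>2 > 0" using K by simp
    fix u t J assume sp: "spectral_system \<Gamma> u t" and J: "finite (J :: nat set)"
    show "(\<Sum>j\<in>J. (cmod (u j (hyp_orbit \<Gamma> P)))\<^sup>2) \<le> K * 768\<^sup>2" if "\<And>j. j \<in> J \<Longrightarrow> Re (t j) = 0"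
      using low[OF sp J] that by blast
    fix \<tau> :: real assume \<tau>: "\<tau> \<ge> 0" and t: "\<And>j. j \<in> J \<Longrightarrow> Im (t j) = 0 \<and> \<bar>\<bar>Re (t j)\<bar> - \<tau>\<bar> \<le> 1"
    show "(\<Sum>j\<in>J. (cmod (u j (hyp_orbit \<Gamma> P)))\<^sup>2) \<le> K * 768\<^sup>2 * (1 + \<tau>)\<^sup>2"
    proof (cases "\<tau> \<ge> 3")
      case True
      have "K * 256 * \<tau>\<^sup>2 \<le> K * 768\<^sup>2 * (1 + \<tau>)\<^sup>2"
        using K \<tau> by (intro mult_mono power_mono) auto
      then show ?thesis using high[OF sp J True t] by linarith
    next
      case False
      have "\<bar>Re (t j)\<bar> \<le> 4" if "j \<in> J" for j using t[OF that] False by linarith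
      then have "(\<Sum>j\<in>J. (cmod (u j (hyp_orbit \<Gamma> P)))\<^sup>2) \<le> K * 768\<^sup>2 * 1" using low[OF sp J] t by simp
      also have "\<dots> \<le> K * 768\<^sup>2 * (1 + \<tau>)\<^sup>2"
        using K \<tau> by (intro mult_left_mono) (auto simp: one_le_power)
      finally show ?thesis .
    qed
  qed
qed

end

section \<open>The spectral large sieve\<close>

text \<open>Rounding changes the distance \<open>d\<close> by at most \<open>1\<close>, and
  \<open>3 * (1 + d ^ 2)\<close> exceeds \<open>1 + (d + 1) ^ 2\<close> by
  \<open>(d - 1) ^ 2 + d ^ 2\<close>.\<close>

lemma inverse_square_floor:
  fixes x y :: real
  shows "1 / (1 + (x - y)\<^sup>2) \<le> 3 / (1 + (of_int (\<lfloor>y\<rfloor> - \<lfloor>x\<rfloor>))\<^sup>2)"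
proof -
  define d where "d = \<bar>x - y\<bar>"
  define e :: real where "e = of_int (\<lfloor>y\<rfloor> - \<lfloor>x\<rfloor>)"
  have "\<bar>e\<bar> \<le> d + 1" unfolding e_def d_def by linarith
  then have "e\<^sup>2 \<le> (d + 1)\<^sup>2" by (metis abs_ge_zero power2_abs power_mono)
  moreover have "0 \<le> (d - 1)\<^sup>2 + d\<^sup>2" by simp
  ultimately have le: "1 + e\<^sup>2 \<le> 3 * (1 + d\<^sup>2)" by (simp add: power2_eq_square algebra_simps)
  have "1 / (1 + d\<^sup>2) = (3 * 1) / (3 * (1 + d\<^sup>2))"
    by (rule mult_divide_mult_cancel_left[symmetric]) simp
  also have "(3 * 1) / (3 * (1 + d\<^sup>2)) \<le> (3 * 1) / (1 + e\<^sup>2)"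
    using le by (intro divide_left_mono mult_pos_pos add_pos_nonneg) auto
  finally show ?thesis by (simp add: d_def e_def)
qed

text \<open>Frequencies are grouped by integer part. The constant is \<open>9 * 3 * 5\<close>: the
  square of \<open>1 + |n| \<le> 3 * T\<close>, the loss from rounding, and the sum of
  \<open>1 / (1 + n ^ 2)\<close> over integers.\<close>

lemma weighted_weyl_bound:
  fixes v t :: "'j \<Rightarrow> real"
  assumes J: "finite J" and v: "\<And>l. l \<in> J \<Longrightarrow> v l \<ge> 0" and T: "T \<ge> 1" and t: "\<And>l. l \<in> J \<Longrightarrow> \<bar>t l\<bar> \<le> T"
    and D: "D \<ge> 0" and loc: "\<And>n. (\<Sum>l\<in>{l \<in> J. \<lfloor>t l\<rfloor> = n}. v l) \<le> D * (1 + \<bar>of_int n\<bar>)\<^sup>2"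
  shows "(\<Sum>l\<in>J. v l / (1 + (x - t l)\<^sup>2)) \<le> 135 * D * T\<^sup>2"
proof -
  define N where "N = (\<lambda>l. \<lfloor>t l\<rfloor>) ` J"
  have N: "finite N" using J by (simp add: N_def)
  define m where "m = \<lfloor>x\<rfloor>"
  have "(\<Sum>l\<in>J. v l / (1 + (x - t l)\<^sup>2)) = (\<Sum>n\<in>N. \<Sum>l\<in>{l \<in> J. \<lfloor>t l\<rfloor> = n}. v l / (1 + (x - t l)\<^sup>2))"
    by (rule sum.group[symmetric, OF J N]) (simp add: N_def)
  also have "\<dots> \<le> (\<Sum>n\<in>N. 27 * D * T\<^sup>2 * (1 / (1 + (of_int (n - m))\<^sup>2)))"
  proof (rule sum_mono)
    fix n assume n: "n \<in> N"
    then obtain l0 where l0: "l0 \<in> J" "n = \<lfloor>t l0\<rfloor>" by (auto simp: N_def)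
    have "\<bar>real_of_int n\<bar> \<le> T + 1" using t[OF l0(1)] l0(2) by linarith
    then have n3: "1 + \<bar>real_of_int n\<bar> \<le> 3 * T" using T by linarith
    have "(\<Sum>l\<in>{l \<in> J. \<lfloor>t l\<rfloor> = n}. v l / (1 + (x - t l)\<^sup>2)) \<le> (\<Sum>l\<in>{l \<in> J. \<lfloor>t l\<rfloor> = n}. v l * (3 / (1 + (of_int (n - m))\<^sup>2)))"
    proof (rule sum_mono)
      fix l assume l: "l \<in> {l \<in> J. \<lfloor>t l\<rfloor> = n}"
      then have "v l * (1 / (1 + (x - t l)\<^sup>2)) \<le> v l * (3 / (1 + (of_int (n - m))\<^sup>2))"
        using v inverse_square_floor[of x "t l"] by (intro mult_left_mono) (auto simp: m_def)
      then show "v l / (1 + (x - t l)\<^sup>2) \<le> v l * (3 / (1 + (of_int (n - m))\<^sup>2))" by simp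
    qed
    also have "\<dots> = (\<Sum>l\<in>{l \<in> J. \<lfloor>t l\<rfloor> = n}. v l) * (3 / (1 + (of_int (n - m))\<^sup>2))"
      by (rule sum_distrib_right[symmetric])
    also have "\<dots> \<le> (D * (3 * T)\<^sup>2) * (3 / (1 + (of_int (n - m))\<^sup>2))"
    proof (rule mult_right_mono)
      have "D * (1 + \<bar>of_int n\<bar>)\<^sup>2 \<le> D * (3 * T)\<^sup>2" using D n3 by (intro mult_left_mono power_mono) auto
      then show "(\<Sum>l\<in>{l \<in> J. \<lfloor>t l\<rfloor> = n}. v l) \<le> D * (3 * T)\<^sup>2" using loc[of n] by linarith
    qed (auto intro!: divide_nonneg_nonneg add_nonneg_nonneg)
    also have "\<dots> = 27 * D * T\<^sup>2 * (1 / (1 + (of_int (n - m))\<^sup>2))" by (simp add: power_mult_distrib)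
    finally show "(\<Sum>l\<in>{l \<in> J. \<lfloor>t l\<rfloor> = n}. v l / (1 + (x - t l)\<^sup>2)) \<le> 27 * D * T\<^sup>2 * (1 / (1 + (of_int (n - m))\<^sup>2))" .
  qed
  also have "\<dots> = 27 * D * T\<^sup>2 * (\<Sum>n\<in>N. 1 / (1 + (of_int (n - m))\<^sup>2))" by (rule sum_distrib_left[symmetric])
  also have "\<dots> \<le> 27 * D * T\<^sup>2 * 5"
    using D by (intro mult_left_mono sum_inverse_one_plus_square_int N mult_nonneg_nonneg) auto
  finally show ?thesis by simp
qed

text \<open>Schur's test after symmetrising: each product is at most half of
  \<open>\<alpha> j ^ 2 * \<beta> l ^ 2\<close> plus the same with \<open>j\<close> and
  \<open>l\<close> exchanged. The factors \<open>\<beta>\<close>, later the moduli of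
  \<open>u j p\<close>, go into the row sums where the Weyl bound applies, and the coefficients stay
  outside.\<close>

lemma mean_square_schur:
  fixes c :: "'j \<Rightarrow> complex" and t \<alpha> \<beta> :: "'j \<Rightarrow> real"
  assumes J: "finite J" and c: "\<And>j. j \<in> J \<Longrightarrow> cmod (c j) \<le> \<alpha> j * \<beta> j"
    and W: "\<And>j. j \<in> J \<Longrightarrow> (\<Sum>l\<in>J. (\<beta> l)\<^sup>2 / (1 + (t j - t l)\<^sup>2)) \<le> W"
  shows "(\<integral>y. indicator {-1..1} y * (cmod (\<Sum>j\<in>J. c j * exp (\<i> * of_real (t j * y))))\<^sup>2 \<partial>lborel) \<le> 8 * W * (\<Sum>j\<in>J. (\<alpha> j)\<^sup>2)"
proof -
  let ?w = "\<lambda>j l. 1 / (1 + (t j - t l)\<^sup>2)"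
  have w: "?w j l \<ge> 0" for j l by (intro divide_nonneg_nonneg add_nonneg_nonneg) auto
  have sym: "?w j l = ?w l j" for j l by (simp add: power2_commute)
  have half: "(p + q) / 2 * s = (p * s + q * s) / 2" for p q s :: real by (simp add: distrib_right)
  let ?Z = "\<Sum>j\<in>J. \<Sum>l\<in>J. (\<alpha> j)\<^sup>2 * (\<beta> l)\<^sup>2 * ?w j l"
  have "(\<Sum>j\<in>J. \<Sum>l\<in>J. cmod (c j) * cmod (c l) / (1 + (t j - t l)\<^sup>2))
      \<le> (\<Sum>j\<in>J. \<Sum>l\<in>J. ((\<alpha> j)\<^sup>2 * (\<beta> l)\<^sup>2 * ?w j l + (\<alpha> l)\<^sup>2 * (\<beta> j)\<^sup>2 * ?w l j) / 2)"
  proof (intro sum_mono)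
    fix j l assume jl: "j \<in> J" "l \<in> J"
    have "cmod (c j) * cmod (c l) \<le> (\<alpha> j * \<beta> j) * (\<alpha> l * \<beta> l)"
      using c[OF jl(1)] c[OF jl(2)] by (intro mult_mono) (auto intro: order_trans[OF norm_ge_zero])
    also have "\<dots> \<le> ((\<alpha> j)\<^sup>2 * (\<beta> l)\<^sup>2 + (\<alpha> l)\<^sup>2 * (\<beta> j)\<^sup>2) / 2"
      using zero_le_power2[of "\<alpha> j * \<beta> l - \<alpha> l * \<beta> j"] by (simp add: power2_eq_square algebra_simps)
    finally have le: "cmod (c j) * cmod (c l) \<le> ((\<alpha> j)\<^sup>2 * (\<beta> l)\<^sup>2 + (\<alpha> l)\<^sup>2 * (\<beta> j)\<^sup>2) / 2" .
    have "cmod (c j) * cmod (c l) / (1 + (t j - t l)\<^sup>2) = cmod (c j) * cmod (c l) * ?w j l" by simp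
    also have "\<dots> \<le> ((\<alpha> j)\<^sup>2 * (\<beta> l)\<^sup>2 + (\<alpha> l)\<^sup>2 * (\<beta> j)\<^sup>2) / 2 * ?w j l"
      by (rule mult_right_mono[OF le w])
    also have "\<dots> = ((\<alpha> j)\<^sup>2 * (\<beta> l)\<^sup>2 * ?w j l + (\<alpha> l)\<^sup>2 * (\<beta> j)\<^sup>2 * ?w j l) / 2"
      by (rule half)
    finally show "cmod (c j) * cmod (c l) / (1 + (t j - t l)\<^sup>2) \<le> ((\<alpha> j)\<^sup>2 * (\<beta> l)\<^sup>2 * ?w j l + (\<alpha> l)\<^sup>2 * (\<beta> j)\<^sup>2 * ?w l j) / 2"
      unfolding sym[of l j] .
  qed
  also have "\<dots> = (?Z + (\<Sum>j\<in>J. \<Sum>l\<in>J. (\<alpha> l)\<^sup>2 * (\<beta> j)\<^sup>2 * ?w l j)) / 2"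
    by (simp only: sum_divide_distrib[symmetric] sum.distrib)
  also have "(\<Sum>j\<in>J. \<Sum>l\<in>J. (\<alpha> l)\<^sup>2 * (\<beta> j)\<^sup>2 * ?w l j) = ?Z" by (rule sum.swap)
  also have "(?Z + ?Z) / 2 = ?Z" by simp
  also have "?Z = (\<Sum>j\<in>J. (\<alpha> j)\<^sup>2 * (\<Sum>l\<in>J. (\<beta> l)\<^sup>2 / (1 + (t j - t l)\<^sup>2)))"
    by (simp add: sum_distrib_left mult_ac)
  also have "\<dots> \<le> (\<Sum>j\<in>J. (\<alpha> j)\<^sup>2 * W)" using W by (intro sum_mono mult_left_mono) auto
  also have "\<dots> = W * (\<Sum>j\<in>J. (\<alpha> j)\<^sup>2)" by (simp add: sum_distrib_left mult.commute)
  finally show ?thesis using mean_square_exponential_sum[OF J, of c t] by linarith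
qed

theorem theorem6:
  fixes \<Gamma> :: "(complex^2^2) set set" and p :: "(complex \<times> real) set"
  assumes "discrete_subgroup \<Gamma>" and "cocompact \<Gamma>" and "p \<in> orbit_space \<Gamma>"
  shows "\<exists>C>0. \<forall>u t. spectral_system \<Gamma> u t \<longrightarrow>
    (\<forall>(X::real) (T::real) (\<epsilon>::real) (R::nat) (x :: nat \<Rightarrow> real) (a :: nat \<Rightarrow> complex).
       X > 1 \<and> T > 1 \<and> \<epsilon> > 0 \<and>
       (\<forall>k\<in>{1..R}. x k \<in> {X..2 * X}) \<and>
       (\<forall>k\<in>{1..R}. \<forall>l\<in>{1..R}. k \<noteq> l \<longrightarrow> \<bar>x k - x l\<bar> > \<epsilon>) \<longrightarrow>
       (\<Sum>k = 1..R. (cmod (\<Sum>j | cmod (t j) \<le> T.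
            a j * complex_of_real (x k) powr (\<i> * t j) * u j p))\<^sup>2)
       \<le> C * (T ^ 3 + X * T\<^sup>2 / \<epsilon>) * (\<Sum>j | cmod (t j) \<le> T. (cmod (a j))\<^sup>2))"
proof -
  interpret discrete_PSL2C \<Gamma> by unfold_locales fact
  obtain P where P: "P \<in> hyp3" and p: "p = hyp_orbit \<Gamma> P" using assms(3) by (auto simp: orbit_space_def)
  obtain D where D: "D > 0"
    and weyl: "\<And>u t J \<tau>. spectral_system \<Gamma> u t \<Longrightarrow> finite J \<Longrightarrow> \<tau> \<ge> 0 \<Longrightarrow>
       (\<And>j. j \<in> J \<Longrightarrow> Im (t j) = 0 \<and> \<bar>\<bar>Re (t j)\<bar> - \<tau>\<bar> \<le> 1) \<Longrightarrow> (\<Sum>j\<in>J. (cmod (u j p))\<^sup>2) \<le> D * (1 + \<tau>)\<^sup>2"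
    and weyl_im: "\<And>u t J. spectral_system \<Gamma> u t \<Longrightarrow> finite J \<Longrightarrow> (\<And>j. j \<in> J \<Longrightarrow> Re (t j) = 0) \<Longrightarrow>
       (\<Sum>j\<in>J. (cmod (u j p))\<^sup>2) \<le> D"
    using local_weyl_bound[OF P, folded p] by metis
  \<comment> \<open>Built from \<open>D\<close> alone, before any spectral system is fixed. The
    parts \<open>16 * (135 * D)\<close> and \<open>2 * D\<close> come from real and imaginary
    parameters; one factor \<open>2\<close> comes from the square of a sum of two terms, another
    from replacing \<open>1 / \<delta>\<close> by \<open>X / \<epsilon>\<close>.\<close>
  define C where "C = 2 * (2 * (16 * (135 * D))) + 8 * D"
  have main: "(\<Sum>k = 1..R. (cmod (\<Sum>j | cmod (t j) \<le> T. a j * complex_of_real (x k) powr (\<i> * t j) * u j p))\<^sup>2)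
       \<le> C * (T ^ 3 + X * T\<^sup>2 / \<epsilon>) * (\<Sum>j | cmod (t j) \<le> T. (cmod (a j))\<^sup>2)"
    if sp: "spectral_system \<Gamma> u t" and X: "X > 1" and T: "T > 1" and e: "\<epsilon> > 0"
      and x: "\<And>k. k \<in> {1..R} \<Longrightarrow> x k \<in> {X..2 * X}"
      and sep: "\<And>k l. k \<in> {1..R} \<Longrightarrow> l \<in> {1..R} \<Longrightarrow> k \<noteq> l \<Longrightarrow> \<bar>x k - x l\<bar> > \<epsilon>"
    for u t X T \<epsilon> and R :: nat and x a
  proof (cases "finite {j. cmod (t j) \<le> T}")
    case False
    \<comment> \<open>Sums over an infinite index set are \<open>0\<close> by convention, so both
      sides vanish.\<close>
    then show ?thesis by simp
  next
    case fin: True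
    define J where "J = {j. cmod (t j) \<le> T}"
    define J1 where "J1 = {j \<in> J. Im (t j) = 0}"
    define J2 where "J2 = {j \<in> J. Im (t j) \<noteq> 0}"
    have fJ: "finite J" "finite J1" "finite J2" using fin by (simp_all add: J_def J1_def J2_def)
    have J12: "J = J1 \<union> J2" "J1 \<inter> J2 = {}" by (auto simp: J1_def J2_def)
    define A where "A = (\<Sum>j\<in>J. (cmod (a j))\<^sup>2)"
    have A0: "A \<ge> 0" by (simp add: A_def sum_nonneg)
    have A12: "(\<Sum>j\<in>J1. (cmod (a j))\<^sup>2) \<le> A" "(\<Sum>j\<in>J2. (cmod (a j))\<^sup>2) \<le> A"
      unfolding A_def using fJ J12 by (auto intro!: sum_mono2)
    have t2: "Re (t j) = 0" "Im (t j) > 0" if "j \<in> J2" for j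
      using sp that by (auto simp: spectral_system_def J2_def less_le)
    define r where "r j = Re (t j)" for j
    have t1: "t j = of_real (r j)" "\<bar>r j\<bar> \<le> T" if "j \<in> J1" for j
      using that abs_Re_le_cmod[of "t j"] by (auto simp: J1_def J_def r_def complex_eq_iff)
    have xpos: "x k > 0" "x k \<ge> 1" if "k \<in> {1..R}" for k using x[OF that] X by auto
    have powr: "complex_of_real (x k) powr (\<i> * s) = exp (\<i> * s * of_real (ln (x k)))" if "k \<in> {1..R}" for k s
      using xpos[OF that] by (simp add: powr_def Ln_of_real)
    \<comment> \<open>The shift by \<open>1\<close> puts the logarithms between \<open>-1\<close>
      and \<open>ln 2 - 1\<close>; windows of length at most \<open>1\<close> to their right then
      stay inside \<open>{-1..1}\<close>, the interval of the mean square bound.\<close>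
    define y where "y k = ln (x k) - ln X - 1" for k
    \<comment> \<open>By \<open>ln s \<le> s - 1\<close>, points more than \<open>\<epsilon>\<close>
      apart and at most \<open>2 * X\<close> have logarithms more than
      \<open>\<epsilon> / (2 * X)\<close> apart. The minimum with \<open>1\<close> keeps the windows
      inside the interval.\<close>
    define \<delta> where "\<delta> = min 1 (\<epsilon> / (2 * X))"
    have \<delta>: "\<delta> > 0" "\<delta> \<le> 1" using e X by (auto simp: \<delta>_def)
    have \<delta>i: "1 / \<delta> \<le> 1 + 2 * X / \<epsilon>"
    proof (cases "\<epsilon> / (2 * X) \<le> 1")
      case True
      then have "\<delta> = \<epsilon> / (2 * X)" by (simp add: \<delta>_def)
      then show ?thesis by simp
    next
      case False
      then have "\<delta> = 1" by (simp add: \<delta>_def)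
      then show ?thesis using X e by simp
    qed
    have rng: "-1 \<le> y k \<and> y k + \<delta> \<le> 1" if "k \<in> {1..R}" for k
    proof -
      have "ln X \<le> ln (x k)" using x[OF that] X by simp
      moreover have "ln (x k) \<le> ln (2 * X)" using x[OF that] X xpos[OF that] by simp
      moreover have "ln (2 * X) = ln 2 + ln X" using X by (simp add: ln_mult)
      moreover have "ln 2 \<le> (1 :: real)" using ln_le_minus_one[of "2 :: real"] by simp
      ultimately show ?thesis using \<delta> by (simp add: y_def)
    qed
    have sepy: "\<bar>y k - y l\<bar> > \<delta>" if k: "k \<in> {1..R}" and l: "l \<in> {1..R}" and kl: "k \<noteq> l" for k l
    proof -
      have gap: "ln p - ln q > \<delta>" if pq: "q > 0" "p \<le> 2 * X" "p - q > \<epsilon>" for p q :: real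
      proof -
        have p: "p > 0" using pq e by linarith
        have "ln q - ln p = ln (q / p)" using pq p by (simp add: ln_div)
        also have "\<dots> \<le> q / p - 1" using pq p by (intro ln_le_minus_one) simp
        also have "\<dots> = - ((p - q) / p)" using p by (simp add: field_simps)
        finally have "(p - q) / p \<le> ln p - ln q" by simp
        moreover have "(p - q) / p > \<epsilon> / p" using pq p by (intro divide_strict_right_mono)
        moreover have "\<epsilon> / p \<ge> \<epsilon> / (2 * X)" using pq p e by (intro divide_left_mono) auto
        moreover have "\<epsilon> / (2 * X) \<ge> \<delta>" by (simp add: \<delta>_def)
        ultimately show ?thesis by linarith
      qed
      have "x k - x l > \<epsilon> \<or> x l - x k > \<epsilon>" using sep[OF k l kl] by linarith
      then show ?thesis
        using gap[of "x l" "x k"] gap[of "x k" "x l"] x[OF k] x[OF l] xpos[OF k] xpos[OF l]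
        by (auto simp: y_def)
    qed
    have T0: "T > 0" using T by simp
    \<comment> \<open>Undoing the shift by \<open>ln X + 1\<close> costs a phase of modulus
      \<open>1\<close>, which is absorbed into the coefficient.\<close>
    define c where "c j = a j * u j p * exp (\<i> * of_real (r j * (ln X + 1)))" for j
    define S where "S v = (\<Sum>j\<in>J1. c j * exp (\<i> * of_real (r j * v)))" for v :: real
    define S' where "S' v = (\<Sum>j\<in>J1. (\<i> * of_real (r j) * c j) * exp (\<i> * of_real (r j * v)))" for v :: real
    define V where "V k = (\<Sum>j\<in>J2. a j * complex_of_real (x k) powr (\<i> * t j) * u j p)" for k
    have inner: "(\<Sum>j\<in>J. a j * complex_of_real (x k) powr (\<i> * t j) * u j p) = S (y k) + V k" if k: "k \<in> {1..R}" for k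
    proof -
      have "(\<Sum>j\<in>J1. a j * complex_of_real (x k) powr (\<i> * t j) * u j p) = S (y k)"
        unfolding S_def
      proof (intro sum.cong refl)
        fix j assume j: "j \<in> J1"
        have "complex_of_real (x k) powr (\<i> * t j) = exp (\<i> * of_real (r j * (ln X + 1)) + \<i> * of_real (r j * y k))"
          unfolding powr[OF k] t1(1)[OF j] by (simp add: y_def algebra_simps)
        then show "a j * complex_of_real (x k) powr (\<i> * t j) * u j p = c j * exp (\<i> * of_real (r j * y k))"
          by (simp only: exp_add c_def mult_ac)
      qed
      then show ?thesis unfolding J12(1) V_def using fJ J12(2) by (simp add: sum.union_disjoint)
    qed
    have dS: "(S has_vector_derivative S' v) (at v)" for v
    proof -
      have "((\<lambda>z. \<Sum>j\<in>J1. c j * exp (\<i> * (of_real (r j) * z))) has_field_derivative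
          (\<Sum>j\<in>J1. (\<i> * of_real (r j) * c j) * exp (\<i> * (of_real (r j) * of_real v)))) (at (of_real v))"
        by (auto intro!: derivative_eq_intros sum.cong simp: mult_ac)
      then have "((\<lambda>v. \<Sum>j\<in>J1. c j * exp (\<i> * (of_real (r j) * of_real v))) has_vector_derivative
          (\<Sum>j\<in>J1. (\<i> * of_real (r j) * c j) * exp (\<i> * (of_real (r j) * of_real v)))) (at v)"
        by (rule has_vector_derivative_real_field)
      then show ?thesis by (simp add: S_def[abs_def] S'_def)
    qed
    have cS': "continuous_on UNIV S'" unfolding S'_def by (intro continuous_intros)
    have W: "(\<Sum>l\<in>J1. (cmod (u l p))\<^sup>2 / (1 + (z - r l)\<^sup>2)) \<le> 135 * D * T\<^sup>2" for z
    proof (rule weighted_weyl_bound[OF fJ(2)])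
      fix n :: int
      show "(\<Sum>l\<in>{l \<in> J1. \<lfloor>r l\<rfloor> = n}. (cmod (u l p))\<^sup>2) \<le> D * (1 + \<bar>of_int n\<bar>)\<^sup>2"
      proof (rule weyl[OF sp])
        fix j assume "j \<in> {l \<in> J1. \<lfloor>r l\<rfloor> = n}"
        then have j: "j \<in> J1" "\<lfloor>r j\<rfloor> = n" by auto
        \<comment> \<open>Windows of \<open>r j\<close> are signed while the Weyl bound concerns
          absolute values; taking absolute values does not increase the distance.\<close>
        have "\<bar>\<bar>r j\<bar> - \<bar>of_int n\<bar>\<bar> \<le> 1" using j(2) by linarith
        then show "Im (t j) = 0 \<and> \<bar>\<bar>Re (t j)\<bar> - \<bar>real_of_int n\<bar>\<bar> \<le> 1" using j(1) by (simp add: r_def J1_def)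
      qed (use fJ in auto)
    qed (use T D t1 in auto)
    have cb: "cmod (c j) \<le> cmod (a j) * cmod (u j p)" for j
      by (simp add: c_def norm_mult)
    have I1: "(\<integral>v. indicator {-1..1} v * (cmod (S v))\<^sup>2 \<partial>lborel) \<le> 8 * (135 * D * T\<^sup>2) * A"
    proof -
      have "(\<integral>v. indicator {-1..1} v * (cmod (S v))\<^sup>2 \<partial>lborel) \<le> 8 * (135 * D * T\<^sup>2) * (\<Sum>j\<in>J1. (cmod (a j))\<^sup>2)"
        unfolding S_def by (rule mean_square_schur[OF fJ(2) cb W])
      also have "\<dots> \<le> 8 * (135 * D * T\<^sup>2) * A" using D A12 by (intro mult_left_mono) auto
      finally show ?thesis .
    qed
    have I2: "(\<integral>v. indicator {-1..1} v * (cmod (S' v))\<^sup>2 \<partial>lborel) \<le> 8 * (135 * D * T\<^sup>2) * (T\<^sup>2 * A)"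
    proof -
      have "(\<integral>v. indicator {-1..1} v * (cmod (S' v))\<^sup>2 \<partial>lborel) \<le> 8 * (135 * D * T\<^sup>2) * (\<Sum>j\<in>J1. (T * cmod (a j))\<^sup>2)"
        unfolding S'_def
      proof (rule mean_square_schur[OF fJ(2) _ W])
        fix j assume j: "j \<in> J1"
        have "cmod (\<i> * of_real (r j) * c j) = \<bar>r j\<bar> * cmod (c j)" by (simp add: norm_mult)
        also have "\<dots> \<le> T * (cmod (a j) * cmod (u j p))" using t1(2)[OF j] cb T0 by (intro mult_mono) auto
        finally show "cmod (\<i> * of_real (r j) * c j) \<le> T * cmod (a j) * cmod (u j p)" by (simp add: mult_ac)
      qed
      also have "(\<Sum>j\<in>J1. (T * cmod (a j))\<^sup>2) = T\<^sup>2 * (\<Sum>j\<in>J1. (cmod (a j))\<^sup>2)"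
        by (simp add: power_mult_distrib sum_distrib_left)
      also have "8 * (135 * D * T\<^sup>2) * (T\<^sup>2 * (\<Sum>j\<in>J1. (cmod (a j))\<^sup>2)) \<le> 8 * (135 * D * T\<^sup>2) * (T\<^sup>2 * A)"
        using D A12 by (intro mult_left_mono) auto
      finally show ?thesis .
    qed
    have B1: "(\<Sum>k = 1..R. (cmod (S (y k)))\<^sup>2) \<le> 16 * (135 * D) * A * (T\<^sup>2 / \<delta> + T ^ 3)"
    proof -
      have "(\<Sum>k = 1..R. (cmod (S (y k)))\<^sup>2) \<le> (1 / \<delta> + T) * (\<integral>v. indicator {-1..1} v * (cmod (S v))\<^sup>2 \<partial>lborel)
          + (\<integral>v. indicator {-1..1} v * (cmod (S' v))\<^sup>2 \<partial>lborel) / T"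
        by (rule gallagher[OF dS cS' \<delta>(1) T0 _ sepy rng]) auto
      also have "\<dots> \<le> (1 / \<delta> + T) * (8 * (135 * D * T\<^sup>2) * A) + (8 * (135 * D * T\<^sup>2) * (T\<^sup>2 * A)) / T"
        using \<delta>(1) T0 by (intro add_mono mult_left_mono divide_right_mono I1 I2) auto
      also have "\<dots> = 8 * (135 * D) * A * (T\<^sup>2 / \<delta>) + 16 * (135 * D) * A * T ^ 3"
        using T0 \<delta>(1) by (simp add: field_simps power2_eq_square power3_eq_cube)
      also have "\<dots> \<le> 16 * (135 * D) * A * (T\<^sup>2 / \<delta>) + 16 * (135 * D) * A * T ^ 3"
        using D A0 \<delta>(1) by (intro add_right_mono mult_right_mono) auto
      finally show ?thesis by (simp add: distrib_left)
    qed
    have Vb: "(cmod (V k))\<^sup>2 \<le> D * A" if k: "k \<in> {1..R}" for k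
    proof -
      have "cmod (V k) \<le> (\<Sum>j\<in>J2. cmod (a j) * cmod (u j p))"
        unfolding V_def
      proof (rule sum_norm_le)
        fix j assume j: "j \<in> J2"
        have "t j = \<i> * of_real (Im (t j))" using t2(1)[OF j] by (simp add: complex_eq_iff)
        then have "\<i> * t j * of_real (ln (x k)) = of_real (- (Im (t j) * ln (x k)))"
          by (simp add: complex_eq_iff t2(1)[OF j])
        then have "cmod (complex_of_real (x k) powr (\<i> * t j)) = exp (- (Im (t j) * ln (x k)))"
          unfolding powr[OF k] by (simp only: norm_exp_eq_Re Re_complex_of_real)
        \<comment> \<open>The exponent is nonpositive by the sign convention for \<open>t\<close> in
          \<open>spectral_system\<close> and by \<open>x k \<ge> 1\<close>.\<close>
        also have "\<dots> \<le> 1" using t2(2)[OF j] xpos[OF k] by (simp add: less_imp_le)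
        finally have le: "cmod (complex_of_real (x k) powr (\<i> * t j)) \<le> 1" .
        have "cmod (a j * complex_of_real (x k) powr (\<i> * t j) * u j p)
            = cmod (a j) * cmod (complex_of_real (x k) powr (\<i> * t j)) * cmod (u j p)" by (simp only: norm_mult)
        also have "\<dots> \<le> cmod (a j) * 1 * cmod (u j p)"
          using le by (intro mult_right_mono mult_left_mono) auto
        finally show "cmod (a j * complex_of_real (x k) powr (\<i> * t j) * u j p) \<le> cmod (a j) * cmod (u j p)" by simp
      qed
      then have "(cmod (V k))\<^sup>2 \<le> (\<Sum>j\<in>J2. cmod (a j) * cmod (u j p))\<^sup>2" by (intro power_mono) auto
      also have "\<dots> \<le> (\<Sum>j\<in>J2. (cmod (a j))\<^sup>2) * (\<Sum>j\<in>J2. (cmod (u j p))\<^sup>2)" by (rule Cauchy_Schwarz_ineq_sum)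
      also have "\<dots> \<le> A * D" using A12 A0 weyl_im[OF sp fJ(3) t2(1)] by (intro mult_mono sum_nonneg) auto
      finally show ?thesis by (simp add: mult.commute)
    qed
    \<comment> \<open>Gallagher's lemma for the constant function \<open>1\<close> counts the
      points: its integral over \<open>{-1..1}\<close> is \<open>2\<close> and its derivative is
      \<open>0\<close>.\<close>
    have R: "real R \<le> 2 * (T\<^sup>2 / \<delta> + T ^ 3)"
    proof -
      have "real R \<le> (1 / \<delta> + T) * 2"
        using gallagher[where f = "\<lambda>_. 1" and f' = "\<lambda>_. 0" and A = "{1..R}" and y = y and a = "-1" and b = 1,
            OF _ _ \<delta>(1) T0 _ sepy rng] by (simp add: content_real)
      also have "\<dots> \<le> (T\<^sup>2 / \<delta> + T ^ 3) * 2"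
      proof -
        have "T ^ 1 \<le> T ^ 3" using T by (intro power_increasing) auto
        moreover have "1 / \<delta> \<le> T\<^sup>2 / \<delta>" using T \<delta>(1) by (intro divide_right_mono) (auto simp: one_le_power)
        ultimately show ?thesis by (intro mult_right_mono add_mono) auto
      qed
      finally show ?thesis by (simp only: mult.commute)
    qed
    have B2: "(\<Sum>k = 1..R. (cmod (V k))\<^sup>2) \<le> 2 * D * A * (T\<^sup>2 / \<delta> + T ^ 3)"
    proof -
      have "(\<Sum>k = 1..R. (cmod (V k))\<^sup>2) \<le> (\<Sum>k = 1..R. D * A)" by (intro sum_mono Vb)
      also have "\<dots> = real R * (D * A)" by simp
      also have "\<dots> \<le> 2 * (T\<^sup>2 / \<delta> + T ^ 3) * (D * A)" using R D A0 by (intro mult_right_mono) auto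
      finally show ?thesis by (simp add: mult_ac)
    qed
    have TT: "T\<^sup>2 / \<delta> + T ^ 3 \<le> 2 * (T ^ 3 + X * T\<^sup>2 / \<epsilon>)"
    proof -
      have "T\<^sup>2 / \<delta> = T\<^sup>2 * (1 / \<delta>)" by simp
      also have "\<dots> \<le> T\<^sup>2 * (1 + 2 * X / \<epsilon>)" using \<delta>i by (intro mult_left_mono) auto
      also have "\<dots> = T\<^sup>2 + 2 * (X * T\<^sup>2 / \<epsilon>)" by (simp add: algebra_simps)
      finally have "T\<^sup>2 / \<delta> \<le> T\<^sup>2 + 2 * (X * T\<^sup>2 / \<epsilon>)" .
      moreover have "T\<^sup>2 \<le> T ^ 3" using T by (intro power_increasing) auto
      ultimately show ?thesis by simp
    qed
    have "(\<Sum>k = 1..R. (cmod (\<Sum>j\<in>J. a j * complex_of_real (x k) powr (\<i> * t j) * u j p))\<^sup>2)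
        \<le> (\<Sum>k = 1..R. 2 * (cmod (S (y k)))\<^sup>2 + 2 * (cmod (V k))\<^sup>2)"
    proof (rule sum_mono)
      fix k assume k: "k \<in> {1..R}"
      have "(cmod (S (y k) + V k))\<^sup>2 \<le> (cmod (S (y k)) + cmod (V k))\<^sup>2"
        by (intro power_mono norm_triangle_ineq) auto
      also have "\<dots> \<le> 2 * (cmod (S (y k)))\<^sup>2 + 2 * (cmod (V k))\<^sup>2"
        using zero_le_power2[of "cmod (S (y k)) - cmod (V k)"] by (simp add: power2_eq_square algebra_simps)
      finally show "(cmod (\<Sum>j\<in>J. a j * complex_of_real (x k) powr (\<i> * t j) * u j p))\<^sup>2 \<le> 2 * (cmod (S (y k)))\<^sup>2 + 2 * (cmod (V k))\<^sup>2"
        unfolding inner[OF k] .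
    qed
    also have "\<dots> = 2 * (\<Sum>k = 1..R. (cmod (S (y k)))\<^sup>2) + 2 * (\<Sum>k = 1..R. (cmod (V k))\<^sup>2)"
      by (simp add: sum.distrib sum_distrib_left)
    also have "\<dots> \<le> (2 * (16 * (135 * D)) + 4 * D) * A * (T\<^sup>2 / \<delta> + T ^ 3)"
    proof -
      define q where "q = T\<^sup>2 / \<delta> + T ^ 3"
      have "(2 * (16 * (135 * D)) + 4 * D) * A * q = 2 * (16 * (135 * D) * A * q) + 2 * (2 * D * A * q)"
        by (simp add: algebra_simps)
      then show ?thesis using B1 B2 unfolding q_def[symmetric] by linarith
    qed
    also have "\<dots> \<le> (2 * (16 * (135 * D)) + 4 * D) * A * (2 * (T ^ 3 + X * T\<^sup>2 / \<epsilon>))"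
      using D A0 TT by (intro mult_left_mono) auto
    also have "\<dots> = C * (T ^ 3 + X * T\<^sup>2 / \<epsilon>) * A" by (simp add: C_def algebra_simps)
    finally show ?thesis by (simp add: A_def J_def)
  qed
  show ?thesis
  proof (intro exI[of _ C] conjI allI impI)
    show "C > 0" using D by (simp add: C_def)
  qed (intro main; simp)
qed

end
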